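(* Let $\ell$ be a positive integer, let $f_1,\dots,f_k$ be $\mathbb{Q}$-linearly independent pseudo-polynomials, let $A=(a_{ij})$ be an arbitrary $\ell\times k$ matrix with real entries and let $N\in\mathbb{N}$. Then there is an exponent $\eta>0$ depending only on $\ell$ and on $f_1,\dots,f_k$ such that \[\min_{1\le n\le N}\max_{1\le i\le\ell}\Big\lVert\sum_{j=1}^k a_{ij}\lfloor f_j(n)\rfloor\Big\rVert\ll_{\ell,f_1,\dots,f_k}N^{-\eta},\] where the bound is uniform in $A$.
   Context: A pseudo-polynomial is a function $f(x)=\alpha_1x^{\theta_1}+\cdots+\alpha_dx^{\theta_d}$ where $\alpha_1,\dots,\alpha_d,\theta_1,\dots,\theta_d$ are positive reals with $1\le\theta_1<\cdots<\theta_d$ and at least one $\theta_j\notin\mathbb{Z}$. $\lVert x\rVert$ denotes the distance from $x$ to the nearest integer, and $\lfloor\cdot\rfloor$ the floor function. *)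

theory Defs
  imports Complex_Main
begin

definition dist_int :: "real \<Rightarrow> real" where
  "dist_int x = \<bar>x - of_int (round x)\<bar>"

definition pseudo_poly :: "(real \<Rightarrow> real) \<Rightarrow> bool" where
  "pseudo_poly f \<longleftrightarrow>
     (\<exists>(d::nat) (\<alpha>::nat \<Rightarrow> real) (\<theta>::nat \<Rightarrow> real).
        d \<ge> 1 \<and>
        (\<forall>j\<in>{1..d}. \<alpha> j > 0) \<and>
        1 \<le> \<theta> 1 \<and>
        strict_mono_on {1..d} \<theta> \<and>
        (\<exists>j\<in>{1..d}. \<theta> j \<notin> \<int>) \<and>
        (\<forall>x>0. f x = (\<Sum>j=1..d. \<alpha> j * x powr \<theta> j)))"

definition Q_lin_indep :: "nat \<Rightarrow> (nat \<Rightarrow> real \<Rightarrow> real) \<Rightarrow> bool" where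
  "Q_lin_indep k f \<longleftrightarrow>
     (\<forall>c::nat \<Rightarrow> rat. (\<forall>x>0. (\<Sum>j=1..k. of_rat (c j) * f j x) = 0)
        \<longrightarrow> (\<forall>j\<in>{1..k}. c j = 0))"

end

theory Submission
  imports Defs "HOL-Analysis.Analysis"
begin

text \<open>
  Since the floors are integers, the entries of \<open>A\<close> may be reduced to \<open>[0, 1)\<close>. Let \<open>p\<^sub>j > 0\<close> be
  the sum of the coefficients of the non-integral exponents of \<open>f\<^sub>j\<close>. If \<open>n\<close> is such that
  \<open>f\<^sub>j(n)\<close> is close to \<open>p\<^sub>j / M\<close> modulo 1 for all \<open>j\<close> and \<open>\<Sum>\<^sub>j a\<^sub>i\<^sub>j f\<^sub>j(n)\<close> is close to
  \<open>\<Sum>\<^sub>j a\<^sub>i\<^sub>j p\<^sub>j / M\<close> modulo 1 for all \<open>i\<close>, then no floor jumps and \<open>\<Sum>\<^sub>j a\<^sub>i\<^sub>j \<lfloor>f\<^sub>j(n)\<rfloor>\<close> is close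
  to an integer. It therefore suffices to find such an \<open>n\<close>, of size polynomial in \<open>M\<close>, for finitely many
  generalised polynomials with bounded but otherwise arbitrary real coefficients.

  If no \<open>n\<close> in a range works, a Fourier kernel produces an integer combination of the coordinates
  with a large exponential sum. By Weyl differencing its coefficients are nearly rational with small
  denominator (integral exponents) or nearly zero (non-integral exponents). This relation eliminates
  one coordinate on a shorter range, and one concludes by induction on the number of coordinates.
  Integral exponents are first removed one degree at a time by passing to multiples of a suitable \<open>q\<close>.
  For non-integral exponents the phase is replaced by a Taylor polynomial on a block whose length
  is chosen such that only the leading coefficient has to be analysed.
\<close>

section \<open>Distance to the nearest integer and exponentials\<close>

text \<open>The floor is discontinuous exactly where one would like \<open>f\<^sub>j(n)\<close> to
  be: a value near 0 modulo 1 may lie just below an integer, and the floor is then off by one. Hence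
  the nonzero target \<open>p\<^sub>j / M\<close>, which for large \<open>M\<close> is at least the
  approximation error \<open>1 / M ^ 2\<close> and still tends to 0. Integral exponents meet
  arithmetic obstructions to nonzero targets, so they aim at 0 and only the non-integral ones carry
  the shift; positivity of the coefficients gives \<open>p\<^sub>j > 0\<close>. As the matrix is
  arbitrary, the coordinates may satisfy exact or approximate integer relations, and the targets
  must respect them. Being values of one linear form on the coefficient vectors, they inherit every
  such relation. The remaining difficulty is uniformity: eliminating a coordinate rescales the
  others by powers of a denominator that grows with the range. Their admissible size is therefore a
  power of the range itself, with an exponent prescribed before the range is chosen. Every size and
  error is a power of \<open>M\<close>, and this becomes a power saving in \<open>N\<close>.\<close>

lemma dist_int_le: "dist_int x \<le> \<bar>x - of_int m\<bar>"
  unfolding dist_int_def by (metis abs_minus_commute round_diff_minimal)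

lemma dist_int_nonneg: "0 \<le> dist_int x"
  by (simp add: dist_int_def)

lemma dist_int_le_half: "dist_int x \<le> 1 / 2"
  unfolding dist_int_def using of_int_round_abs_le[of x] by (simp add: abs_minus_commute)

lemma dist_int_obtain: obtains m :: int where "dist_int x = \<bar>x - of_int m\<bar>"
  by (simp add: dist_int_def)

lemma dist_int_le_abs: "dist_int x \<le> \<bar>x\<bar>"
  using dist_int_le[of x 0] by simp

lemma dist_int_add: "dist_int (x + y) \<le> dist_int x + dist_int y"
proof -
  obtain m n where "dist_int x = \<bar>x - of_int m\<bar>" "dist_int y = \<bar>y - of_int n\<bar>"
    using dist_int_obtain by metis
  then show ?thesis using dist_int_le[of "x + y" "m + n"] by simp
qed

lemma dist_int_add_Ints: assumes "z \<in> \<int>" shows "dist_int (x + z) = dist_int x"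
proof -
  obtain m where m: "z = of_int m" using assms Ints_cases by metis
  obtain a where a: "dist_int x = \<bar>x - of_int a\<bar>" using dist_int_obtain .
  obtain b where b: "dist_int (x + z) = \<bar>x + z - of_int b\<bar>" using dist_int_obtain .
  have "dist_int (x + z) \<le> dist_int x" using dist_int_le[of "x + z" "a + m"] a m by simp
  moreover have "dist_int x \<le> dist_int (x + z)"
    using dist_int_le[of x "b - m"] b m by (simp add: algebra_simps)
  ultimately show ?thesis by simp
qed

lemma dist_int_mult_int: "dist_int (of_int k * x) \<le> \<bar>of_int k\<bar> * dist_int x"
proof -
  obtain m where m: "dist_int x = \<bar>x - of_int m\<bar>" using dist_int_obtain .
  have "\<bar>of_int k * x - of_int (k * m)\<bar> = \<bar>of_int k\<bar> * \<bar>x - of_int m\<bar>"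
    by (simp add: abs_mult[symmetric] algebra_simps)
  then show ?thesis using dist_int_le[of "of_int k * x" "k * m"] m by simp
qed

lemma dist_int_mult_nat: "dist_int (real k * x) \<le> real k * dist_int x"
  using dist_int_mult_int[of "int k" x] by simp

lemma dist_int_eq_abs: assumes "\<bar>x\<bar> \<le> 1 / 2" shows "dist_int x = \<bar>x\<bar>"
proof (rule antisym)
  obtain m where m: "dist_int x = \<bar>x - of_int m\<bar>" using dist_int_obtain .
  show "\<bar>x\<bar> \<le> dist_int x"
  proof (cases "m = 0")
    case False
    then have "\<bar>real_of_int m\<bar> \<ge> 1" by linarith
    then show ?thesis using m assms by linarith
  qed (use m in simp)
qed (rule dist_int_le_abs)

lemma dist_int_0 [simp]: "dist_int 0 = 0"
  by (simp add: dist_int_def)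

lemma dist_int_sum: "dist_int (\<Sum>a\<in>A. g a) \<le> (\<Sum>a\<in>A. dist_int (g a))"
proof (induction A rule: infinite_finite_induct)
  case (insert a A)
  then show ?case using dist_int_add[of "g a" "\<Sum>a\<in>A. g a"] by simp
qed auto

section \<open>The additive character \<open>expi\<close> and its geometric sums\<close>

definition expi :: "real \<Rightarrow> complex" where
  "expi x = cis (2 * pi * x)"

lemma norm_expi [simp]: "norm (expi x) = 1"
  by (simp add: expi_def)

lemma expi_add: "expi (x + y) = expi x * expi y"
  by (simp add: expi_def cis_mult algebra_simps)

lemma expi_0 [simp]: "expi 0 = 1"
  by (simp add: expi_def)

lemma expi_diff: "expi (x - y) = expi x * cnj (expi y)"
  by (simp add: expi_def cis_cnj cis_mult algebra_simps)

lemma expi_power: "expi x ^ n = expi (real n * x)"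
  by (simp add: expi_def Complex.DeMoivre mult.assoc mult.left_commute)

lemma expi_sum: "finite A \<Longrightarrow> expi (\<Sum>a\<in>A. g a) = (\<Prod>a\<in>A. expi (g a))"
  by (induction A rule: finite_induct) (auto simp: expi_add)

lemma norm_one_minus_expi: "norm (1 - expi x) = 2 * \<bar>sin (pi * x)\<bar>"
proof -
  have "norm (1 - expi x) ^ 2 = (1 - cos (2 * (pi * x)))\<^sup>2 + (sin (2 * (pi * x)))\<^sup>2"
    by (simp add: expi_def cmod_power2 mult.assoc)
  also have "\<dots> = 2 - 2 * cos (2 * (pi * x))"
    using sin_cos_squared_add[of "2 * (pi * x)"] by (simp add: power2_eq_square algebra_simps)
  also have "\<dots> = (2 * \<bar>sin (pi * x)\<bar>)\<^sup>2"
    by (simp only: cos_double_sin) (simp add: power_mult_distrib)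
  finally show ?thesis by (rule power2_eq_imp_eq) auto
qed

text \<open>Jordan's inequality: the concave sine lies above its chord from 0 to
  \<open>pi / 2\<close>.\<close>

lemma two_mult_le_sin_pi: assumes "0 \<le> x" "x \<le> 1 / 2" shows "2 * x \<le> sin (pi * x)"
proof -
  have "concave_on {0..pi} sin"
  proof -
    have "convex_on {0..pi} (\<lambda>x. - sin x)"
      by (rule f''_ge0_imp_convex[where f' = "\<lambda>x. - cos x" and f'' = sin])
         (auto intro!: derivative_eq_intros sin_ge_zero)
    then show ?thesis by (simp add: concave_on_def)
  qed
  moreover have "0 \<le> 2 * x" "2 * x \<le> 1" using assms by auto
  ultimately have "(1 - 2 * x) * sin 0 + (2 * x) * sin (pi / 2) \<le> sin ((1 - 2 * x) * 0 + (2 * x) * (pi / 2))"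
    using concave_onD[of "{0..pi}" sin "2 * x" 0 "pi / 2"] by simp
  then show ?thesis by (simp add: mult.commute)
qed

lemma dist_int_le_sin: "2 * dist_int x \<le> \<bar>sin (pi * x)\<bar>"
proof -
  obtain m where m: "dist_int x = \<bar>x - of_int m\<bar>" using dist_int_obtain .
  have "\<bar>sin (pi * x)\<bar> = \<bar>sin (pi * (x - of_int m))\<bar>"
  proof -
    have "\<bar>cos (pi * of_int m)\<bar> = 1"
      using sin_cos_squared_add[of "pi * of_int m"] by (simp add: abs_square_eq_1)
    then show ?thesis by (simp add: right_diff_distrib sin_diff abs_mult)
  qed
  also have "\<dots> = \<bar>sin (pi * \<bar>x - of_int m\<bar>)\<bar>"
    by (metis abs_if abs_minus_cancel mult_minus_right sin_minus)
  finally have "\<bar>sin (pi * x)\<bar> = \<bar>sin (pi * dist_int x)\<bar>" using m by simp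
  then show ?thesis
    using two_mult_le_sin_pi[OF dist_int_nonneg dist_int_le_half, of x] by linarith
qed

lemma dist_int_le_norm_expi: "4 * dist_int x \<le> norm (1 - expi x)"
  using dist_int_le_sin[of x] by (simp add: norm_one_minus_expi)

lemma norm_expi_diff_le: "norm (expi x - expi y) \<le> 2 * pi * \<bar>x - y\<bar>"
proof -
  have "expi x - expi y = - expi y * (1 - expi (x - y))"
    by (simp add: expi_add[symmetric] algebra_simps)
  then have "norm (expi x - expi y) = norm (1 - expi (x - y))"
    by (simp add: norm_mult)
  also have "\<dots> \<le> 2 * \<bar>pi * (x - y)\<bar>"
    unfolding norm_one_minus_expi using abs_sin_x_le_abs_x by simp
  finally show ?thesis by (simp add: abs_mult)
qed

text \<open>The closed form has a numerator of norm at most 2 and a denominator of norm at least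
  \<open>4 * dist_int a\<close>. The product form also covers integral \<open>a\<close>, where the
  denominator vanishes.\<close>

lemma geometric_expi_bound: "norm (\<Sum>y<L. expi (b + a * real y)) * dist_int a \<le> 1 / 2"
proof -
  have "(\<Sum>y<L. expi (b + a * real y)) = expi b * (\<Sum>y<L. expi a ^ y)"
    by (simp add: expi_add expi_power sum_distrib_left mult.commute)
  moreover have "(1 - expi a) * (\<Sum>y<L. expi a ^ y) = 1 - expi a ^ L"
    by (simp add: one_diff_power_eq)
  ultimately have "norm (1 - expi a) * norm (\<Sum>y<L. expi (b + a * real y)) = norm (1 - expi a ^ L)"
    by (metis norm_mult norm_expi mult_1)
  also have "\<dots> \<le> 2"
    using norm_triangle_ineq4[of 1 "expi a ^ L"] by (simp add: norm_power)
  finally have "norm (1 - expi a) * norm (\<Sum>y<L. expi (b + a * real y)) \<le> 2" .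
  moreover have "4 * dist_int a * norm (\<Sum>y<L. expi (b + a * real y)) \<le> norm (1 - expi a) * norm (\<Sum>y<L. expi (b + a * real y))"
    by (intro mult_right_mono dist_int_le_norm_expi) auto
  ultimately show ?thesis by (simp add: mult.commute)
qed

section \<open>Weyl differencing\<close>

text \<open>All \<open>H\<close> translates of the zero-padded sequence have the same sum, so
  \<open>H\<close> times this sum is a sum of window sums over only \<open>L + H\<close> positions.
  Cauchy-Schwarz over the positions and expansion of the square leave the autocorrelations
  \<open>c\<close>.\<close>

lemma van_der_Corput_inequality:
  fixes u :: "nat \<Rightarrow> complex" and L H :: nat
  defines "c \<equiv> \<lambda>h. \<Sum>y<L - h. u (y + h) * cnj (u y)"
  shows "(real H * norm (\<Sum>y<L. u y))\<^sup>2
           \<le> real (L + H) * (\<Sum>i<H. \<Sum>j<H. norm (c (if j \<le> i then i - j else j - i)))"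
proof -
  \<comment> \<open>The offset \<open>H\<close> keeps the whole support inside
    \<open>z < L + H\<close> after every shift by \<open>j < H\<close>.\<close>
  define w where "w = (\<lambda>z. if H \<le> z \<and> z < H + L then u (z - H) else 0)"
  define S where "S = (\<Sum>y<L. u y)"
  have shift: "(\<Sum>z<L + H. w (z + j)) = S" if "j < H" for j
  proof -
    have "(\<Sum>z<L + H. w (z + j)) = (\<Sum>z\<in>{H - j..<H - j + L}. w (z + j))"
      by (rule sum.mono_neutral_right) (use that in \<open>auto simp: w_def\<close>)
    also have "\<dots> = S"
      unfolding S_def
      by (rule sum.reindex_bij_witness[where i = "\<lambda>y. y + (H - j)" and j = "\<lambda>z. z - (H - j)"])
         (use that in \<open>auto simp: w_def\<close>)
    finally show ?thesis .
  qed
  have corr: "(\<Sum>z<L + H. w (z + i) * cnj (w (z + j))) = c (i - j)" if "j \<le> i" "i < H" for i j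
  proof -
    have "(\<Sum>z<L + H. w (z + i) * cnj (w (z + j)))
            = (\<Sum>z\<in>{H - j..<H - j + (L - (i - j))}. w (z + i) * cnj (w (z + j)))"
      by (rule sum.mono_neutral_right) (use that in \<open>auto simp: w_def\<close>)
    also have "\<dots> = c (i - j)"
      unfolding c_def
      by (rule sum.reindex_bij_witness[where i = "\<lambda>y. y + (H - j)" and j = "\<lambda>z. z - (H - j)"])
         (use that in \<open>auto simp: w_def\<close>)
    finally show ?thesis .
  qed
  have norm_corr: "norm (\<Sum>z<L + H. w (z + i) * cnj (w (z + j)))
      = norm (c (if j \<le> i then i - j else j - i))" if "i < H" "j < H" for i j
  proof (cases "j \<le> i")
    case False
    have "(\<Sum>z<L + H. w (z + i) * cnj (w (z + j))) = cnj (\<Sum>z<L + H. w (z + j) * cnj (w (z + i)))"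
      by (simp add: mult.commute)
    also have "\<dots> = cnj (c (j - i))" using corr[of i j] False that by simp
    finally show ?thesis using False by simp
  qed (use corr that in simp)
  have "of_nat H * S = (\<Sum>z<L + H. \<Sum>j<H. w (z + j))"
    by (subst sum.swap) (simp add: shift)
  then have "real H * norm S = norm (\<Sum>z<L + H. \<Sum>j<H. w (z + j))"
    by (metis norm_mult norm_of_nat)
  also have "\<dots> \<le> (\<Sum>z<L + H. norm (\<Sum>j<H. w (z + j)))"
    by (rule norm_sum)
  finally have "(real H * norm S)\<^sup>2 \<le> (\<Sum>z<L + H. norm (\<Sum>j<H. w (z + j)))\<^sup>2"
    by (rule power_mono) simp
  also have "\<dots> \<le> real (L + H) * (\<Sum>z<L + H. (norm (\<Sum>j<H. w (z + j)))\<^sup>2)"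
    using Cauchy_Schwarz_ineq_sum[of "\<lambda>_. 1" "\<lambda>z. norm (\<Sum>j<H. w (z + j))" "{..<L + H}"] by simp
  also have "(\<Sum>z<L + H. (norm (\<Sum>j<H. w (z + j)))\<^sup>2)
      = norm (\<Sum>z<L + H. complex_of_real ((norm (\<Sum>j<H. w (z + j)))\<^sup>2))"
    unfolding of_real_sum[symmetric] norm_of_real by (simp add: sum_nonneg)
  also have "(\<Sum>z<L + H. complex_of_real ((norm (\<Sum>j<H. w (z + j)))\<^sup>2))
      = (\<Sum>z<L + H. \<Sum>i<H. \<Sum>j<H. w (z + i) * cnj (w (z + j)))"
    unfolding complex_norm_square by (simp add: sum_product)
  also have "\<dots> = (\<Sum>i<H. \<Sum>j<H. \<Sum>z<L + H. w (z + i) * cnj (w (z + j)))"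
    by (subst sum.swap, rule sum.cong[OF refl], rule sum.swap)
  also have "norm \<dots> \<le> (\<Sum>i<H. \<Sum>j<H. norm (\<Sum>z<L + H. w (z + i) * cnj (w (z + j))))"
    by (intro sum_norm_le norm_sum)
  also have "\<dots> = (\<Sum>i<H. \<Sum>j<H. norm (c (if j \<le> i then i - j else j - i)))"
    by (intro sum.cong refl norm_corr) auto
  finally show ?thesis unfolding S_def by (simp add: mult_left_mono)
qed

text \<open>A pigeonhole over the shifts in van der Corput's inequality. Shifts below
  \<open>W\<close> are estimated trivially, and the condition on \<open>W\<close> keeps their share
  small, so some shift \<open>h >= W\<close> must correlate. The threshold is a parameter because
  one application needs only \<open>h > 0\<close>, another \<open>h\<close> comparable to
  \<open>Y\<close>.\<close>

lemma biased_difference: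
  fixes \<phi> :: "nat \<Rightarrow> real"
  assumes L: "L \<le> Y" and Y: "Y \<ge> 1" and \<epsilon>: "0 < \<epsilon>" 
    and H: "1 \<le> H" "H \<le> Y" and W: "8 * real W \<le> \<epsilon>\<^sup>2 * real H"
    and bias: "\<epsilon> * real Y \<le> norm (\<Sum>y<L. expi (\<phi> y))"
  obtains h L' where "W \<le> h" "h < H" "L' \<le> Y"
    "\<epsilon>\<^sup>2 / 8 * real Y \<le> norm (\<Sum>y<L'. expi (\<phi> (y + h) - \<phi> y))"
proof (rule ccontr)
  assume contra: "\<not> thesis"
  note goal_ex = that
  define c where "c = (\<lambda>h. \<Sum>y<L - h. expi (\<phi> (y + h)) * cnj (expi (\<phi> y)))"
  have trivial: "norm (c h) \<le> real Y" for h
  proof -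
    have "norm (c h) \<le> (\<Sum>y<L - h. 1)"
      unfolding c_def by (rule sum_norm_le) (simp add: norm_mult)
    also have "\<dots> \<le> real Y" using L by simp
    finally show ?thesis .
  qed
  have small: "norm (c h) \<le> \<epsilon>\<^sup>2 / 8 * real Y" if "W \<le> h" "h < H" for h
  proof (rule ccontr)
    assume "\<not> ?thesis"
    then have "\<epsilon>\<^sup>2 / 8 * real Y \<le> norm (\<Sum>y<L - h. expi (\<phi> (y + h) - \<phi> y))"
      by (simp add: c_def expi_diff)
    moreover have "L - h \<le> Y" using L by simp
    ultimately show False using goal_ex[of h "L - h"] contra \<open>W \<le> h\<close> \<open>h < H\<close> by blast
  qed
  have row: "(\<Sum>j<H. norm (c (if j \<le> i then i - j else j - i)))
      \<le> 2 * real W * real Y + real H * (\<epsilon>\<^sup>2 / 8 * real Y)" if "i < H" for i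
  proof -
    let ?A = "{j. j < H \<and> (if j \<le> i then i - j else j - i) < W}"
    have "card ?A \<le> card ({i + 1 - W..i} \<union> {i<..<i + W})"
      by (rule card_mono) (auto split: if_splits)
    also have "\<dots> \<le> card {i + 1 - W..i} + card {i<..<i + W}" by (rule card_Un_le)
    also have "\<dots> \<le> 2 * W" by auto
    finally have A: "card ?A \<le> 2 * W" .
    have "(\<Sum>j<H. norm (c (if j \<le> i then i - j else j - i)))
        \<le> (\<Sum>j<H. (if j \<in> ?A then real Y else 0) + \<epsilon>\<^sup>2 / 8 * real Y)"
    proof (rule sum_mono)
      fix j assume j: "j \<in> {..<H}"
      let ?h = "if j \<le> i then i - j else j - i"
      show "norm (c ?h) \<le> (if j \<in> ?A then real Y else 0) + \<epsilon>\<^sup>2 / 8 * real Y"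
      proof (cases "j \<in> ?A")
        case True
        moreover have "0 \<le> \<epsilon>\<^sup>2 / 8 * real Y" by simp
        ultimately show ?thesis using trivial[of ?h] by (simp only: if_True)
      next
        case False
        then have "W \<le> ?h" "?h < H" using j that by auto
        then show ?thesis using small[of ?h] False by (simp only: if_False add_0)
      qed
    qed
    also have "\<dots> = (\<Sum>j\<in>{..<H} \<inter> ?A. real Y) + real H * (\<epsilon>\<^sup>2 / 8 * real Y)"
      unfolding sum.distrib sum.inter_restrict[OF finite_lessThan] by simp
    also have "(\<Sum>j\<in>{..<H} \<inter> ?A. real Y) = real (card ?A) * real Y"
    proof -
      have "{..<H} \<inter> ?A = ?A" by auto
      then show ?thesis by simp
    qed
    also have "\<dots> \<le> 2 * real W * real Y" using A by (intro mult_right_mono) auto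
    finally show ?thesis by simp
  qed
  have "(real H * (\<epsilon> * real Y))\<^sup>2 \<le> (real H * norm (\<Sum>y<L. expi (\<phi> y)))\<^sup>2"
    using bias \<epsilon> by (intro power_mono mult_left_mono) auto
  also have "\<dots> \<le> real (L + H) * (\<Sum>i<H. \<Sum>j<H. norm (c (if j \<le> i then i - j else j - i)))"
    unfolding c_def by (rule van_der_Corput_inequality)
  also have "\<dots> \<le> (2 * real Y) * (\<Sum>i<H. 2 * real W * real Y + real H * (\<epsilon>\<^sup>2 / 8 * real Y))"
    by (intro mult_mono sum_mono row sum_nonneg) (use L H in auto)
  also have "\<dots> = (real H * (real Y)\<^sup>2) * (4 * real W + real H * \<epsilon>\<^sup>2 / 4)"
    by (simp add: algebra_simps power2_eq_square)
  \<comment> \<open>The near shifts account for at most one half of the lower bound and the far ones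
    for one quarter, which is contradictory.\<close>
  also have "\<dots> \<le> (real H * (real Y)\<^sup>2) * (\<epsilon>\<^sup>2 * real H / 2 + real H * \<epsilon>\<^sup>2 / 4)"
    by (intro mult_left_mono add_mono) (use W in auto)
  also have "\<dots> = (real H * (\<epsilon> * real Y))\<^sup>2 * (3 / 4)"
    by (simp add: algebra_simps power2_eq_square)
  finally have "(real H * (\<epsilon> * real Y))\<^sup>2 \<le> 0" by simp
  moreover have "0 < (real H * (\<epsilon> * real Y))\<^sup>2" using H Y \<epsilon> by simp
  ultimately show False by linarith
qed

text \<open>\<open>poly_diff K a \<phi>\<close> says that \<open>\<phi>\<close> is a polynomial of degree at most \<open>K\<close> whose
  coefficient of degree \<open>K\<close> is \<open>a / K!\<close>; this normalisation is stable under differencing.\<close>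

fun poly_diff :: "nat \<Rightarrow> real \<Rightarrow> (nat \<Rightarrow> real) \<Rightarrow> bool" where
  "poly_diff 0 a \<phi> = (\<forall>y. \<phi> y = a)"
| "poly_diff (Suc K) a \<phi> = (\<forall>h. poly_diff K (a * real h) (\<lambda>y. \<phi> (y + h) - \<phi> y))"

lemma poly_diff_add:
  "poly_diff K a \<phi> \<Longrightarrow> poly_diff K b \<psi> \<Longrightarrow> poly_diff K (a + b) (\<lambda>y. \<phi> y + \<psi> y)"
proof (induction K arbitrary: a b \<phi> \<psi>)
  case (Suc K)
  have "poly_diff K ((a + b) * real h) (\<lambda>y. \<phi> (y + h) + \<psi> (y + h) - (\<phi> y + \<psi> y))" for h
  proof -
    have "poly_diff K (a * real h + b * real h) (\<lambda>y. (\<phi> (y + h) - \<phi> y) + (\<psi> (y + h) - \<psi> y))"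
      using Suc by simp
    then show ?thesis by (simp add: algebra_simps)
  qed
  then show ?case by simp
qed simp

lemma poly_diff_cmult: "poly_diff K a \<phi> \<Longrightarrow> poly_diff K (c * a) (\<lambda>y. c * \<phi> y)"
proof (induction K arbitrary: a \<phi>)
  case (Suc K)
  have "poly_diff K (c * a * real h) (\<lambda>y. c * \<phi> (y + h) - c * \<phi> y)" for h
    using Suc.IH[of "a * real h" "\<lambda>y. \<phi> (y + h) - \<phi> y"] Suc.prems
    by (simp add: right_diff_distrib mult.assoc)
  then show ?case by simp
qed simp

lemma poly_diff_Suc_0: "poly_diff K a \<phi> \<Longrightarrow> poly_diff (Suc K) 0 \<phi>"
proof (induction K arbitrary: a \<phi>)
  case (Suc K)
  have "poly_diff (Suc K) 0 (\<lambda>y. \<phi> (y + h) - \<phi> y)" for h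
    using Suc.IH[of "a * real h" "\<lambda>y. \<phi> (y + h) - \<phi> y"] Suc.prems by simp
  then show ?case by (subst poly_diff.simps(2)) simp
qed simp

lemma poly_diff_raise: "poly_diff i a \<phi> \<Longrightarrow> i < K \<Longrightarrow> poly_diff K 0 \<phi>"
proof (induction K)
  case (Suc K)
  then show ?case
    using poly_diff_Suc_0[of K _ \<phi>] less_SucE by metis
qed simp

lemma poly_diff_sum:
  "finite A \<Longrightarrow> (\<And>i. i \<in> A \<Longrightarrow> poly_diff K (a i) (\<phi> i)) \<Longrightarrow> poly_diff K (\<Sum>i\<in>A. a i) (\<lambda>y. \<Sum>i\<in>A. \<phi> i y)"
proof (induction A rule: finite_induct)
  case empty
  show ?case by (induction K) auto
qed (simp add: poly_diff_add)

text \<open>In the binomial expansion of a difference only the term of degree \<open>k\<close> has a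
  nonzero top coefficient, namely \<open>Suc k * h * fact k\<close>; lower powers are covered by the
  strong induction and \<open>poly_diff_raise\<close>.\<close>

lemma poly_diff_power: "poly_diff K (fact K) (\<lambda>y. real y ^ K)"
proof (induction K rule: less_induct)
  case (less K)
  show ?case
  proof (cases K)
    case (Suc k)
    have "poly_diff k (fact (Suc k) * real h) (\<lambda>y. real (y + h) ^ Suc k - real y ^ Suc k)" for h
    proof -
      define b where "b = (\<lambda>i. real (Suc k choose i) * real h ^ (Suc k - i))"
      have "poly_diff k (if i = k then b k * fact k else 0) (\<lambda>y. b i * real y ^ i)" if "i \<le> k" for i
      proof (cases "i = k")
        case True
        then show ?thesis using poly_diff_cmult[OF less(1)[of k]] Suc by simp
      next
        case False
        then show ?thesis
          using poly_diff_raise[OF poly_diff_cmult[OF less(1)[of i]]] Suc that by auto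
      qed
      then have "poly_diff k (\<Sum>i\<le>k. if i = k then b k * fact k else 0) (\<lambda>y. \<Sum>i\<le>k. b i * real y ^ i)"
        by (intro poly_diff_sum) auto
      moreover have "(\<Sum>i\<le>k. if i = k then b k * fact k else 0) = fact (Suc k) * real h"
        by (simp add: b_def)
      moreover have "(\<Sum>i\<le>k. b i * real y ^ i) = real (y + h) ^ Suc k - real y ^ Suc k" for y
        by (simp only: of_nat_add binomial_ring sum.atMost_Suc) (simp add: b_def algebra_simps)
      ultimately show ?thesis by simp
    qed
    then show ?thesis using Suc by simp
  qed simp
qed

lemma poly_diff_power_sum: "poly_diff K (fact K * c K) (\<lambda>y. \<Sum>i\<le>K. c i * real y ^ i)"
proof -
  have "poly_diff K (if i = K then fact K * c K else 0) (\<lambda>y. c i * real y ^ i)" if "i \<le> K" for i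
  proof (cases "i = K")
    case True
    then show ?thesis using poly_diff_cmult[OF poly_diff_power, of K "c K"] by (simp add: mult.commute)
  next
    case False
    then show ?thesis
      using poly_diff_raise[OF poly_diff_cmult[OF poly_diff_power]] that by simp
  qed
  then have "poly_diff K (\<Sum>i\<le>K. if i = K then fact K * c K else 0) (\<lambda>y. \<Sum>i\<le>K. c i * real y ^ i)"
    by (intro poly_diff_sum) auto
  then show ?thesis by simp
qed

lemma poly_diff_1_bound:
  assumes "poly_diff 1 a \<phi>"
  shows "norm (\<Sum>y<L. expi (\<phi> y)) * dist_int a \<le> 1 / 2"
proof -
  have "\<phi> y = \<phi> 0 + a * real y" for y
    using assms by (simp add: algebra_simps) (metis add_0 add.commute diff_eq_eq)
  then have "(\<Sum>y<L. expi (\<phi> y)) = (\<Sum>y<L. expi (\<phi> 0 + a * real y))" by metis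
  then show ?thesis using geometric_expi_bound[where L = L and b = "\<phi> 0" and a = a] by simp
qed

text \<open>Weyl's inequality read contrapositively. Each differencing replaces \<open>a\<close> by
  \<open>a * h\<close> with \<open>h\<close> at most \<open>9 / \<epsilon> ^ 2\<close>, so the
  shifts accumulate in the denominator \<open>q\<close>, while the accuracy comes from the linear
  case. Only one factor \<open>Y\<close> is gained, which suffices where the block may be taken
  long.\<close>

lemma Weyl_leading_coefficient:
  assumes "K \<ge> 1"
  shows "\<exists>C\<ge>1. \<exists>E. \<forall>Y\<ge>1. \<forall>L\<le>Y. \<forall>\<epsilon> a \<phi>. 0 < \<epsilon> \<longrightarrow> \<epsilon> \<le> 1 \<longrightarrow> poly_diff K a \<phi> \<longrightarrow>
           \<epsilon> * real Y \<le> norm (\<Sum>y<L. expi (\<phi> y)) \<longrightarrow>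
           (\<exists>q\<ge>1. real q \<le> C / \<epsilon> ^ E \<and> dist_int (real q * a) \<le> C / (\<epsilon> ^ E * real Y))"
  using assms
proof (induction K rule: nat_induct_at_least)
  case base
  show ?case
  proof (intro exI[of _ 1] conjI allI impI)
    fix Y L :: nat and \<epsilon> a \<phi>
    assume *: "1 \<le> Y" "L \<le> Y" "0 < \<epsilon>" "\<epsilon> \<le> 1" "poly_diff 1 a \<phi>" 
      "\<epsilon> * real Y \<le> norm (\<Sum>y<L. expi (\<phi> y))"
    show "real 1 \<le> 1 / \<epsilon> ^ 1" using * by simp
    have "\<epsilon> * real Y * dist_int a \<le> 1 / 2"
      using poly_diff_1_bound[OF *(5), of L] mult_right_mono[OF *(6) dist_int_nonneg[of a]] by linarith
    then have "dist_int a * (\<epsilon> * real Y) \<le> 1" by (simp add: mult.commute)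
    then show "dist_int (real 1 * a) \<le> 1 / (\<epsilon> ^ 1 * real Y)"
      using * by (simp add: pos_le_divide_eq)
  qed simp_all
next
  case (Suc K)
  from Suc.IH obtain C E where C: "C \<ge> 1" and IH0: "\<forall>Y\<ge>1. \<forall>L\<le>Y. \<forall>\<epsilon> a \<phi>. 0 < \<epsilon> \<longrightarrow> \<epsilon> \<le> 1 \<longrightarrow> poly_diff K a \<phi> \<longrightarrow>
           \<epsilon> * real Y \<le> norm (\<Sum>y<L. expi (\<phi> y)) \<longrightarrow>
           (\<exists>q\<ge>1. real q \<le> C / \<epsilon> ^ E \<and> dist_int (real q * a) \<le> C / (\<epsilon> ^ E * real Y))"
    by (elim exE conjE)
  note IH = IH0[rule_format]
  define C' where "C' = 9 * C * 8 ^ E"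
  have "C * 1 \<le> C * 8 ^ E" using C by (intro mult_left_mono) auto
  then have C': "C' \<ge> 9" "C * 8 ^ E \<le> C'" and C'1: "1 \<le> C'" using C unfolding C'_def by linarith+
  show ?case
  proof (rule exI[of _ C'], rule conjI[OF _ exI[of _ "2 * E + 2"]], simp add: C'1, intro allI impI)
    fix Y L :: nat and \<epsilon> a \<phi>
    assume *: "1 \<le> Y" "L \<le> Y" "0 < \<epsilon>" "\<epsilon> \<le> 1" "poly_diff (Suc K) a \<phi>" 
      "\<epsilon> * real Y \<le> norm (\<Sum>y<L. expi (\<phi> y))"
    have eps: "\<epsilon> ^ (2 * E + 2) \<le> \<epsilon>\<^sup>2" "0 < \<epsilon> ^ (2 * E + 2)"
      using * power_decreasing[of 2 "2 * E + 2" \<epsilon>] by auto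
    \<comment> \<open>The shortest window that admits \<open>W = 1\<close>; a shift
      \<open>h >= 1\<close> keeps the denominator \<open>q * h\<close> positive.\<close>
    define H where "H = nat \<lceil>8 / \<epsilon>\<^sup>2\<rceil>"
    have H: "8 / \<epsilon>\<^sup>2 \<le> real H" "real H \<le> 9 / \<epsilon>\<^sup>2" "1 \<le> H"
    proof -
      have "1 \<le> 1 / \<epsilon>\<^sup>2" using * by (simp add: power_le_one)
      moreover have "9 / \<epsilon>\<^sup>2 = 8 / \<epsilon>\<^sup>2 + 1 / \<epsilon>\<^sup>2" by (simp add: add_divide_distrib[symmetric])
      moreover have "0 \<le> 8 / \<epsilon>\<^sup>2" by simp
      ultimately show "8 / \<epsilon>\<^sup>2 \<le> real H" "real H \<le> 9 / \<epsilon>\<^sup>2"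
        unfolding H_def by linarith+
      moreover have "8 / \<epsilon>\<^sup>2 > 0" using * by simp
      ultimately show "1 \<le> H" by (metis One_nat_def Suc_leI gr0I less_le_trans not_less of_nat_0)
    qed
    show "\<exists>q\<ge>1. real q \<le> C' / \<epsilon> ^ (2 * E + 2) \<and> dist_int (real q * a) \<le> C' / (\<epsilon> ^ (2 * E + 2) * real Y)"
    proof (cases "H \<le> Y")
      \<comment> \<open>A window longer than \<open>Y\<close> means
        \<open>Y <= 9 / \<epsilon> ^ 2\<close>, and then \<open>q = 1\<close> satisfies both
        bounds.\<close>
      case False
      then have "real Y \<le> 9 / \<epsilon>\<^sup>2" using H by linarith
      also have "\<dots> \<le> C' / \<epsilon> ^ (2 * E + 2)"
        using eps C' * by (intro frac_le) auto
      finally have Y: "real Y \<le> C' / \<epsilon> ^ (2 * E + 2)" .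
      then have "1 \<le> C' / (\<epsilon> ^ (2 * E + 2) * real Y)"
        using * eps by (simp add: field_simps)
      moreover have "1 \<le> C' / \<epsilon> ^ (2 * E + 2)"
        by (rule order_trans[OF _ Y]) (use * in simp)
      ultimately show ?thesis
        using dist_int_le_half[of "real 1 * a"] by (intro exI[of _ 1]) auto
    next
      case True
      have "8 * real 1 \<le> \<epsilon>\<^sup>2 * real H" using H(1) * by (simp add: field_simps)
      from biased_difference[OF *(2,1,3) H(3) True this *(6)]
      obtain h L' where h: "1 \<le> h" "h < H" "L' \<le> Y"
        "\<epsilon>\<^sup>2 / 8 * real Y \<le> norm (\<Sum>y<L'. expi (\<phi> (y + h) - \<phi> y))" by metis
      have "0 < \<epsilon>\<^sup>2 / 8" "\<epsilon>\<^sup>2 / 8 \<le> 1" using * power_le_one[of \<epsilon> 2] by auto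
      moreover have "poly_diff K (a * real h) (\<lambda>y. \<phi> (y + h) - \<phi> y)" using * by simp
      ultimately obtain q where q: "q \<ge> 1" "real q \<le> C / (\<epsilon>\<^sup>2 / 8) ^ E"
        "dist_int (real q * (a * real h)) \<le> C / ((\<epsilon>\<^sup>2 / 8) ^ E * real Y)"
        using IH[OF *(1) h(3) _ _ _ h(4)] by blast
      have e: "C / (\<epsilon>\<^sup>2 / 8) ^ E = C * 8 ^ E / \<epsilon> ^ (2 * E)"
        by (simp add: power_divide power_mult)
      have "real (q * h) \<le> C * 8 ^ E / \<epsilon> ^ (2 * E) * (9 / \<epsilon>\<^sup>2)"
        unfolding of_nat_mult using q(2) h(2) H(2) C * by (intro mult_mono) (auto simp: e)
      also have "\<dots> = C' / \<epsilon> ^ (2 * E + 2)" by (simp add: C'_def power_add power2_eq_square mult_ac)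
      finally have 1: "real (q * h) \<le> C' / \<epsilon> ^ (2 * E + 2)" .
      have "dist_int (real (q * h) * a) \<le> C / (\<epsilon>\<^sup>2 / 8) ^ E / real Y"
        using q(3) by (simp add: mult_ac)
      also have "\<dots> = C * 8 ^ E / \<epsilon> ^ (2 * E) / real Y" by (simp add: e)
      also have "\<dots> \<le> C' / \<epsilon> ^ (2 * E + 2) / real Y"
        using C C' * power_decreasing[of "2 * E" "2 * E + 2" \<epsilon>]
        by (intro divide_right_mono frac_le) auto
      finally have "dist_int (real (q * h) * a) \<le> C' / (\<epsilon> ^ (2 * E + 2) * real Y)" by simp
      with 1 show ?thesis using q(1) h(1) by (intro exI[of _ "q * h"]) auto
    qed
  qed
qed

text \<open>The smallness of \<open>a\<close> ensures that the linear coefficient left after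
  \<open>K - 1\<close> differences is at most 1/2 in absolute value, so its distance to the integers
  is its absolute value. Shifts proportional to \<open>\<epsilon> ^ 2 * Y\<close> then gain a factor
  \<open>Y\<close> at each step, and the full power \<open>Y ^ K\<close> is recovered: the leading
  term of a biased phase is bounded on the block.\<close>

lemma Weyl_small_leading_coefficient:
  assumes "K \<ge> 1"
  shows "\<exists>C\<ge>1. \<exists>E. \<forall>Y\<ge>1. \<forall>L\<le>Y. \<forall>\<epsilon> a \<phi>. 0 < \<epsilon> \<longrightarrow> \<epsilon> \<le> 1 \<longrightarrow> poly_diff K a \<phi> \<longrightarrow>
           \<bar>a\<bar> * real Y ^ (K - 1) \<le> 1 / 2 \<longrightarrow>
           \<epsilon> * real Y \<le> norm (\<Sum>y<L. expi (\<phi> y)) \<longrightarrow> \<bar>a\<bar> * real Y ^ K \<le> C / \<epsilon> ^ E"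
  using assms
proof (induction K rule: nat_induct_at_least)
  case base
  show ?case
  proof (intro exI[of _ 1] conjI allI impI)
    fix Y L :: nat and \<epsilon> a \<phi>
    assume *: "1 \<le> Y" "L \<le> Y" "0 < \<epsilon>" "\<epsilon> \<le> 1" "poly_diff 1 a \<phi>" "\<bar>a\<bar> * real Y ^ (1 - 1) \<le> 1 / 2"
      "\<epsilon> * real Y \<le> norm (\<Sum>y<L. expi (\<phi> y))"
    have "\<epsilon> * real Y * dist_int a \<le> 1 / 2"
      using poly_diff_1_bound[OF *(5), of L] mult_right_mono[OF *(7) dist_int_nonneg[of a]] by linarith
    then have "\<bar>a\<bar> * real Y * \<epsilon> \<le> 1" using *(6) dist_int_eq_abs[of a] by (simp add: mult_ac)
    then show "\<bar>a\<bar> * real Y ^ 1 \<le> 1 / \<epsilon> ^ 1"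
      using * by (simp add: pos_le_divide_eq)
  qed simp_all
next
  case (Suc K)
  from Suc.IH obtain C E where C: "C \<ge> 1" and IH0: "\<forall>Y\<ge>1. \<forall>L\<le>Y. \<forall>\<epsilon> a \<phi>. 0 < \<epsilon> \<longrightarrow> \<epsilon> \<le> 1 \<longrightarrow> poly_diff K a \<phi> \<longrightarrow>
           \<bar>a\<bar> * real Y ^ (K - 1) \<le> 1 / 2 \<longrightarrow>
           \<epsilon> * real Y \<le> norm (\<Sum>y<L. expi (\<phi> y)) \<longrightarrow> \<bar>a\<bar> * real Y ^ K \<le> C / \<epsilon> ^ E"
    by (elim exE conjE)
  note IH = IH0[rule_format]
  define C' where "C' = 16 * C * 8 ^ E"
  have "C * 1 \<le> C * 8 ^ E" using C by (intro mult_left_mono) auto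
  then have C': "C' \<ge> 16" and C'1: "1 \<le> C'" using C unfolding C'_def by linarith+
  show ?case
  proof (rule exI[of _ C'], rule conjI[OF _ exI[of _ "2 * E + 2"]], simp add: C'1, intro allI impI)
    fix Y L :: nat and \<epsilon> a \<phi>
    assume *: "1 \<le> Y" "L \<le> Y" "0 < \<epsilon>" "\<epsilon> \<le> 1" "poly_diff (Suc K) a \<phi>" 
      "\<bar>a\<bar> * real Y ^ (Suc K - 1) \<le> 1 / 2"
      "\<epsilon> * real Y \<le> norm (\<Sum>y<L. expi (\<phi> y))"
    have eps: "\<epsilon> ^ (2 * E + 2) \<le> \<epsilon>\<^sup>2" "0 < \<epsilon> ^ (2 * E + 2)" "0 < \<epsilon>\<^sup>2"
      using * power_decreasing[of 2 "2 * E + 2" \<epsilon>] by auto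
    define x where "x = \<epsilon>\<^sup>2 * real Y / 8"
    \<comment> \<open>The largest threshold allowed with the full window \<open>H = Y\<close>. If
      \<open>x < 1\<close>, then \<open>Y\<close> itself is below \<open>8 / \<epsilon> ^ 2\<close>
      and the claim is direct.\<close>
    define W where "W = nat \<lfloor>x\<rfloor>"
    have "0 \<le> x" by (simp add: x_def)
    show "\<bar>a\<bar> * real Y ^ Suc K \<le> C' / \<epsilon> ^ (2 * E + 2)"
    proof (cases "x < 1")
      case True
      then have "real Y \<le> 8 / \<epsilon>\<^sup>2" using eps by (simp add: x_def field_simps)
      have "\<bar>a\<bar> * real Y ^ Suc K = (\<bar>a\<bar> * real Y ^ K) * real Y" by simp
      also have "\<dots> \<le> 1 / 2 * (8 / \<epsilon>\<^sup>2)"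
        using * \<open>real Y \<le> 8 / \<epsilon>\<^sup>2\<close> by (intro mult_mono) auto
      also have "\<dots> \<le> 16 / \<epsilon>\<^sup>2" using eps by (simp add: divide_right_mono)
      also have "\<dots> \<le> C' / \<epsilon> ^ (2 * E + 2)" using eps C' by (intro frac_le) auto
      finally show ?thesis .
    next
      case False
      then have "real W = of_int \<lfloor>x\<rfloor>" "1 \<le> \<lfloor>x\<rfloor>" by (simp_all add: W_def)
      then have W: "real W \<le> x" "x / 2 \<le> real W" by linarith+
      have "8 * real W \<le> \<epsilon>\<^sup>2 * real Y" using W(1) by (simp add: x_def)
      from biased_difference[OF *(2,1,3) *(1) order_refl this *(7)]
      obtain h L' where h: "W \<le> h" "h < Y" "L' \<le> Y"
        "\<epsilon>\<^sup>2 / 8 * real Y \<le> norm (\<Sum>y<L'. expi (\<phi> (y + h) - \<phi> y))" by metis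
      have "\<bar>a * real h\<bar> * real Y ^ (K - 1) \<le> \<bar>a\<bar> * real Y * real Y ^ (K - 1)"
        using h(2) by (intro mult_right_mono) (auto simp: abs_mult intro!: mult_left_mono)
      also have "\<dots> = \<bar>a\<bar> * real Y ^ K" using Suc.hyps by (cases K) auto
      also have "\<dots> \<le> 1 / 2" using *(6) by simp
      finally have "\<bar>a * real h\<bar> * real Y ^ (K - 1) \<le> 1 / 2" .
      moreover have "0 < \<epsilon>\<^sup>2 / 8" "\<epsilon>\<^sup>2 / 8 \<le> 1" using * power_le_one[of \<epsilon> 2] by auto
      moreover have "poly_diff K (a * real h) (\<lambda>y. \<phi> (y + h) - \<phi> y)" using * by simp
      ultimately have q: "\<bar>a * real h\<bar> * real Y ^ K \<le> C / (\<epsilon>\<^sup>2 / 8) ^ E"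
        using IH[OF *(1) h(3) _ _ _ _ h(4)] by blast
      have "\<bar>a\<bar> * real Y ^ Suc K * (\<epsilon>\<^sup>2 / 16) = (x / 2) * (\<bar>a\<bar> * real Y ^ K)"
        by (simp add: x_def)
      also have "\<dots> \<le> real h * (\<bar>a\<bar> * real Y ^ K)"
        using W(2) h(1) by (intro mult_right_mono) auto
      also have "\<dots> \<le> C / (\<epsilon>\<^sup>2 / 8) ^ E" using q by (simp add: abs_mult mult_ac)
      also have "\<dots> = C * 8 ^ E / \<epsilon> ^ (2 * E)" by (simp add: power_divide power_mult)
      finally have "\<bar>a\<bar> * real Y ^ Suc K \<le> C * 8 ^ E / \<epsilon> ^ (2 * E) / (\<epsilon>\<^sup>2 / 16)"
        using eps(3) by (subst pos_le_divide_eq) simp_all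
      also have "\<dots> = C' / \<epsilon> ^ (2 * E + 2)" by (simp add: C'_def power_add power2_eq_square mult_ac)
      finally show ?thesis .
    qed
  qed
qed

section \<open>Detection by a Fourier kernel\<close>

text \<open>The Fourier expansion of \<open>cos (pi * x) ^ (2 * R)\<close>: nonnegative coefficients
  of sum 1, frequencies at most \<open>R\<close>, and exponential decay in \<open>R\<close> away
  from the integers.\<close>

definition cos_kernel :: "nat \<Rightarrow> real \<Rightarrow> complex" where
  "cos_kernel R x = (\<Sum>a\<le>2 * R. complex_of_real (real (2 * R choose a) / 4 ^ R) * expi ((real a - real R) * x))"

lemma cos_kernel_eq: "cos_kernel R x = complex_of_real ((cos (pi * x))\<^sup>2 ^ R)"
proof -
  have half: "1 + expi x = complex_of_real (2 * cos (pi * x)) * expi (x / 2)"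
  proof -
    have "1 + cos (2 * (pi * x)) = 2 * cos (pi * x) * cos (pi * x)"
      by (simp add: cos_double_cos power2_eq_square)
    moreover have "sin (2 * (pi * x)) = 2 * cos (pi * x) * sin (pi * x)"
      by (simp add: sin_double)
    ultimately show ?thesis
      by (simp add: expi_def complex_eq_iff mult.assoc)
  qed
  have "cos_kernel R x = (\<Sum>a\<le>2 * R. of_nat (2 * R choose a) * expi x ^ a * 1 ^ (2 * R - a)) * (expi (- real R * x) / 4 ^ R)"
    unfolding cos_kernel_def sum_distrib_right
  proof (intro sum.cong refl)
    fix a
    have "expi ((real a - real R) * x) = expi x ^ a * expi (- real R * x)"
      by (simp add: expi_power expi_add[symmetric] algebra_simps)
    then show "complex_of_real (real (2 * R choose a) / 4 ^ R) * expi ((real a - real R) * x) =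
      of_nat (2 * R choose a) * expi x ^ a * 1 ^ (2 * R - a) * (expi (- real R * x) / 4 ^ R)" by simp
  qed
  also have "\<dots> = (expi x + 1) ^ (2 * R) * (expi (- real R * x) / 4 ^ R)"
    by (simp only: binomial_ring)
  also have "(expi x + 1) ^ (2 * R) = (complex_of_real (2 * cos (pi * x)))\<^sup>2 ^ R * expi (x / 2) ^ (2 * R)"
    by (simp only: add.commute[of "expi x"] half power_mult_distrib power_mult)
  also have "expi (x / 2) ^ (2 * R) = expi (real R * x)"
    by (simp add: expi_power)
  also have "(complex_of_real (2 * cos (pi * x)))\<^sup>2 ^ R * expi (real R * x) * (expi (- real R * x) / 4 ^ R)
      = (complex_of_real (2 * cos (pi * x)))\<^sup>2 ^ R / 4 ^ R * expi (real R * x + - real R * x)"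
    by (simp only: expi_add) simp
  also have "\<dots> = complex_of_real ((cos (pi * x))\<^sup>2 ^ R)"
    by (simp add: power_mult_distrib)
  finally show ?thesis .
qed

lemma cos_squared_le: "(cos (pi * x))\<^sup>2 \<le> 1 - 4 * (dist_int x)\<^sup>2"
proof -
  have "(2 * dist_int x)\<^sup>2 \<le> \<bar>sin (pi * x)\<bar>\<^sup>2"
    by (intro power_mono dist_int_le_sin) (simp add: dist_int_nonneg)
  then show ?thesis by (simp add: cos_squared_eq power_mult_distrib)
qed

text \<open>The exponent on the left grows linearly in \<open>s\<close>, the one on the right
  exponentially, so a single \<open>s\<close> serves all \<open>M\<close>. In use, the right side is
  the reciprocal of the decay of a kernel of degree \<open>M ^ s\<close> at distance
  \<open>1 / M\<close> from the integers, and the left side, up to a spare factor \<open>M\<close>,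
  the reciprocal of the weight of the zero frequency.\<close>

lemma exp_beats_power:
  fixes D :: nat
  obtains s :: nat where "s \<ge> 2" "\<And>M. M \<ge> 2 \<Longrightarrow> real M ^ ((s + 1) * D + 1) < exp (4 * real M ^ (s - 2))"
proof
  define m where "m = 8 * (D + 1)"
  define s where "s = 3 + m"
  have lin: "(s + 1) * D + 1 \<le> 2 ^ m"
  proof -
    have "D + 1 \<le> 2 ^ (D + 1)" by (rule less_imp_le[OF less_exp])
    then have sq: "(D + 1) * (D + 1) \<le> 2 ^ (D + 1) * 2 ^ (D + 1)" by (rule mult_le_mono) fact
    have "(s + 1) * D + 1 \<le> 21 * ((D + 1) * (D + 1))"
      by (simp add: s_def m_def algebra_simps)
    also have "\<dots> \<le> 64 * (2 ^ (D + 1) * 2 ^ (D + 1))" using sq by simp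
    also have "\<dots> \<le> 2 ^ (6 * (D + 1)) * (2 ^ (D + 1) * 2 ^ (D + 1))"
      using power_increasing[of 6 "6 * (D + 1)" "2 :: nat"] by (intro mult_right_mono) auto
    also have "\<dots> = 2 ^ m" unfolding m_def power_add[symmetric] by (rule arg_cong[where f = "\<lambda>k. 2 ^ k"]) simp
    finally show ?thesis .
  qed
  show "s \<ge> 2" by (simp add: s_def)
  fix M :: nat assume M: "M \<ge> 2"
  have "real ((s + 1) * D + 1) \<le> real M ^ m"
  proof -
    have "real ((s + 1) * D + 1) \<le> 2 ^ m" using lin by (metis of_nat_le_iff of_nat_numeral of_nat_power)
    also have "\<dots> \<le> real M ^ m" using M by (intro power_mono) auto
    finally show ?thesis .
  qed
  moreover have "ln (real M) < real M" "0 \<le> ln (real M)" using M ln_less_self[of "real M"] by auto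
  ultimately have "real ((s + 1) * D + 1) * ln (real M) \<le> real M ^ m * real M"
    by (intro mult_mono) auto
  also have "\<dots> = real M ^ (s - 2)" by (simp add: s_def)
  also have "\<dots> < 4 * real M ^ (s - 2)" using M by simp
  finally have "exp (real ((s + 1) * D + 1) * ln (real M)) < exp (4 * real M ^ (s - 2))" by simp
  then show "real M ^ ((s + 1) * D + 1) < exp (4 * real M ^ (s - 2))"
    using M by (subst (asm) exp_of_nat_mult) simp
qed

text \<open>Sum over \<open>S\<close> the product of the kernels at \<open>F i n - v i\<close>.
  Every summand is tiny because some coordinate misses its target, whereas the zero frequency
  contributes \<open>card S\<close> times a fixed negative power of \<open>M\<close>. Some other
  frequency, bounded by the degree of the kernel, must compensate. The targets \<open>v\<close> only
  rotate the Fourier coefficients, so the bounds do not depend on them.\<close>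

lemma large_Weyl_sum:
  fixes D :: nat
  shows "\<exists>s a. \<forall>M\<ge>2. \<forall>I (F :: nat \<Rightarrow> nat \<Rightarrow> real) v S. finite I \<longrightarrow> card I = D \<longrightarrow> finite S \<longrightarrow> S \<noteq> {} \<longrightarrow>
      (\<forall>n\<in>S. \<exists>i\<in>I. dist_int (F i n - v i) > 1 / real M) \<longrightarrow>
      (\<exists>h :: nat \<Rightarrow> int. (\<exists>i\<in>I. h i \<noteq> 0) \<and> (\<forall>i\<in>I. \<bar>h i\<bar> \<le> int M ^ s) \<and>
        real (card S) / real M ^ a \<le> norm (\<Sum>n\<in>S. expi (\<Sum>i\<in>I. of_int (h i) * F i n)))"
proof -
  obtain s where s: "s \<ge> 2" "\<And>M. M \<ge> 2 \<Longrightarrow> real M ^ ((s + 1) * D + 1) < exp (4 * real M ^ (s - 2))"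
    using exp_beats_power[of D] by blast
  \<comment> \<open>The zero frequency has weight at least \<open>1 / M ^ ((s + 1) * D)\<close>; the
    additional factor \<open>M >= 2\<close> pays for two errors, the kernel values and the other
    frequencies.\<close>
  define a where "a = (s + 1) * D + 1"
  show ?thesis
  proof (rule exI[of _ s], rule exI[of _ a], intro allI impI, rule ccontr)
    fix M :: nat and I S and F :: "nat \<Rightarrow> nat \<Rightarrow> real" and v
    assume M: "M \<ge> 2" and I: "finite I" "card I = D" and S: "finite S" "S \<noteq> {}"
      and bad: "\<forall>n\<in>S. \<exists>i\<in>I. dist_int (F i n - v i) > 1 / real M"
    assume contra: "\<not> (\<exists>h :: nat \<Rightarrow> int. (\<exists>i\<in>I. h i \<noteq> 0) \<and> (\<forall>i\<in>I. \<bar>h i\<bar> \<le> int M ^ s) \<and>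
        real (card S) / real M ^ a \<le> norm (\<Sum>n\<in>S. expi (\<Sum>i\<in>I. of_int (h i) * F i n)))"
    define R where "R = M ^ s"
    have R: "R \<ge> 1" using M by (simp add: R_def)
    define c where "c = (\<lambda>b. real (2 * R choose b) / 4 ^ R)"
    define P where "P = (\<lambda>n. \<Prod>i\<in>I. cos_kernel R (F i n - v i))"
    define T where "T = (\<lambda>g. (\<Prod>i\<in>I. complex_of_real (c (g i))) * expi (- (\<Sum>i\<in>I. (real (g i) - real R) * v i))
        * (\<Sum>n\<in>S. expi (\<Sum>i\<in>I. (real (g i) - real R) * F i n)))"
    define G where "G = PiE I (\<lambda>_. {..2 * R})"
    \<comment> \<open>The index \<open>R\<close> stands for frequency 0; \<open>restrict\<close>
      makes the constant function a member of \<open>PiE\<close>.\<close>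
    define g0 where "g0 = restrict (\<lambda>_. R) I"
    have finG: "finite G" using I by (simp add: G_def finite_PiE)
    have g0: "g0 \<in> G" by (auto simp: g0_def G_def)
    have c_nonneg: "0 \<le> c b" for b by (simp add: c_def)
    have expand: "(\<Sum>n\<in>S. P n) = (\<Sum>g\<in>G. T g)"
    proof -
      have "P n = (\<Sum>g\<in>G. (\<Prod>i\<in>I. complex_of_real (c (g i))) * expi (- (\<Sum>i\<in>I. (real (g i) - real R) * v i))
        * expi (\<Sum>i\<in>I. (real (g i) - real R) * F i n))" for n
      proof -
        have "P n = (\<Sum>g\<in>G. \<Prod>i\<in>I. complex_of_real (c (g i)) * expi ((real (g i) - real R) * (F i n - v i)))"
          unfolding P_def cos_kernel_def G_def c_def using I by (subst prod_sum_PiE) auto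
        also have "\<dots> = (\<Sum>g\<in>G. (\<Prod>i\<in>I. complex_of_real (c (g i))) * expi (- (\<Sum>i\<in>I. (real (g i) - real R) * v i))
          * expi (\<Sum>i\<in>I. (real (g i) - real R) * F i n))"
          unfolding prod.distrib expi_sum[OF I(1), symmetric] mult.assoc expi_add[symmetric]
          by (simp add: right_diff_distrib sum_subtractf)
        finally show ?thesis .
      qed
      then have "(\<Sum>n\<in>S. P n) = (\<Sum>n\<in>S. \<Sum>g\<in>G. (\<Prod>i\<in>I. complex_of_real (c (g i))) * expi (- (\<Sum>i\<in>I. (real (g i) - real R) * v i))
        * expi (\<Sum>i\<in>I. (real (g i) - real R) * F i n))" by simp
      also have "\<dots> = (\<Sum>g\<in>G. T g)"
        unfolding T_def sum_distrib_left by (rule sum.swap)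
      finally show ?thesis .
    qed
    \<comment> \<open>Because the weights sum to 1, a common bound for the nonzero frequencies
      bounds their total, however many there are.\<close>
    have c_sum: "(\<Sum>g\<in>G. \<Prod>i\<in>I. c (g i)) = 1"
    proof -
      have "(\<Sum>b\<le>2 * R. c b) = real (2 ^ (2 * R)) / 4 ^ R"
        unfolding c_def sum_divide_distrib[symmetric] choose_row_sum[symmetric] by simp
      also have "\<dots> = 1" by (simp add: power_mult)
      finally have "(\<Prod>i\<in>I. \<Sum>b\<le>2 * R. c b) = 1" by simp
      then show ?thesis unfolding G_def using I by (subst (asm) prod_sum_PiE) auto
    qed
    have main: "T g0 = of_real (c R ^ D * real (card S))"
      using I by (simp add: T_def g0_def)
    have rest: "norm (T g) \<le> (\<Prod>i\<in>I. c (g i)) * (real (card S) / real M ^ a)" if "g \<in> G - {g0}" for g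
    proof -
      define h where "h = (\<lambda>i. int (g i) - int R)"
      have "\<exists>i\<in>I. h i \<noteq> 0"
      proof (rule ccontr)
        assume "\<not> ?thesis"
        then have "g i = g0 i" for i
          using that by (cases "i \<in> I") (auto simp: h_def g0_def G_def PiE_def extensional_def)
        then show False using that by auto
      qed
      moreover have "\<bar>h i\<bar> \<le> int M ^ s" if "i \<in> I" for i
      proof -
        have "g i \<le> 2 * R" using \<open>g \<in> G - {g0}\<close> that by (auto simp: G_def)
        then have "\<bar>h i\<bar> \<le> int R" by (auto simp: h_def)
        then show ?thesis by (simp add: R_def)
      qed
      ultimately have "norm (\<Sum>n\<in>S. expi (\<Sum>i\<in>I. of_int (h i) * F i n)) \<le> real (card S) / real M ^ a"
        using contra by (meson less_imp_le not_le)
      then have "norm (\<Sum>n\<in>S. expi (\<Sum>i\<in>I. (real (g i) - real R) * F i n)) \<le> real (card S) / real M ^ a"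
        by (simp add: h_def)
      moreover have "norm (\<Prod>i\<in>I. complex_of_real (c (g i))) = (\<Prod>i\<in>I. c (g i))"
        by (simp add: prod_norm[symmetric] c_nonneg)
      ultimately show ?thesis
        unfolding T_def norm_mult norm_expi mult_1_right
        by (simp only:) (intro mult_left_mono prod_nonneg c_nonneg)
    qed
    have "norm (\<Sum>g\<in>G - {g0}. T g) \<le> (\<Sum>g\<in>G - {g0}. (\<Prod>i\<in>I. c (g i)) * (real (card S) / real M ^ a))"
      by (intro sum_norm_le rest)
    also have "\<dots> \<le> (\<Sum>g\<in>G. (\<Prod>i\<in>I. c (g i)) * (real (card S) / real M ^ a))"
      using finG by (intro sum_mono2 mult_nonneg_nonneg prod_nonneg c_nonneg) auto
    also have "\<dots> = real (card S) / real M ^ a"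
      unfolding sum_distrib_right[symmetric] c_sum by simp
    finally have tail: "norm (\<Sum>g\<in>G - {g0}. T g) \<le> real (card S) / real M ^ a" .
    have "c R ^ D * real (card S) = norm (T g0)" unfolding main norm_of_real by (simp add: c_nonneg)
    also have "T g0 = (\<Sum>n\<in>S. P n) - (\<Sum>g\<in>G - {g0}. T g)"
      unfolding expand using finG g0 by (simp add: sum.remove)
    also have "norm \<dots> \<le> norm (\<Sum>n\<in>S. P n) + real (card S) / real M ^ a"
      using norm_triangle_ineq4 tail by (meson add_left_mono order_trans)
    also have "norm (\<Sum>n\<in>S. P n) \<le> (\<Sum>n\<in>S. (1 - 4 / (real M)\<^sup>2) ^ R)"
    proof (rule sum_norm_le)
      fix n assume n: "n \<in> S"
      obtain j where j: "j \<in> I" "dist_int (F j n - v j) > 1 / real M" using bad n by blast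
      have "norm (P n) = (\<Prod>i\<in>I. (cos (pi * (F i n - v i)))\<^sup>2 ^ R)"
        unfolding P_def cos_kernel_eq prod_norm[symmetric] norm_of_real by simp
      also have "\<dots> = (cos (pi * (F j n - v j)))\<^sup>2 ^ R * (\<Prod>i\<in>I - {j}. (cos (pi * (F i n - v i)))\<^sup>2 ^ R)"
        using I j by (simp add: prod.remove)
      also have "\<dots> \<le> (cos (pi * (F j n - v j)))\<^sup>2 ^ R * 1"
        by (intro mult_left_mono prod_le_1) (auto intro!: power_le_one[OF zero_le_power2] simp: abs_square_le_1 simp del: power_le_one_iff)
      also have "\<dots> \<le> (1 - 4 / (real M)\<^sup>2) ^ R"
      proof -
        have "(1 / real M)\<^sup>2 \<le> (dist_int (F j n - v j))\<^sup>2"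
          using j by (intro power_mono) auto
        then have "(cos (pi * (F j n - v j)))\<^sup>2 \<le> 1 - 4 / (real M)\<^sup>2"
          using cos_squared_le[of "F j n - v j"] by (simp add: power_divide)
        then show ?thesis by (simp add: power_mono)
      qed
      finally show "norm (P n) \<le> (1 - 4 / (real M)\<^sup>2) ^ R" .
    qed
    also have "\<dots> = real (card S) * (1 - 4 / (real M)\<^sup>2) ^ R" by simp
    finally have "real (card S) * c R ^ D \<le> real (card S) * ((1 - 4 / (real M)\<^sup>2) ^ R + 1 / real M ^ a)"
      by (simp add: algebra_simps)
    then have le: "c R ^ D \<le> (1 - 4 / (real M)\<^sup>2) ^ R + 1 / real M ^ a"
      using S by (simp add: card_gt_0_iff)
    have "(1 - 4 / (real M)\<^sup>2) ^ R \<le> exp (- (4 / (real M)\<^sup>2)) ^ R"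
    proof (rule power_mono)
      show "1 - 4 / (real M)\<^sup>2 \<le> exp (- (4 / (real M)\<^sup>2))"
        using exp_ge_add_one_self[of "- (4 / (real M)\<^sup>2)"] by simp
      have "2\<^sup>2 \<le> (real M)\<^sup>2" using M by (intro power_mono) auto
      then show "0 \<le> 1 - 4 / (real M)\<^sup>2" using M by simp
    qed
    also have "\<dots> = exp (- (4 * real M ^ (s - 2)))"
    proof -
      have "real M ^ s = real M ^ (s - 2) * (real M)\<^sup>2"
        using s(1) by (metis le_add_diff_inverse2 power_add)
      then have "real R * (- (4 / (real M)\<^sup>2)) = - (4 * real M ^ (s - 2))"
        using M by (simp add: R_def field_simps)
      then show ?thesis by (simp only: exp_of_nat_mult[symmetric])
    qed
    also have "\<dots> < 1 / real M ^ a"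
      using s(2)[OF M] M unfolding a_def exp_minus inverse_eq_divide
      by (intro divide_strict_left_mono) auto
    finally have "c R ^ D < 2 / real M ^ a" using le by (simp add: add_divide_distrib[symmetric])
    also have "\<dots> \<le> 1 / real M ^ ((s + 1) * D)"
      using M by (simp add: a_def field_simps)
    also have "\<dots> = (1 / real M ^ (s + 1)) ^ D" by (simp only: power_divide power_mult power_one)
    also have "\<dots> \<le> c R ^ D"
    proof (rule power_mono)
      have "2 * real R \<le> real M ^ (s + 1)" using M by (simp add: R_def)
      then have "1 / real M ^ (s + 1) \<le> 1 / (2 * real R)" using R by (intro divide_left_mono) auto
      also have "\<dots> = 4 ^ R / (2 * real R) / 4 ^ R" by simp
      also have "\<dots> \<le> c R"
        unfolding c_def using central_binomial_lower_bound[of R] R by (intro divide_right_mono) auto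
      finally show "1 / real M ^ (s + 1) \<le> c R" .
    qed simp
    finally show False by simp
  qed
qed

section \<open>Recurrence from an inverse theorem\<close>

definition gen_poly :: "real set \<Rightarrow> (real \<Rightarrow> real) \<Rightarrow> real \<Rightarrow> real" where
  "gen_poly \<Theta> \<gamma> x = (\<Sum>\<theta>\<in>\<Theta>. \<gamma> \<theta> * x powr \<theta>)"

text \<open>A generalised polynomial whose exponential sum over some block of integers below
  \<open>Z ^ r\<close> is large (with \<open>Z = M ^ w\<close>) has, up to a common denominator \<open>q\<close>, all its coefficients
  close to integers, and to zero for the exponents outside \<open>\<nat>\<close>. The order of the quantifiers
  matters: the size \<open>M ^ \<sigma>\<close> of \<open>q\<close> is fixed before the scale \<open>w\<close>, and the admissible size
  \<open>(Z ^ r) ^ B\<close> of the coefficients is measured against the length of the range.\<close>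

definition inverse_property :: "real set \<Rightarrow> bool" where
  "inverse_property \<Theta> \<longleftrightarrow> (\<forall>B \<kappa>. \<exists>r\<ge>2. \<forall>a. \<exists>\<sigma> w\<^sub>0. \<forall>w\<ge>w\<^sub>0. \<forall>M\<ge>2. \<exists>X\<ge>1. \<exists>L\<ge>1.
     X + L \<le> (M ^ w) ^ r \<and>
     (\<forall>\<gamma>. (\<forall>\<theta>\<in>\<Theta>. \<theta> \<notin> \<nat> \<longrightarrow> \<bar>\<gamma> \<theta>\<bar> \<le> (real M ^ w) ^ (r * B)) \<longrightarrow>
        real L / real M ^ a \<le> norm (\<Sum>y<L. expi (gen_poly \<Theta> \<gamma> (real (X + y)))) \<longrightarrow>
        (\<exists>q\<ge>1. \<exists>m :: real \<Rightarrow> int. q \<le> M ^ \<sigma> \<and>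
           (\<forall>\<theta>\<in>\<Theta>. (\<theta> \<notin> \<nat> \<longrightarrow> m \<theta> = 0) \<and> \<bar>real q * \<gamma> \<theta> - of_int (m \<theta>)\<bar> \<le> 1 / (real M ^ w) ^ \<kappa>))))"

text \<open>The target \<open>\<Sum>\<theta>\<in>\<Theta>. t \<theta> * \<Gamma> i \<theta>\<close> is a combination of the coefficient vectors of the
  non-integral exponents only; such targets survive the elimination of a coordinate below.\<close>

definition recurrence_property :: "real set \<Rightarrow> nat \<Rightarrow> bool" where
  "recurrence_property \<Theta> D \<longleftrightarrow> (\<forall>B. \<exists>g\<ge>1. \<forall>M\<ge>2. \<forall>I (\<Gamma> :: nat \<Rightarrow> real \<Rightarrow> real) t. finite I \<longrightarrow> card I = D \<longrightarrow>
     (\<forall>i\<in>I. \<forall>\<theta>\<in>\<Theta>. \<theta> \<notin> \<nat> \<longrightarrow> \<bar>\<Gamma> i \<theta>\<bar> \<le> (real M ^ g) ^ B) \<longrightarrow>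
     (\<forall>\<theta>\<in>\<Theta>. \<bar>t \<theta>\<bar> \<le> 1 \<and> (\<theta> \<in> \<nat> \<longrightarrow> t \<theta> = 0)) \<longrightarrow>
     (\<exists>n\<ge>1. n \<le> M ^ g \<and>
        (\<forall>i\<in>I. dist_int (gen_poly \<Theta> (\<Gamma> i) (real n) - (\<Sum>\<theta>\<in>\<Theta>. t \<theta> * \<Gamma> i \<theta>)) \<le> 1 / real M)))"

text \<open>An approximate integer relation with coefficients \<open>h\<close> between the coordinates expresses the
  coordinate \<open>i\<^sub>0\<close> through the others along the multiples of \<open>Q\<close>; dividing the remaining ones by
  \<open>h i\<^sub>0\<close> absorbs the denominator.\<close>

lemma eliminate_coordinate:
  fixes \<Gamma> :: "nat \<Rightarrow> real \<Rightarrow> real" and h :: "nat \<Rightarrow> int" and m :: "real \<Rightarrow> int" and q n Tm :: nat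
  assumes I: "finite I" "i\<^sub>0 \<in> I" and h: "h i\<^sub>0 \<noteq> 0" "\<And>i. i \<in> I \<Longrightarrow> \<bar>real_of_int (h i)\<bar> \<le> H"
    and q: "q \<ge> 1" and n: "n \<ge> 1" and \<Theta>: "finite \<Theta>" "\<And>\<theta>. \<theta> \<in> \<Theta> \<Longrightarrow> 1 \<le> \<theta>" "\<And>\<theta>. \<theta> \<in> \<Theta> \<Longrightarrow> \<theta> \<le> real Tm"
    and m: "\<And>\<theta>. \<theta> \<in> \<Theta> \<Longrightarrow> \<theta> \<notin> \<nat> \<Longrightarrow> m \<theta> = 0"
      "\<And>\<theta>. \<theta> \<in> \<Theta> \<Longrightarrow> \<bar>real q * (\<Sum>i\<in>I. of_int (h i) * \<Gamma> i \<theta>) - of_int (m \<theta>)\<bar> \<le> \<beta>"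
    and t: "\<And>\<theta>. \<theta> \<in> \<Theta> \<Longrightarrow> \<bar>t \<theta>\<bar> \<le> 1" "\<And>\<theta>. \<theta> \<in> \<Theta> \<Longrightarrow> \<theta> \<in> \<nat> \<Longrightarrow> t \<theta> = 0"
  defines "Q \<equiv> q * nat \<bar>h i\<^sub>0\<bar>"
  assumes IH: "\<And>i. i \<in> I - {i\<^sub>0} \<Longrightarrow> dist_int (gen_poly \<Theta> (\<lambda>\<theta>. \<Gamma> i \<theta> * real Q powr \<theta> / of_int (h i\<^sub>0)) (real n)
      - (\<Sum>\<theta>\<in>\<Theta>. t \<theta> * real Q powr (- \<theta>) * (\<Gamma> i \<theta> * real Q powr \<theta> / of_int (h i\<^sub>0)))) \<le> \<delta>"
    and "0 \<le> \<delta>" and i: "i \<in> I"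
  shows "dist_int (gen_poly \<Theta> (\<Gamma> i) (real (Q * n)) - (\<Sum>\<theta>\<in>\<Theta>. t \<theta> * \<Gamma> i \<theta>))
    \<le> real (card I) * H * \<delta> + 2 * real (card \<Theta>) * \<beta> * real (Q * n) ^ Tm"
proof -
  define x where "x = (\<lambda>i. gen_poly \<Theta> (\<Gamma> i) (real (Q * n)) - (\<Sum>\<theta>\<in>\<Theta>. t \<theta> * \<Gamma> i \<theta>))"
  define h\<^sub>0 where "h\<^sub>0 = real_of_int (h i\<^sub>0)"
  define \<gamma> where "\<gamma> = (\<lambda>\<theta>. \<Sum>i\<in>I. of_int (h i) * \<Gamma> i \<theta>)"
  have h\<^sub>0: "h\<^sub>0 \<noteq> 0" "1 \<le> \<bar>h\<^sub>0\<bar>" using h(1) by (auto simp: h\<^sub>0_def)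
  have Q: "Q \<ge> 1" using q h(1) by (simp add: Q_def Suc_le_eq)
  have H: "1 \<le> H" using h(2)[OF I(2)] h\<^sub>0 by (simp add: h\<^sub>0_def)
  \<comment> \<open>At \<open>Q * n\<close> the factors \<open>Q powr \<theta>\<close> and
    \<open>Q powr (- \<theta>)\<close> cancel in the target, so the induction hypothesis controls
    exactly \<open>x i / h\<^sub>0\<close>.\<close>
  have y: "dist_int (x i / h\<^sub>0) \<le> \<delta>" if "i \<in> I - {i\<^sub>0}" for i
  proof -
    have "x i / h\<^sub>0 = gen_poly \<Theta> (\<lambda>\<theta>. \<Gamma> i \<theta> * real Q powr \<theta> / of_int (h i\<^sub>0)) (real n)
      - (\<Sum>\<theta>\<in>\<Theta>. t \<theta> * real Q powr (- \<theta>) * (\<Gamma> i \<theta> * real Q powr \<theta> / of_int (h i\<^sub>0)))"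
      unfolding x_def gen_poly_def diff_divide_distrib sum_divide_distrib h\<^sub>0_def
      using Q n by (intro arg_cong2[where f = "(-)"] sum.cong) (auto simp: powr_mult powr_minus field_simps)
    then show ?thesis using IH[OF that] by simp
  qed
  have \<beta>: "0 \<le> \<beta>" if "\<theta> \<in> \<Theta>" for \<theta> using m(2)[OF that] by (meson abs_ge_zero order_trans)
  have nonneg: "0 \<le> 2 * real (card \<Theta>) * \<beta> * real (Q * n) ^ Tm"
    using \<beta> by (cases "\<Theta> = {}") auto
  show ?thesis
  proof (cases "i = i\<^sub>0")
    case False
    have "dist_int (x i) = dist_int (of_int (h i\<^sub>0) * (x i / h\<^sub>0))"
      using h\<^sub>0 by (simp add: h\<^sub>0_def)
    also have "\<dots> \<le> \<bar>of_int (h i\<^sub>0)\<bar> * dist_int (x i / h\<^sub>0)" by (rule dist_int_mult_int)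
    also have "\<dots> \<le> H * \<delta>"
      using y i False h(2)[OF I(2)] H by (intro mult_mono) (auto simp: dist_int_nonneg)
    also have "\<dots> \<le> real (card I) * H * \<delta>"
      using I H \<open>0 \<le> \<delta>\<close> mult_right_mono[of 1 "real (card I)" "H * \<delta>"]
      by (simp add: mult.assoc Suc_le_eq card_gt_0_iff) blast
    finally show ?thesis using nonneg unfolding x_def by linarith
  next
    case True
    have "(\<Sum>i\<in>I. of_int (h i) * x i) = (\<Sum>\<theta>\<in>\<Theta>. \<gamma> \<theta> * (real (Q * n) powr \<theta> - t \<theta>))"
    proof -
      have "(\<Sum>i\<in>I. of_int (h i) * x i) = (\<Sum>i\<in>I. \<Sum>\<theta>\<in>\<Theta>. of_int (h i) * \<Gamma> i \<theta> * (real (Q * n) powr \<theta> - t \<theta>))"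
        unfolding x_def gen_poly_def sum_subtractf[symmetric] sum_distrib_left
        by (intro sum.cong) (auto simp: algebra_simps)
      also have "\<dots> = (\<Sum>\<theta>\<in>\<Theta>. \<gamma> \<theta> * (real (Q * n) powr \<theta> - t \<theta>))"
        unfolding \<gamma>_def sum_distrib_right by (rule sum.swap)
      finally show ?thesis .
    qed
    moreover have "(\<Sum>i\<in>I. of_int (h i) * x i) = h\<^sub>0 * x i\<^sub>0 + (\<Sum>i\<in>I - {i\<^sub>0}. of_int (h i) * x i)"
      using I by (simp add: sum.remove h\<^sub>0_def)
    ultimately have "h\<^sub>0 * x i\<^sub>0 = (\<Sum>\<theta>\<in>\<Theta>. \<gamma> \<theta> * (real (Q * n) powr \<theta> - t \<theta>)) - (\<Sum>i\<in>I - {i\<^sub>0}. of_int (h i) * x i)"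
      by linarith
    then have "x i\<^sub>0 = ((\<Sum>\<theta>\<in>\<Theta>. \<gamma> \<theta> * (real (Q * n) powr \<theta> - t \<theta>)) - (\<Sum>i\<in>I - {i\<^sub>0}. of_int (h i) * x i)) / h\<^sub>0"
      using h\<^sub>0 by (simp add: field_simps)
    \<comment> \<open>Every other coordinate enters as \<open>x i / h\<^sub>0\<close> with an
      integer factor, so the division by \<open>h\<^sub>0\<close> is harmless modulo 1.\<close>
    also have "\<dots> = (\<Sum>\<theta>\<in>\<Theta>. \<gamma> \<theta> * (real (Q * n) powr \<theta> - t \<theta>) / h\<^sub>0) + (\<Sum>i\<in>I - {i\<^sub>0}. of_int (- h i) * (x i / h\<^sub>0))"
      by (simp add: diff_divide_distrib sum_divide_distrib sum_negf)
    finally have "dist_int (x i\<^sub>0) \<le> dist_int (\<Sum>\<theta>\<in>\<Theta>. \<gamma> \<theta> * (real (Q * n) powr \<theta> - t \<theta>) / h\<^sub>0)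
        + dist_int (\<Sum>i\<in>I - {i\<^sub>0}. of_int (- h i) * (x i / h\<^sub>0))"
      by (simp only: dist_int_add)
    moreover have "dist_int (\<Sum>i\<in>I - {i\<^sub>0}. of_int (- h i) * (x i / h\<^sub>0)) \<le> real (card I) * H * \<delta>"
    proof -
      have "dist_int (\<Sum>i\<in>I - {i\<^sub>0}. of_int (- h i) * (x i / h\<^sub>0)) \<le> (\<Sum>i\<in>I - {i\<^sub>0}. dist_int (of_int (- h i) * (x i / h\<^sub>0)))"
        by (rule dist_int_sum)
      also have "\<dots> \<le> (\<Sum>i\<in>I - {i\<^sub>0}. H * \<delta>)"
      proof (rule sum_mono)
        fix i assume i: "i \<in> I - {i\<^sub>0}"
        have "dist_int (of_int (- h i) * (x i / h\<^sub>0)) \<le> \<bar>of_int (- h i)\<bar> * dist_int (x i / h\<^sub>0)"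
          by (rule dist_int_mult_int)
        also have "\<dots> \<le> H * \<delta>"
          using y[OF i] i h(2)[of i] H by (intro mult_mono) (auto simp: dist_int_nonneg)
        finally show "dist_int (of_int (- h i) * (x i / h\<^sub>0)) \<le> H * \<delta>" .
      qed
      also have "\<dots> \<le> real (card I) * (H * \<delta>)"
        using H \<open>0 \<le> \<delta>\<close> I by (auto intro!: mult_right_mono card_mono)
      finally show ?thesis by (simp add: mult.assoc)
    qed
    moreover have "dist_int (\<Sum>\<theta>\<in>\<Theta>. \<gamma> \<theta> * (real (Q * n) powr \<theta> - t \<theta>) / h\<^sub>0) \<le> 2 * real (card \<Theta>) * \<beta> * real (Q * n) ^ Tm"
    proof -
      have "dist_int (\<Sum>\<theta>\<in>\<Theta>. \<gamma> \<theta> * (real (Q * n) powr \<theta> - t \<theta>) / h\<^sub>0)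
          \<le> (\<Sum>\<theta>\<in>\<Theta>. dist_int (\<gamma> \<theta> * (real (Q * n) powr \<theta> - t \<theta>) / h\<^sub>0))"
        by (rule dist_int_sum)
      also have "\<dots> \<le> (\<Sum>\<theta>\<in>\<Theta>. 2 * \<beta> * real (Q * n) ^ Tm)"
      proof (rule sum_mono)
        fix \<theta> assume \<theta>: "\<theta> \<in> \<Theta>"
        define z where "z = real (Q * n) powr \<theta> - t \<theta>"
        define e where "e = real q * \<gamma> \<theta> - of_int (m \<theta>)"
        have Qn: "1 \<le> real (Q * n)" using Q n mult_le_mono[of 1 Q 1 n] by linarith
        have e: "\<bar>e\<bar> \<le> \<beta>" using m(2)[OF \<theta>] by (simp add: e_def \<gamma>_def)
        have "real (Q * n) powr \<theta> \<le> real (Q * n) powr real Tm"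
          using Qn \<Theta>(3)[OF \<theta>] by (intro powr_mono)
        then have "real (Q * n) powr \<theta> \<le> real (Q * n) ^ Tm" using Qn by (simp add: powr_realpow)
        moreover have "1 \<le> real (Q * n) ^ Tm" using Qn by (rule one_le_power)
        ultimately have z: "\<bar>z\<bar> \<le> 2 * real (Q * n) ^ Tm"
          using t(1)[OF \<theta>] unfolding z_def by (smt (verit) powr_ge_zero)
        have qh: "1 \<le> \<bar>real q * h\<^sub>0\<bar>"
          using q h\<^sub>0 mult_mono[of 1 "real q" 1 "\<bar>h\<^sub>0\<bar>"] by (simp add: abs_mult)
        have "\<gamma> \<theta> * z / h\<^sub>0 = (real q * \<gamma> \<theta>) * z / (real q * h\<^sub>0)" using q by simp
        also have "\<dots> = e * z / (real q * h\<^sub>0) + of_int (m \<theta>) * z / (real q * h\<^sub>0)"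
          by (simp add: e_def ring_distribs diff_divide_distrib)
        finally have eq: "\<gamma> \<theta> * z / h\<^sub>0 = e * z / (real q * h\<^sub>0) + of_int (m \<theta>) * z / (real q * h\<^sub>0)" .
        \<comment> \<open>For a non-integral exponent \<open>m \<theta> = 0\<close>. For an integral
          one the target vanishes, and since the exponent is at least 1,
          \<open>(Q * n) ^ Suc d\<close> has a factor \<open>Q = q * \<bar>h i\<^sub>0\<bar>\<close>
          that cancels the denominator.\<close>
        have int: "of_int (m \<theta>) * z / (real q * h\<^sub>0) \<in> \<int>"
        proof (cases "\<theta> \<in> \<nat>")
          case False
          then show ?thesis using m(1)[OF \<theta>] by simp
        next
          case True
          then obtain d' where d': "\<theta> = real d'" by (auto elim: Nats_cases)
          then obtain d where d: "\<theta> = real (Suc d)" using \<Theta>(2)[OF \<theta>] by (cases d') auto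
          have "z = real (Q * n) ^ Suc d"
            using t(2)[OF \<theta> True] Qn unfolding z_def d by (subst powr_realpow) auto
          also have "\<dots> = real q * \<bar>h\<^sub>0\<bar> * real n * real (Q * n) ^ d"
            by (simp add: Q_def h\<^sub>0_def)
          finally have "of_int (m \<theta>) * z / (real q * h\<^sub>0) = of_int (m \<theta>) * (\<bar>h\<^sub>0\<bar> / h\<^sub>0) * real n * real (Q * n) ^ d"
            using q by simp
          also have "\<bar>h\<^sub>0\<bar> / h\<^sub>0 = of_int (sgn (h i\<^sub>0))" using h(1) by (auto simp: h\<^sub>0_def abs_if sgn_if)
          also have "of_int (m \<theta>) * of_int (sgn (h i\<^sub>0)) * real n * real (Q * n) ^ d = of_int (m \<theta> * sgn (h i\<^sub>0) * int n * int (Q * n) ^ d)"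
            by simp
          finally show ?thesis by (metis Ints_of_int)
        qed
        have "dist_int (\<gamma> \<theta> * z / h\<^sub>0) = dist_int (e * z / (real q * h\<^sub>0))"
          unfolding eq using int by (rule dist_int_add_Ints)
        also have "\<dots> \<le> \<bar>e * z / (real q * h\<^sub>0)\<bar>" by (rule dist_int_le_abs)
        also have "\<dots> = \<bar>e\<bar> * \<bar>z\<bar> / \<bar>real q * h\<^sub>0\<bar>" by (simp add: abs_mult)
        also have "\<dots> \<le> \<bar>e\<bar> * \<bar>z\<bar> / 1" using qh q h\<^sub>0 by (intro divide_left_mono) auto
        also have "\<dots> \<le> \<beta> * (2 * real (Q * n) ^ Tm)"
          using e z by (simp only: div_by_1) (intro mult_mono, auto)
        finally show "dist_int (\<gamma> \<theta> * (real (Q * n) powr \<theta> - t \<theta>) / h\<^sub>0) \<le> 2 * \<beta> * real (Q * n) ^ Tm"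
          by (simp add: z_def mult_ac)
      qed
      also have "\<dots> = 2 * real (card \<Theta>) * \<beta> * real (Q * n) ^ Tm" by simp
      finally show ?thesis .
    qed
    ultimately show ?thesis using True by (simp add: x_def)
  qed
qed

section \<open>Absorbing constants into powers of \<open>M\<close>\<close>

lemma nat_le_power:
  fixes M k c :: nat
  assumes "M \<ge> 2" "k \<le> c"
  shows "k \<le> M ^ c"
proof -
  have "k < 2 ^ k" by (rule less_exp)
  also have "\<dots> \<le> M ^ k" using assms by (intro power_mono) auto
  also have "\<dots> \<le> M ^ c" using assms by (intro power_increasing) auto
  finally show ?thesis by simp
qed

lemma mult_power_le_power:
  fixes M k e c :: nat
  assumes "M \<ge> 2" "k + e \<le> c"
  shows "k * M ^ e \<le> M ^ c"
proof -
  have "k * M ^ e \<le> M ^ k * M ^ e" using assms nat_le_power[of M k k] by (intro mult_right_mono) auto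
  also have "\<dots> \<le> M ^ c" unfolding power_add[symmetric] using assms by (intro power_increasing) auto
  finally show ?thesis .
qed

lemma finite_real_set_bound:
  fixes \<Theta> :: "real set"
  assumes "finite \<Theta>"
  obtains Tm :: nat where "\<And>\<theta>. \<theta> \<in> \<Theta> \<Longrightarrow> \<theta> \<le> real Tm"
proof -
  obtain b where "\<And>\<theta>. \<theta> \<in> \<Theta> \<Longrightarrow> \<theta> \<le> b" using bdd_above_finite[OF assms] by (auto simp: bdd_above_def)
  then show thesis using that[of "nat \<lceil>b\<rceil>"] by (meson order_trans real_nat_ceiling_ge)
qed

text \<open>Two ranges interact: the block for the inverse property ends below \<open>Z ^ r\<close>,
  while the reduced system is solved with \<open>n' <= Z\<close> and accuracy
  \<open>1 / M ^ c\<close>. This gap pays for passing from \<open>n'\<close> to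
  \<open>Q * n'\<close> and for multiplying the errors by the relation coefficients.\<close>

lemma recurrence_from_inverse:
  assumes \<Theta>: "finite \<Theta>" "\<And>\<theta>. \<theta> \<in> \<Theta> \<Longrightarrow> 1 \<le> \<theta>" and inv: "inverse_property \<Theta>"
  shows "recurrence_property \<Theta> D"
proof (induction D)
  case 0
  show ?case
    unfolding recurrence_property_def
  proof (intro allI exI[of _ 1] conjI impI)
    fix M :: nat and I :: "nat set"
    assume "M \<ge> 2" "finite I" "card I = 0"
    then show "1 \<le> M ^ 1" by simp
    from \<open>finite I\<close> \<open>card I = 0\<close> have "I = {}" by simp
    then show "\<forall>i\<in>I. dist_int (gen_poly \<Theta> (\<Gamma> i) (real 1) - (\<Sum>\<theta>\<in>\<Theta>. t \<theta> * \<Gamma> i \<theta>)) \<le> 1 / real M" for \<Gamma> t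
      by simp
  qed simp_all
next
  case (Suc D)
  obtain Tm :: nat where Tm: "\<And>\<theta>. \<theta> \<in> \<Theta> \<Longrightarrow> \<theta> \<le> real Tm"
    using finite_real_set_bound[OF \<Theta>(1)] by blast
  obtain s a :: nat where large: "\<forall>M\<ge>2. \<forall>I (F :: nat \<Rightarrow> nat \<Rightarrow> real) v S. finite I \<longrightarrow> card I = Suc D \<longrightarrow>
      finite S \<longrightarrow> S \<noteq> {} \<longrightarrow> (\<forall>n\<in>S. \<exists>i\<in>I. dist_int (F i n - v i) > 1 / real M) \<longrightarrow>
      (\<exists>h :: nat \<Rightarrow> int. (\<exists>i\<in>I. h i \<noteq> 0) \<and> (\<forall>i\<in>I. \<bar>h i\<bar> \<le> int M ^ s) \<and>
        real (card S) / real M ^ a \<le> norm (\<Sum>n\<in>S. expi (\<Sum>i\<in>I. of_int (h i) * F i n)))"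
    using large_Weyl_sum[of "Suc D"] by (elim exE)
  show ?case
    unfolding recurrence_property_def
  proof
    fix B :: nat
    \<comment> \<open>The error of the relation is multiplied by \<open>(Q * n') ^ Tm\<close>, which
      may reach \<open>Z ^ (2 * Tm)\<close>; the two further powers leave
      \<open>1 / Z ^ 2\<close>.\<close>
    define \<kappa> where "\<kappa> = 2 * Tm + 2"
    \<comment> \<open>\<open>B + 1\<close> instead of \<open>B\<close> leaves a spare factor
      \<open>Z ^ r\<close> for the passage from \<open>\<Gamma> i\<close> to an integer combination
      with coefficients up to \<open>M ^ s\<close>.\<close>
    obtain r where r: "r \<ge> 2" and r': "\<forall>a. \<exists>\<sigma> w\<^sub>0. \<forall>w\<ge>w\<^sub>0. \<forall>M\<ge>2. \<exists>X\<ge>1. \<exists>L\<ge>1.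
       X + L \<le> (M ^ w) ^ r \<and>
       (\<forall>\<gamma>. (\<forall>\<theta>\<in>\<Theta>. \<theta> \<notin> \<nat> \<longrightarrow> \<bar>\<gamma> \<theta>\<bar> \<le> (real M ^ w) ^ (r * (B + 1))) \<longrightarrow>
          real L / real M ^ a \<le> norm (\<Sum>y<L. expi (gen_poly \<Theta> \<gamma> (real (X + y)))) \<longrightarrow>
          (\<exists>q\<ge>1. \<exists>m :: real \<Rightarrow> int. q \<le> M ^ \<sigma> \<and>
             (\<forall>\<theta>\<in>\<Theta>. (\<theta> \<notin> \<nat> \<longrightarrow> m \<theta> = 0) \<and> \<bar>real q * \<gamma> \<theta> - of_int (m \<theta>)\<bar> \<le> 1 / (real M ^ w) ^ \<kappa>)))"
      using inv[unfolded inverse_property_def, rule_format, of "B + 1" \<kappa>] by (elim exE conjE)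
    obtain \<sigma> w\<^sub>0 where inv': "\<forall>w\<ge>w\<^sub>0. \<forall>M\<ge>2. \<exists>X\<ge>1. \<exists>L\<ge>1.
       X + L \<le> (M ^ w) ^ r \<and>
       (\<forall>\<gamma>. (\<forall>\<theta>\<in>\<Theta>. \<theta> \<notin> \<nat> \<longrightarrow> \<bar>\<gamma> \<theta>\<bar> \<le> (real M ^ w) ^ (r * (B + 1))) \<longrightarrow>
          real L / real M ^ a \<le> norm (\<Sum>y<L. expi (gen_poly \<Theta> \<gamma> (real (X + y)))) \<longrightarrow>
          (\<exists>q\<ge>1. \<exists>m :: real \<Rightarrow> int. q \<le> M ^ \<sigma> \<and>
             (\<forall>\<theta>\<in>\<Theta>. (\<theta> \<notin> \<nat> \<longrightarrow> m \<theta> = 0) \<and> \<bar>real q * \<gamma> \<theta> - of_int (m \<theta>)\<bar> \<le> 1 / (real M ^ w) ^ \<kappa>)))"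
      using r'[rule_format, of a] by (elim exE)
    \<comment> \<open>The rescaled coefficients
      \<open>\<Gamma> i \<theta> * Q powr \<theta> / h i\<^sub>0\<close> are bounded by
      \<open>Z ^ (r * B + Tm)\<close>. This exponent must be known before \<open>g'\<close>, which
      in turn determines \<open>w\<close>; hence \<open>r\<close> precedes \<open>w\<close> in
      \<open>inverse_property\<close>.\<close>
    obtain g' where g': "g' \<ge> 1" and IH: "\<forall>M\<ge>2. \<forall>I (\<Gamma> :: nat \<Rightarrow> real \<Rightarrow> real) t. finite I \<longrightarrow> card I = D \<longrightarrow>
     (\<forall>i\<in>I. \<forall>\<theta>\<in>\<Theta>. \<theta> \<notin> \<nat> \<longrightarrow> \<bar>\<Gamma> i \<theta>\<bar> \<le> (real M ^ g') ^ (r * B + Tm)) \<longrightarrow>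
     (\<forall>\<theta>\<in>\<Theta>. \<bar>t \<theta>\<bar> \<le> 1 \<and> (\<theta> \<in> \<nat> \<longrightarrow> t \<theta> = 0)) \<longrightarrow>
     (\<exists>n\<ge>1. n \<le> M ^ g' \<and>
        (\<forall>i\<in>I. dist_int (gen_poly \<Theta> (\<Gamma> i) (real n) - (\<Sum>\<theta>\<in>\<Theta>. t \<theta> * \<Gamma> i \<theta>)) \<le> 1 / real M))"
      using Suc[unfolded recurrence_property_def, rule_format, of "r * B + Tm"] by (elim exE conjE)
    \<comment> \<open>\<open>w\<^sub>0\<close> makes the scale admissible,
      \<open>\<sigma> + s\<close> gives \<open>Q <= M ^ c\<close>, and the other summands absorb the
      constants of the two error terms.\<close>
    define c where "c = w\<^sub>0 + \<sigma> + s + 4 * card \<Theta> + 2 * Suc D + 2"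
    \<comment> \<open>With this scale \<open>Z = (M ^ c) ^ g'\<close> is precisely the range of the
      induction hypothesis applied to \<open>M ^ c\<close>.\<close>
    define w where "w = c * g'"
    define g where "g = w * r"
    have cw: "c \<le> w" using g' by (simp add: w_def)
    have "g \<ge> 1" using r cw by (simp add: g_def c_def Suc_le_eq)
    show "\<exists>g\<ge>1. \<forall>M\<ge>2. \<forall>I (\<Gamma> :: nat \<Rightarrow> real \<Rightarrow> real) t. finite I \<longrightarrow> card I = Suc D \<longrightarrow>
     (\<forall>i\<in>I. \<forall>\<theta>\<in>\<Theta>. \<theta> \<notin> \<nat> \<longrightarrow> \<bar>\<Gamma> i \<theta>\<bar> \<le> (real M ^ g) ^ B) \<longrightarrow>
     (\<forall>\<theta>\<in>\<Theta>. \<bar>t \<theta>\<bar> \<le> 1 \<and> (\<theta> \<in> \<nat> \<longrightarrow> t \<theta> = 0)) \<longrightarrow>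
     (\<exists>n\<ge>1. n \<le> M ^ g \<and>
        (\<forall>i\<in>I. dist_int (gen_poly \<Theta> (\<Gamma> i) (real n) - (\<Sum>\<theta>\<in>\<Theta>. t \<theta> * \<Gamma> i \<theta>)) \<le> 1 / real M))"
    proof (rule exI[of _ g], rule conjI[OF \<open>g \<ge> 1\<close>], intro allI impI)
      fix M :: nat and I :: "nat set" and \<Gamma> :: "nat \<Rightarrow> real \<Rightarrow> real" and t :: "real \<Rightarrow> real"
      assume M: "M \<ge> 2" and I: "finite I" "card I = Suc D"
        and \<Gamma>: "\<forall>i\<in>I. \<forall>\<theta>\<in>\<Theta>. \<theta> \<notin> \<nat> \<longrightarrow> \<bar>\<Gamma> i \<theta>\<bar> \<le> (real M ^ g) ^ B"
        and t: "\<forall>\<theta>\<in>\<Theta>. \<bar>t \<theta>\<bar> \<le> 1 \<and> (\<theta> \<in> \<nat> \<longrightarrow> t \<theta> = 0)"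
      define Z where "Z = M ^ w"
      have McZ: "M ^ c \<le> Z" unfolding Z_def using M cw by (intro power_increasing) auto
      have Z: "Z \<ge> 1" using M by (simp add: Z_def)
      have ZM: "real Z = real M ^ w" by (simp add: Z_def)
      have gZ: "M ^ g = Z ^ r" by (simp add: g_def Z_def power_mult)
      have gZB: "(real M ^ g) ^ B = real Z ^ (r * B)"
        by (simp add: g_def ZM power_mult)
      have "w \<ge> w\<^sub>0" using cw by (simp add: c_def)
      with inv'[rule_format, OF _ M]
      have "\<exists>X\<ge>1. \<exists>L\<ge>1. X + L \<le> Z ^ r \<and>
       (\<forall>\<gamma>. (\<forall>\<theta>\<in>\<Theta>. \<theta> \<notin> \<nat> \<longrightarrow> \<bar>\<gamma> \<theta>\<bar> \<le> real Z ^ (r * (B + 1))) \<longrightarrow>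
          real L / real M ^ a \<le> norm (\<Sum>y<L. expi (gen_poly \<Theta> \<gamma> (real (X + y)))) \<longrightarrow>
          (\<exists>q\<ge>1. \<exists>m :: real \<Rightarrow> int. q \<le> M ^ \<sigma> \<and>
             (\<forall>\<theta>\<in>\<Theta>. (\<theta> \<notin> \<nat> \<longrightarrow> m \<theta> = 0) \<and> \<bar>real q * \<gamma> \<theta> - of_int (m \<theta>)\<bar> \<le> 1 / real Z ^ \<kappa>)))"
        unfolding ZM unfolding Z_def by simp
      then obtain X L where X: "X \<ge> 1" and L: "L \<ge> 1" and XL: "X + L \<le> Z ^ r" and
        IL: "\<forall>\<gamma>. (\<forall>\<theta>\<in>\<Theta>. \<theta> \<notin> \<nat> \<longrightarrow> \<bar>\<gamma> \<theta>\<bar> \<le> real Z ^ (r * (B + 1))) \<longrightarrow>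
          real L / real M ^ a \<le> norm (\<Sum>y<L. expi (gen_poly \<Theta> \<gamma> (real (X + y)))) \<longrightarrow>
          (\<exists>q\<ge>1. \<exists>m :: real \<Rightarrow> int. q \<le> M ^ \<sigma> \<and>
             (\<forall>\<theta>\<in>\<Theta>. (\<theta> \<notin> \<nat> \<longrightarrow> m \<theta> = 0) \<and> \<bar>real q * \<gamma> \<theta> - of_int (m \<theta>)\<bar> \<le> 1 / real Z ^ \<kappa>))"
        by (elim exE conjE)
      let ?good = "\<lambda>n. \<forall>i\<in>I. dist_int (gen_poly \<Theta> (\<Gamma> i) (real n) - (\<Sum>\<theta>\<in>\<Theta>. t \<theta> * \<Gamma> i \<theta>)) \<le> 1 / real M"
      show "\<exists>n\<ge>1. n \<le> M ^ g \<and> ?good n"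
      proof (cases "\<exists>y<L. ?good (X + y)")
        case True
        then obtain y where "y < L" "?good (X + y)" by blast
        then show ?thesis using X XL gZ by (intro exI[of _ "X + y"]) auto
      next
        case False
        define F where "F = (\<lambda>i y. gen_poly \<Theta> (\<Gamma> i) (real (X + y)))"
        define v where "v = (\<lambda>i. \<Sum>\<theta>\<in>\<Theta>. t \<theta> * \<Gamma> i \<theta>)"
        from False have bad: "\<forall>y\<in>{..<L}. \<exists>i\<in>I. dist_int (F i y - v i) > 1 / real M"
          unfolding F_def v_def by (metis lessThan_iff not_le)
        have ne: "{..<L} \<noteq> {}" using L by (auto simp: lessThan_empty_iff)
        obtain h :: "nat \<Rightarrow> int" where h: "\<exists>i\<in>I. h i \<noteq> 0" "\<forall>i\<in>I. \<bar>h i\<bar> \<le> int M ^ s" and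
          bias: "real L / real M ^ a \<le> norm (\<Sum>y<L. expi (\<Sum>i\<in>I. of_int (h i) * gen_poly \<Theta> (\<Gamma> i) (real (X + y))))"
          using large[THEN spec, THEN mp, OF M, THEN spec[of _ I], THEN spec[of _ F], THEN spec[of _ v],
              THEN spec[of _ "{..<L}"], THEN mp, OF I(1), THEN mp, OF I(2), THEN mp, OF finite_lessThan,
              THEN mp, OF ne, THEN mp, OF bad]
          unfolding F_def card_lessThan by (elim exE conjE)
        define \<gamma> where "\<gamma> = (\<lambda>\<theta>. \<Sum>i\<in>I. of_int (h i) * \<Gamma> i \<theta>)"
        have comb: "(\<Sum>i\<in>I. of_int (h i) * gen_poly \<Theta> (\<Gamma> i) x) = gen_poly \<Theta> \<gamma> x" for x
          unfolding gen_poly_def \<gamma>_def sum_distrib_left sum_distrib_right mult.assoc by (rule sum.swap)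
        have hM: "\<bar>real_of_int (h i)\<bar> \<le> real M ^ s" if "i \<in> I" for i
        proof -
          have "real_of_int \<bar>h i\<bar> \<le> real_of_int (int M ^ s)" using h(2) that by (simp only: of_int_le_iff)
          then show ?thesis by simp
        qed
        have \<gamma>: "\<forall>\<theta>\<in>\<Theta>. \<theta> \<notin> \<nat> \<longrightarrow> \<bar>\<gamma> \<theta>\<bar> \<le> real Z ^ (r * (B + 1))"
        proof (intro ballI impI)
          fix \<theta> assume \<theta>: "\<theta> \<in> \<Theta>" "\<theta> \<notin> \<nat>"
          have "\<bar>\<gamma> \<theta>\<bar> \<le> (\<Sum>i\<in>I. \<bar>of_int (h i) * \<Gamma> i \<theta>\<bar>)" unfolding \<gamma>_def by (rule sum_abs)
          also have "\<dots> \<le> (\<Sum>i\<in>I. real M ^ s * real Z ^ (r * B))"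
            unfolding abs_mult gZB[symmetric] using hM \<Gamma> \<theta> by (intro sum_mono mult_mono) auto
          also have "\<dots> = real (Suc D * M ^ s) * real Z ^ (r * B)" using I by (simp add: algebra_simps)
          also have "\<dots> \<le> real (Z ^ r) * real Z ^ (r * B)"
          proof (intro mult_right_mono of_nat_mono)
            have "Suc D * M ^ s \<le> M ^ c" using M by (intro mult_power_le_power) (auto simp: c_def)
            also have "\<dots> \<le> Z" by (rule McZ)
            also have "\<dots> \<le> Z ^ r" using r Z by (intro self_le_power) auto
            finally show "Suc D * M ^ s \<le> Z ^ r" .
          qed auto
          also have "\<dots> = real Z ^ (r * (B + 1))" by (simp add: power_add[symmetric])
          finally show "\<bar>\<gamma> \<theta>\<bar> \<le> real Z ^ (r * (B + 1))" .
        qed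
        from IL[THEN spec, THEN mp, OF \<gamma>] bias obtain q m where q: "q \<ge> 1" "q \<le> M ^ \<sigma>"
          and m: "\<forall>\<theta>\<in>\<Theta>. (\<theta> \<notin> \<nat> \<longrightarrow> m \<theta> = 0) \<and> \<bar>real q * \<gamma> \<theta> - of_int (m \<theta>)\<bar> \<le> 1 / real Z ^ \<kappa>"
          unfolding comb by blast
        obtain i\<^sub>0 where i\<^sub>0: "i\<^sub>0 \<in> I" "h i\<^sub>0 \<noteq> 0" using h(1) by blast
        define Q where "Q = q * nat \<bar>h i\<^sub>0\<bar>"
        have Q: "1 \<le> Q" using q i\<^sub>0 by (simp add: Q_def Suc_le_eq)
        have QZ: "Q \<le> Z"
        proof -
          have "nat \<bar>h i\<^sub>0\<bar> \<le> M ^ s" using h(2) i\<^sub>0 by (simp add: nat_le_iff)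
          then have "Q \<le> M ^ \<sigma> * M ^ s" unfolding Q_def using q by (intro mult_mono) auto
          also have "\<dots> \<le> M ^ c" unfolding power_add[symmetric] using M by (intro power_increasing) (auto simp: c_def)
          finally show ?thesis using McZ by simp
        qed
        define \<Gamma>' where "\<Gamma>' = (\<lambda>i \<theta>. \<Gamma> i \<theta> * real Q powr \<theta> / of_int (h i\<^sub>0))"
        define t' where "t' = (\<lambda>\<theta>. t \<theta> * real Q powr (- \<theta>))"
        have "M ^ c \<ge> 2"
        proof -
          have "M ^ 1 \<le> M ^ c" using M by (intro power_increasing) (auto simp: c_def)
          then show ?thesis using M by simp
        qed
        moreover have "finite (I - {i\<^sub>0})" "card (I - {i\<^sub>0}) = D" using I i\<^sub>0 by auto
        moreover have "\<forall>i\<in>I - {i\<^sub>0}. \<forall>\<theta>\<in>\<Theta>. \<theta> \<notin> \<nat> \<longrightarrow> \<bar>\<Gamma>' i \<theta>\<bar> \<le> (real (M ^ c) ^ g') ^ (r * B + Tm)"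
        proof (intro ballI impI)
          fix i \<theta> assume *: "i \<in> I - {i\<^sub>0}" "\<theta> \<in> \<Theta>" "\<theta> \<notin> \<nat>"
          have "real Q powr \<theta> \<le> real Q powr real Tm" using Q Tm[OF *(2)] by (intro powr_mono) auto
          also have "\<dots> = real Q ^ Tm" using Q by (simp add: powr_realpow)
          also have "\<dots> \<le> real Z ^ Tm" using QZ by (intro power_mono) auto
          finally have Q\<theta>: "real Q powr \<theta> \<le> real Z ^ Tm" .
          have "1 \<le> \<bar>real_of_int (h i\<^sub>0)\<bar>" using i\<^sub>0 by linarith
          then have "\<bar>\<Gamma>' i \<theta>\<bar> \<le> \<bar>\<Gamma> i \<theta>\<bar> * real Q powr \<theta> / 1"
            unfolding \<Gamma>'_def abs_divide abs_mult by (intro frac_le) auto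
          also have "\<dots> \<le> real Z ^ (r * B) * real Z ^ Tm"
            using \<Gamma> * Q\<theta> unfolding gZB div_by_1 by (intro mult_mono) auto
          also have "\<dots> = (real (M ^ c) ^ g') ^ (r * B + Tm)"
            by (simp add: ZM w_def power_mult power_add)
          finally show "\<bar>\<Gamma>' i \<theta>\<bar> \<le> (real (M ^ c) ^ g') ^ (r * B + Tm)" .
        qed
        moreover have "\<forall>\<theta>\<in>\<Theta>. \<bar>t' \<theta>\<bar> \<le> 1 \<and> (\<theta> \<in> \<nat> \<longrightarrow> t' \<theta> = 0)"
        proof (intro ballI conjI impI)
          fix \<theta> assume \<theta>: "\<theta> \<in> \<Theta>"
          have "real Q powr (- \<theta>) \<le> real Q powr 0" using Q \<Theta>(2)[OF \<theta>] by (intro powr_mono) auto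
          also have "\<dots> = 1" using Q by simp
          finally have "\<bar>t \<theta>\<bar> * real Q powr (- \<theta>) \<le> 1 * 1" using t \<theta> by (intro mult_mono) auto
          then show "\<bar>t' \<theta>\<bar> \<le> 1" by (simp add: t'_def abs_mult)
          assume "\<theta> \<in> \<nat>" then show "t' \<theta> = 0" using t \<theta> by (simp add: t'_def)
        qed
        ultimately obtain n' where n': "n' \<ge> 1" "n' \<le> (M ^ c) ^ g'" and
          near: "\<forall>i\<in>I - {i\<^sub>0}. dist_int (gen_poly \<Theta> (\<Gamma>' i) (real n') - (\<Sum>\<theta>\<in>\<Theta>. t' \<theta> * \<Gamma>' i \<theta>)) \<le> 1 / real (M ^ c)"
          using IH[rule_format, of "M ^ c" "I - {i\<^sub>0}" \<Gamma>' t'] by blast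
        have n'Z: "n' \<le> Z" using n'(2) by (simp add: Z_def w_def power_mult)
        have QnZ: "Q * n' \<le> Z ^ 2" unfolding power2_eq_square using QZ n'Z by (intro mult_mono) auto
        have elim: "dist_int (gen_poly \<Theta> (\<Gamma> i) (real (Q * n')) - (\<Sum>\<theta>\<in>\<Theta>. t \<theta> * \<Gamma> i \<theta>))
          \<le> real (card I) * real M ^ s * (1 / real (M ^ c)) + 2 * real (card \<Theta>) * (1 / real Z ^ \<kappa>) * real (Q * n') ^ Tm"
          if "i \<in> I" for i
          unfolding Q_def
          by (rule eliminate_coordinate[where m = m])
             (use I i\<^sub>0 hM q n' \<Theta> Tm m t that near in \<open>auto simp: \<gamma>_def \<Gamma>'_def t'_def Q_def\<close>)
        have err1: "real (card I) * real M ^ s * (1 / real (M ^ c)) \<le> 1 / (2 * real M)"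
        proof -
          have "2 * Suc D * M ^ (s + 1) \<le> M ^ c" using M by (intro mult_power_le_power) (auto simp: c_def)
          then have "real (2 * Suc D * M ^ (s + 1)) \<le> real (M ^ c)" by (rule of_nat_mono)
          then have "real (card I) * real M ^ s * (2 * real M) \<le> real (M ^ c)"
            using I by (simp add: algebra_simps)
          then show ?thesis using M by (simp add: field_simps)
        qed
        have err2: "2 * real (card \<Theta>) * (1 / real Z ^ \<kappa>) * real (Q * n') ^ Tm \<le> 1 / (2 * real M)"
        proof -
          have "real (Q * n') ^ Tm \<le> real (Z ^ 2) ^ Tm" using QnZ by (intro power_mono of_nat_mono) auto
          then have "2 * real (card \<Theta>) * (1 / real Z ^ \<kappa>) * real (Q * n') ^ Tm
            \<le> 2 * real (card \<Theta>) * (1 / real Z ^ \<kappa>) * real (Z ^ 2) ^ Tm"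
            by (intro mult_left_mono) auto
          also have "\<dots> = 2 * real (card \<Theta>) / (real Z * real Z)"
            using Z by (simp add: \<kappa>_def power_add power_mult power2_eq_square)
          also have "\<dots> \<le> 1 / (2 * real M)"
          proof -
            have "4 * card \<Theta> * M ^ 1 \<le> M ^ c" using M by (intro mult_power_le_power) (auto simp: c_def)
            then have "4 * card \<Theta> * M \<le> Z" using McZ by simp
            also have "Z \<le> Z * Z" using Z by simp
            finally have "real (4 * card \<Theta> * M) \<le> real (Z * Z)" by (rule of_nat_mono)
            then show ?thesis using M Z by (simp add: field_simps)
          qed
          finally show ?thesis .
        qed
        have "?good (Q * n')"
        proof
          fix i assume "i \<in> I"
          have "1 / (2 * real M) + 1 / (2 * real M) = 1 / real M" by simp
          then show "dist_int (gen_poly \<Theta> (\<Gamma> i) (real (Q * n')) - (\<Sum>\<theta>\<in>\<Theta>. t \<theta> * \<Gamma> i \<theta>)) \<le> 1 / real M"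
            using elim[OF \<open>i \<in> I\<close>] err1 err2 by linarith
        qed
        moreover have "Q * n' \<le> M ^ g"
          unfolding gZ using QnZ power_increasing[OF r, of Z] Z by linarith
        moreover have "1 \<le> Q * n'" using Q n' by (simp add: Suc_le_eq)
        ultimately show ?thesis by blast
      qed
    qed
  qed
qed

section \<open>The inverse theorem for monomials\<close>

text \<open>Weyl's inequality bounds the denominator and the constant in the error by
  \<open>M ^ \<sigma>\<close>, fixed before the scale. One power of \<open>Z\<close> absorbs this
  constant, so a block of length \<open>Z ^ (\<kappa> + 1)\<close> yields accuracy
  \<open>1 / Z ^ \<kappa>\<close>.\<close>

lemma inverse_property_monomial:
  assumes "d \<ge> 1"
  shows "inverse_property {real d}"
  unfolding inverse_property_def
proof (intro allI)
  fix B \<kappa> :: nat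
  obtain C E where C: "C \<ge> 1" and Weyl0: "\<forall>Y\<ge>1. \<forall>L\<le>Y. \<forall>\<epsilon> a \<phi>. 0 < \<epsilon> \<longrightarrow> \<epsilon> \<le> 1 \<longrightarrow> poly_diff d a \<phi> \<longrightarrow>
           \<epsilon> * real Y \<le> norm (\<Sum>y<L. expi (\<phi> y)) \<longrightarrow>
           (\<exists>q\<ge>1. real q \<le> C / \<epsilon> ^ E \<and> dist_int (real q * a) \<le> C / (\<epsilon> ^ E * real Y))"
    using Weyl_leading_coefficient[OF assms] by (elim exE conjE)
  note Weyl = Weyl0[rule_format]
  have main: "\<exists>\<sigma> w\<^sub>0. \<forall>w\<ge>w\<^sub>0. \<forall>M\<ge>2. \<exists>X\<ge>1. \<exists>L\<ge>1.
     X + L \<le> (M ^ w) ^ (\<kappa> + 2) \<and>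
     (\<forall>\<gamma>. (\<forall>\<theta>\<in>{real d}. \<theta> \<notin> \<nat> \<longrightarrow> \<bar>\<gamma> \<theta>\<bar> \<le> (real M ^ w) ^ ((\<kappa> + 2) * B)) \<longrightarrow>
        real L / real M ^ a \<le> norm (\<Sum>y<L. expi (gen_poly {real d} \<gamma> (real (X + y)))) \<longrightarrow>
        (\<exists>q\<ge>1. \<exists>m :: real \<Rightarrow> int. q \<le> M ^ \<sigma> \<and>
           (\<forall>\<theta>\<in>{real d}. (\<theta> \<notin> \<nat> \<longrightarrow> m \<theta> = 0) \<and> \<bar>real q * \<gamma> \<theta> - of_int (m \<theta>)\<bar> \<le> 1 / (real M ^ w) ^ \<kappa>)))" for a
  proof -
    \<comment> \<open>The factor \<open>fact d\<close> comes from the normalisation in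
      \<open>poly_diff\<close> and ends up in the denominator \<open>q * fact d\<close>.\<close>
    define k where "k = nat \<lceil>C\<rceil> * fact d"
    define \<sigma> where "\<sigma> = k + a * E"
    show ?thesis
    proof (rule exI[of _ \<sigma>], rule exI[of _ "\<sigma> + 1"], intro allI impI)
      fix w M :: nat assume w: "\<sigma> + 1 \<le> w" and M: "2 \<le> M"
      define Z where "Z = M ^ w"
      have ZM: "real Z = real M ^ w" by (simp add: Z_def)
      have bound: "C * real M ^ (a * E) * fact d \<le> real (M ^ \<sigma>)"
      proof -
        have "C * real M ^ (a * E) * fact d \<le> real (nat \<lceil>C\<rceil>) * real M ^ (a * E) * fact d"
          by (intro mult_right_mono real_nat_ceiling_ge) auto
        also have "\<dots> = real (k * M ^ (a * E))" by (simp add: k_def)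
        also have "\<dots> \<le> real (M ^ \<sigma>)"
          using M by (intro of_nat_mono mult_power_le_power) (auto simp: \<sigma>_def)
        finally show ?thesis .
      qed
      have "M ^ \<sigma> \<le> Z" "M ^ 1 \<le> Z" unfolding Z_def using M w by (intro power_increasing; simp)+
      then have Z: "M ^ \<sigma> \<le> Z" "2 \<le> Z" using M by auto
      show "\<exists>X\<ge>1. \<exists>L\<ge>1. X + L \<le> (M ^ w) ^ (\<kappa> + 2) \<and>
       (\<forall>\<gamma>. (\<forall>\<theta>\<in>{real d}. \<theta> \<notin> \<nat> \<longrightarrow> \<bar>\<gamma> \<theta>\<bar> \<le> (real M ^ w) ^ ((\<kappa> + 2) * B)) \<longrightarrow>
          real L / real M ^ a \<le> norm (\<Sum>y<L. expi (gen_poly {real d} \<gamma> (real (X + y)))) \<longrightarrow>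
          (\<exists>q\<ge>1. \<exists>m :: real \<Rightarrow> int. q \<le> M ^ \<sigma> \<and>
             (\<forall>\<theta>\<in>{real d}. (\<theta> \<notin> \<nat> \<longrightarrow> m \<theta> = 0) \<and> \<bar>real q * \<gamma> \<theta> - of_int (m \<theta>)\<bar> \<le> 1 / (real M ^ w) ^ \<kappa>)))"
        unfolding ZM[symmetric] Z_def[symmetric]
      proof (rule exI[of _ 1], rule conjI[OF order_refl], rule exI[of _ "Z ^ (\<kappa> + 1)"], intro conjI allI impI)
        define L where "L = Z ^ (\<kappa> + 1)"
        have L: "1 \<le> L" using Z by (simp add: L_def)
        then show "1 \<le> Z ^ (\<kappa> + 1)" by (simp add: L_def)
        have "2 * L \<le> Z * L" using Z by (intro mult_right_mono) auto
        moreover have "Z ^ (\<kappa> + 2) = Z * L" by (simp add: L_def)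
        ultimately show "1 + Z ^ (\<kappa> + 1) \<le> Z ^ (\<kappa> + 2)" using L unfolding L_def[symmetric] by linarith
        fix \<gamma> :: "real \<Rightarrow> real"
        assume bias: "real (Z ^ (\<kappa> + 1)) / real M ^ a \<le> norm (\<Sum>y<Z ^ (\<kappa> + 1). expi (gen_poly {real d} \<gamma> (real (1 + y))))"
        define \<phi> where "\<phi> = (\<lambda>y. \<Sum>i\<le>d. \<gamma> (real d) * real (d choose i) * real y ^ i)"
        have \<phi>: "gen_poly {real d} \<gamma> (real (1 + y)) = \<phi> y" for y
        proof -
          have "real (1 + y) powr real d = (real y + 1) ^ d"
            by (subst powr_realpow) (auto simp: add.commute)
          also have "\<dots> = (\<Sum>i\<le>d. real (d choose i) * real y ^ i)" by (subst binomial_ring) simp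
          finally show ?thesis by (simp add: gen_poly_def \<phi>_def sum_distrib_left mult.assoc)
        qed
        have "poly_diff d (fact d * (\<gamma> (real d) * real (d choose d))) \<phi>"
          unfolding \<phi>_def by (rule poly_diff_power_sum)
        then have "poly_diff d (fact d * \<gamma> (real d)) \<phi>" by simp
        moreover have "0 < 1 / real M ^ a" "1 / real M ^ a \<le> 1" using M by auto
        moreover have "1 / real M ^ a * real L \<le> norm (\<Sum>y<L. expi (\<phi> y))"
          using bias unfolding \<phi> L_def by simp
        ultimately obtain q where q: "q \<ge> 1" "real q \<le> C / (1 / real M ^ a) ^ E"
          "dist_int (real q * (fact d * \<gamma> (real d))) \<le> C / ((1 / real M ^ a) ^ E * real L)"
          using Weyl[OF L order_refl] by blast
        have CE: "C / (1 / real M ^ a) ^ E = C * real M ^ (a * E)" by (simp add: power_divide power_mult)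
        have "real (q * fact d) \<le> C * real M ^ (a * E) * fact d"
          using q(2) unfolding CE by simp
        then have qle: "q * fact d \<le> M ^ \<sigma>" using bound by linarith
        have "dist_int (real (q * fact d) * \<gamma> (real d)) \<le> C / (1 / real M ^ a) ^ E / real L"
          using q(3) by (simp add: mult_ac)
        also have "\<dots> \<le> real Z / real L"
        proof (intro divide_right_mono)
          have "C * real M ^ (a * E) * 1 \<le> C * real M ^ (a * E) * fact d"
            using C by (intro mult_left_mono) auto
          also note bound
          also have "real (M ^ \<sigma>) \<le> real Z" using Z by linarith
          finally show "C / (1 / real M ^ a) ^ E \<le> real Z" by (simp add: CE)
        qed simp
        also have "\<dots> = 1 / real Z ^ \<kappa>" using Z by (simp add: L_def)
        finally have "dist_int (real (q * fact d) * \<gamma> (real d)) \<le> 1 / real Z ^ \<kappa>" .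
        then show "\<exists>q\<ge>1. \<exists>m :: real \<Rightarrow> int. q \<le> M ^ \<sigma> \<and>
             (\<forall>\<theta>\<in>{real d}. (\<theta> \<notin> \<nat> \<longrightarrow> m \<theta> = 0) \<and> \<bar>real q * \<gamma> \<theta> - of_int (m \<theta>)\<bar> \<le> 1 / real Z ^ \<kappa>)"
          using qle q(1) by (intro exI[of _ "q * fact d"] conjI exI[of _ "\<lambda>_. round (real (q * fact d) * \<gamma> (real d))"])
            (auto simp: dist_int_def Suc_le_eq)
      qed
    qed
  qed
  show "\<exists>r\<ge>2. \<forall>a. \<exists>\<sigma> w\<^sub>0. \<forall>w\<ge>w\<^sub>0. \<forall>M\<ge>2. \<exists>X\<ge>1. \<exists>L\<ge>1.
     X + L \<le> (M ^ w) ^ r \<and>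
     (\<forall>\<gamma>. (\<forall>\<theta>\<in>{real d}. \<theta> \<notin> \<nat> \<longrightarrow> \<bar>\<gamma> \<theta>\<bar> \<le> (real M ^ w) ^ (r * B)) \<longrightarrow>
        real L / real M ^ a \<le> norm (\<Sum>y<L. expi (gen_poly {real d} \<gamma> (real (X + y)))) \<longrightarrow>
        (\<exists>q\<ge>1. \<exists>m :: real \<Rightarrow> int. q \<le> M ^ \<sigma> \<and>
           (\<forall>\<theta>\<in>{real d}. (\<theta> \<notin> \<nat> \<longrightarrow> m \<theta> = 0) \<and> \<bar>real q * \<gamma> \<theta> - of_int (m \<theta>)\<bar> \<le> 1 / (real M ^ w) ^ \<kappa>)))"
    by (rule exI[of _ "\<kappa> + 2"], rule conjI[OF le_add2 allI[OF main]])
qed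

section \<open>The inverse theorem for non-integral exponents\<close>

text \<open>No factor \<open>a - i\<close> vanishes. This is how non-integrality enters: Taylor
  coefficients of every order survive, whereas those of an integral power stop at its
  degree.\<close>

lemma gbinomial_neq_0: "(a gchoose k) \<noteq> 0" if "a \<notin> \<nat>" for a :: real
  using that by (auto simp: gbinomial_prod_rev prod_zero_iff)

text \<open>The combination \<open>(i + 1) * D (i + 1) - (\<xi> - i) * D i\<close> of two consecutive moments kills the
  contribution of the exponent \<open>\<xi>\<close>, which is a Vandermonde elimination step.\<close>

lemma gbinomial_moments:
  fixes \<Theta> :: "real set"
  assumes "finite \<Theta>" "\<Theta> \<inter> \<nat> = {}"
  shows "\<exists>C\<ge>0. \<forall>v. (\<Sum>\<theta>\<in>\<Theta>. \<bar>v \<theta>\<bar>)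
           \<le> C * (\<Sum>i\<in>{K..<K + card \<Theta>}. \<bar>\<Sum>\<theta>\<in>\<Theta>. v \<theta> * (\<theta> gchoose i)\<bar>)"
  using assms
proof (induction \<Theta> rule: finite_induct)
  case empty
  show ?case by (intro exI[of _ 0]) simp
next
  case (insert \<xi> \<Theta>)
  then obtain C where C: "C \<ge> 0" and IH: "\<And>v. (\<Sum>\<theta>\<in>\<Theta>. \<bar>v \<theta>\<bar>)
           \<le> C * (\<Sum>i\<in>{K..<K + card \<Theta>}. \<bar>\<Sum>\<theta>\<in>\<Theta>. v \<theta> * (\<theta> gchoose i)\<bar>)"
    by auto
  have \<xi>: "(\<xi> gchoose K) \<noteq> 0" using insert.prems by (intro gbinomial_neq_0) auto
  define W where "W = real (K + card \<Theta> + 1) + \<bar>\<xi>\<bar>"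
  \<comment> \<open>Capping the factors at 1 makes the whole product a lower bound for each single
    distance \<open>\<bar>\<theta> - \<xi>\<bar>\<close>.\<close>
  define \<delta> where "\<delta> = (\<Prod>\<theta>\<in>\<Theta>. min 1 \<bar>\<theta> - \<xi>\<bar>)"
  define G where "G = (\<Sum>\<theta>\<in>\<Theta>. \<bar>\<theta> gchoose K\<bar>)"
  have \<delta>: "\<delta> > 0" using insert.hyps by (auto simp: \<delta>_def intro!: prod_pos)
  have \<delta>_le: "\<delta> \<le> \<bar>\<theta> - \<xi>\<bar>" if "\<theta> \<in> \<Theta>" for \<theta>
  proof -
    have "\<delta> = min 1 \<bar>\<theta> - \<xi>\<bar> * (\<Prod>\<theta>\<in>\<Theta> - {\<theta>}. min 1 \<bar>\<theta> - \<xi>\<bar>)"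
      using insert.hyps that by (simp add: \<delta>_def prod.remove)
    also have "\<dots> \<le> min 1 \<bar>\<theta> - \<xi>\<bar> * 1" by (intro mult_left_mono prod_le_1) auto
    finally show ?thesis by simp
  qed
  define C\<^sub>1 where "C\<^sub>1 = C * (2 * W) / \<delta>"
  define C' where "C' = C\<^sub>1 + (1 + G * C\<^sub>1) / \<bar>\<xi> gchoose K\<bar>"
  have nn: "0 \<le> W" "0 \<le> G" "0 \<le> C\<^sub>1" using C \<delta> by (auto simp: W_def G_def C\<^sub>1_def intro!: sum_nonneg)
  have "C' \<ge> 0" using nn by (simp add: C'_def)
  moreover have "(\<Sum>\<theta>\<in>insert \<xi> \<Theta>. \<bar>v \<theta>\<bar>)
      \<le> C' * (\<Sum>i\<in>{K..<K + card (insert \<xi> \<Theta>)}. \<bar>\<Sum>\<theta>\<in>insert \<xi> \<Theta>. v \<theta> * (\<theta> gchoose i)\<bar>)" for v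
  proof -
    define D where "D = (\<lambda>i. \<Sum>\<theta>\<in>insert \<xi> \<Theta>. v \<theta> * (\<theta> gchoose i))"
    define A where "A = (\<Sum>i\<in>{K..<K + card (insert \<xi> \<Theta>)}. \<bar>D i\<bar>)"
    have card: "card (insert \<xi> \<Theta>) = Suc (card \<Theta>)" using insert.hyps by simp
    have A0: "0 \<le> A" by (auto simp: A_def intro!: sum_nonneg)
    have reduce: "(\<Sum>\<theta>\<in>\<Theta>. v \<theta> * (\<theta> - \<xi>) * (\<theta> gchoose i)) = real (Suc i) * D (Suc i) - (\<xi> - real i) * D i" for i
    proof -
      have "real (Suc i) * D (Suc i) - (\<xi> - real i) * D i
        = (\<Sum>\<theta>\<in>insert \<xi> \<Theta>. v \<theta> * (real (Suc i) * (\<theta> gchoose Suc i) - (\<xi> - real i) * (\<theta> gchoose i)))"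
        unfolding D_def sum_distrib_left sum_subtractf[symmetric]
        by (intro sum.cong) (auto simp: algebra_simps)
      also have "\<dots> = (\<Sum>\<theta>\<in>insert \<xi> \<Theta>. v \<theta> * (\<theta> - \<xi>) * (\<theta> gchoose i))"
      proof (intro sum.cong refl)
        fix \<theta>
        have "real (Suc i) * (\<theta> gchoose Suc i) = \<theta> * (\<theta> gchoose i) - real i * (\<theta> gchoose i)"
          using gbinomial_mult_1[of \<theta> i] by linarith
        then show "v \<theta> * (real (Suc i) * (\<theta> gchoose Suc i) - (\<xi> - real i) * (\<theta> gchoose i)) = v \<theta> * (\<theta> - \<xi>) * (\<theta> gchoose i)"
          by (simp only:) (simp add: algebra_simps)
      qed
      also have "\<dots> = (\<Sum>\<theta>\<in>\<Theta>. v \<theta> * (\<theta> - \<xi>) * (\<theta> gchoose i))" using insert.hyps by simp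
      finally show ?thesis by simp
    qed
    have "(\<Sum>i\<in>{K..<K + card \<Theta>}. \<bar>real (Suc i) * D (Suc i) - (\<xi> - real i) * D i\<bar>)
        \<le> (\<Sum>i\<in>{K..<K + card \<Theta>}. W * \<bar>D (Suc i)\<bar> + W * \<bar>D i\<bar>)"
    proof (rule sum_mono)
      fix i assume "i \<in> {K..<K + card \<Theta>}"
      then have "\<bar>real (Suc i)\<bar> \<le> W" "\<bar>\<xi> - real i\<bar> \<le> W" by (auto simp: W_def)
      then have "\<bar>real (Suc i)\<bar> * \<bar>D (Suc i)\<bar> + \<bar>\<xi> - real i\<bar> * \<bar>D i\<bar> \<le> W * \<bar>D (Suc i)\<bar> + W * \<bar>D i\<bar>"
        by (intro add_mono mult_right_mono) auto
      then show "\<bar>real (Suc i) * D (Suc i) - (\<xi> - real i) * D i\<bar> \<le> W * \<bar>D (Suc i)\<bar> + W * \<bar>D i\<bar>"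
        using abs_triangle_ineq4[of "real (Suc i) * D (Suc i)" "(\<xi> - real i) * D i"]
        unfolding abs_mult by linarith
    qed
    also have "\<dots> = W * (\<Sum>i\<in>{K..<K + card \<Theta>}. \<bar>D (Suc i)\<bar>) + W * (\<Sum>i\<in>{K..<K + card \<Theta>}. \<bar>D i\<bar>)"
      by (simp add: sum.distrib sum_distrib_left)
    also have "\<dots> \<le> W * A + W * A"
    proof (intro add_mono mult_left_mono nn)
      show "(\<Sum>i\<in>{K..<K + card \<Theta>}. \<bar>D i\<bar>) \<le> A" unfolding A_def card by (intro sum_mono2) auto
      have "(\<Sum>i\<in>{K..<K + card \<Theta>}. \<bar>D (Suc i)\<bar>) = (\<Sum>i\<in>{Suc K..<Suc (K + card \<Theta>)}. \<bar>D i\<bar>)"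
        by (rule sum.shift_bounds_Suc_ivl[symmetric])
      also have "\<dots> \<le> A" unfolding A_def card by (intro sum_mono2) auto
      finally show "(\<Sum>i\<in>{K..<K + card \<Theta>}. \<bar>D (Suc i)\<bar>) \<le> A" .
    qed
    finally have *: "(\<Sum>i\<in>{K..<K + card \<Theta>}. \<bar>real (Suc i) * D (Suc i) - (\<xi> - real i) * D i\<bar>) \<le> 2 * (W * A)"
      by linarith
    have "\<delta> * (\<Sum>\<theta>\<in>\<Theta>. \<bar>v \<theta>\<bar>) \<le> (\<Sum>\<theta>\<in>\<Theta>. \<bar>v \<theta> * (\<theta> - \<xi>)\<bar>)"
      unfolding sum_distrib_left abs_mult using \<delta>_le
      by (intro sum_mono) (metis abs_ge_zero mult.commute mult_left_mono)
    also have "\<dots> \<le> C * (\<Sum>i\<in>{K..<K + card \<Theta>}. \<bar>real (Suc i) * D (Suc i) - (\<xi> - real i) * D i\<bar>)"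
      using IH[of "\<lambda>\<theta>. v \<theta> * (\<theta> - \<xi>)"] unfolding reduce .
    also have "\<dots> \<le> C * (2 * (W * A))" using * C by (intro mult_left_mono)
    finally have small: "(\<Sum>\<theta>\<in>\<Theta>. \<bar>v \<theta>\<bar>) \<le> C\<^sub>1 * A"
      using \<delta> by (simp add: C\<^sub>1_def field_simps)
    \<comment> \<open>Once the entries over \<open>\<Theta>\<close> are controlled, the moment of
      order \<open>K\<close> gives back \<open>v \<xi>\<close>, because
      \<open>\<xi> gchoose K\<close> is nonzero.\<close>
    have "D K = v \<xi> * (\<xi> gchoose K) + (\<Sum>\<theta>\<in>\<Theta>. v \<theta> * (\<theta> gchoose K))"
      unfolding D_def using insert.hyps by simp
    then have "\<bar>v \<xi>\<bar> * \<bar>\<xi> gchoose K\<bar> \<le> \<bar>D K\<bar> + \<bar>\<Sum>\<theta>\<in>\<Theta>. v \<theta> * (\<theta> gchoose K)\<bar>"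
      unfolding abs_mult[symmetric] by linarith
    also have "\<bar>D K\<bar> \<le> A" unfolding A_def card by (rule member_le_sum) auto
    also have "\<bar>\<Sum>\<theta>\<in>\<Theta>. v \<theta> * (\<theta> gchoose K)\<bar> \<le> G * (C\<^sub>1 * A)"
    proof -
      have "\<bar>\<Sum>\<theta>\<in>\<Theta>. v \<theta> * (\<theta> gchoose K)\<bar> \<le> (\<Sum>\<theta>\<in>\<Theta>. \<bar>v \<theta>\<bar> * \<bar>\<theta> gchoose K\<bar>)"
        unfolding abs_mult[symmetric] by (rule sum_abs)
      also have "\<dots> \<le> (\<Sum>\<theta>\<in>\<Theta>. \<bar>v \<theta>\<bar> * G)"
        unfolding G_def using insert.hyps
        by (intro sum_mono mult_left_mono member_le_sum[where f = "\<lambda>\<theta>. \<bar>\<theta> gchoose K\<bar>"]) auto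
      also have "\<dots> = G * (\<Sum>\<theta>\<in>\<Theta>. \<bar>v \<theta>\<bar>)" by (simp add: sum_distrib_left mult.commute)
      also have "\<dots> \<le> G * (C\<^sub>1 * A)" using small nn by (intro mult_left_mono)
      finally show ?thesis .
    qed
    finally have "\<bar>v \<xi>\<bar> * \<bar>\<xi> gchoose K\<bar> \<le> (1 + G * C\<^sub>1) * A" by (simp add: algebra_simps)
    then have "\<bar>v \<xi>\<bar> \<le> (1 + G * C\<^sub>1) / \<bar>\<xi> gchoose K\<bar> * A"
      using \<xi> by (simp add: field_simps)
    then have "(\<Sum>\<theta>\<in>insert \<xi> \<Theta>. \<bar>v \<theta>\<bar>) \<le> C' * A"
      using small insert.hyps by (simp add: C'_def algebra_simps)
    then show ?thesis unfolding A_def D_def .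
  qed
  ultimately show ?case by blast
qed

text \<open>The binomial series in \<open>z = y / X\<close>. For \<open>z <= 1 / 2\<close> its tail
  divided by \<open>z ^ Suc K\<close> is dominated termwise by the value at 1/2, which converges
  absolutely and gives a constant independent of \<open>X\<close> and \<open>y\<close>.\<close>

lemma powr_Taylor:
  fixes \<theta> :: real
  shows "\<exists>C\<ge>0. \<forall>X y. 0 < X \<longrightarrow> 0 \<le> y \<longrightarrow> y \<le> X / 2 \<longrightarrow>
    \<bar>(X + y) powr \<theta> - (\<Sum>i\<le>K. (\<theta> gchoose i) * X powr \<theta> * (y / X) ^ i)\<bar> \<le> C * X powr \<theta> * (y / X) ^ Suc K"
proof -
  define b where "b = (\<lambda>i. \<bar>\<theta> gchoose (i + Suc K)\<bar> * (1 / 2) ^ i)"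
  have "summable (\<lambda>i. norm ((\<theta> gchoose i) * (1 / 2) ^ i))"
    by (rule abs_summable_in_conv_radius) (auto simp: conv_radius_gchoose one_ereal_def)
  then have "summable (\<lambda>i. \<bar>\<theta> gchoose i\<bar> * (1 / 2) ^ i)" by (simp add: abs_mult)
  then have "summable (\<lambda>i. \<bar>\<theta> gchoose (i + Suc K)\<bar> * (1 / 2) ^ (i + Suc K))"
    by (rule summable_ignore_initial_segment)
  then have "summable (\<lambda>i. 2 ^ Suc K * (\<bar>\<theta> gchoose (i + Suc K)\<bar> * (1 / 2) ^ (i + Suc K)))"
    by (rule summable_mult)
  moreover have "2 ^ Suc K * (\<bar>\<theta> gchoose (i + Suc K)\<bar> * (1 / 2) ^ (i + Suc K)) = b i" for i
    by (simp add: b_def power_add power_divide)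
  ultimately have b: "summable b" by (simp only:)
  have b0: "0 \<le> b i" for i by (simp add: b_def)
  show ?thesis
  proof (intro exI[of _ "suminf b"] conjI allI impI)
    show "0 \<le> suminf b" using b b0 by (rule suminf_nonneg)
    fix X y :: real assume X: "0 < X" and y: "0 \<le> y" "y \<le> X / 2"
    define z where "z = y / X"
    have z: "0 \<le> z" "z \<le> 1 / 2" using X y by (auto simp: z_def field_simps)
    define a where "a = (\<lambda>i. (\<theta> gchoose i) * z ^ i)"
    have sums: "a sums (1 + z) powr \<theta>"
      unfolding a_def using z by (intro gen_binomial_real) auto
    have "(\<lambda>i. a (i + Suc K)) sums ((1 + z) powr \<theta> - (\<Sum>i<Suc K. a i))"
      using sums by (simp only: sums_iff_shift')
    then have tail: "(1 + z) powr \<theta> - (\<Sum>i\<le>K. a i) = (\<Sum>i. a (i + Suc K))"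
      by (simp add: sums_iff lessThan_Suc_atMost)
    have "norm (\<Sum>i. a (i + Suc K)) \<le> (\<Sum>i. z ^ Suc K * b i)"
    proof (rule norm_suminf_le)
      fix i
      have "norm (a (i + Suc K)) = z ^ Suc K * (\<bar>\<theta> gchoose (i + Suc K)\<bar> * z ^ i)"
        using z by (simp add: a_def abs_mult power_add)
      also have "\<dots> \<le> z ^ Suc K * b i"
        unfolding b_def using z by (intro mult_left_mono power_mono) auto
      finally show "norm (a (i + Suc K)) \<le> z ^ Suc K * b i" .
    qed (rule summable_mult[OF b])
    also have "\<dots> = z ^ Suc K * suminf b" using b by (rule suminf_mult)
    finally have main: "\<bar>(1 + z) powr \<theta> - (\<Sum>i\<le>K. a i)\<bar> \<le> z ^ Suc K * suminf b"
      unfolding tail by simp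
    have "X + y = X * (1 + z)" using X by (simp add: z_def field_simps)
    then have "(X + y) powr \<theta> = X powr \<theta> * (1 + z) powr \<theta>" using X z by (simp add: powr_mult)
    then have "(X + y) powr \<theta> - (\<Sum>i\<le>K. (\<theta> gchoose i) * X powr \<theta> * (y / X) ^ i)
        = X powr \<theta> * ((1 + z) powr \<theta> - (\<Sum>i\<le>K. a i))"
      by (simp add: a_def z_def[symmetric] right_diff_distrib sum_distrib_left mult_ac)
    then have "\<bar>(X + y) powr \<theta> - (\<Sum>i\<le>K. (\<theta> gchoose i) * X powr \<theta> * (y / X) ^ i)\<bar>
        = X powr \<theta> * \<bar>(1 + z) powr \<theta> - (\<Sum>i\<le>K. a i)\<bar>"
      by (simp add: abs_mult)
    also have "\<dots> \<le> X powr \<theta> * (z ^ Suc K * suminf b)" using main by (intro mult_left_mono) auto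
    finally show "\<bar>(X + y) powr \<theta> - (\<Sum>i\<le>K. (\<theta> gchoose i) * X powr \<theta> * (y / X) ^ i)\<bar>
        \<le> suminf b * X powr \<theta> * (y / X) ^ Suc K"
      by (simp add: z_def mult_ac)
  qed
qed

text \<open>Used contrapositively: a biased sum over a long interval is biased on some subinterval
  of length \<open>Y\<close>. Blocks are cut off at the right end and the incomplete rest is bounded
  trivially.\<close>

lemma norm_sum_le_subintervals:
  fixes u :: "nat \<Rightarrow> complex"
  assumes "\<And>y. norm (u y) \<le> 1" "0 \<le> \<delta>" "Y \<ge> 1"
    and "\<And>p. p + Y \<le> L \<Longrightarrow> norm (\<Sum>y<Y. u (p + y)) \<le> \<delta> * real Y"
  shows "norm (\<Sum>y<L. u y) \<le> \<delta> * real L + real Y"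
  using assms(4)
proof (induction L rule: less_induct)
  case (less L)
  show ?case
  proof (cases "L < Y")
    case True
    have "norm (\<Sum>y<L. u y) \<le> (\<Sum>y<L. 1)" by (intro sum_norm_le assms)
    also have "\<dots> \<le> real Y" using True by simp
    finally show ?thesis using assms(2) by (simp add: add_increasing)
  next
    case False
    have split: "(\<Sum>y<L. u y) = (\<Sum>y<L - Y. u y) + (\<Sum>y<Y. u (L - Y + y))"
    proof -
      have "(\<Sum>y<L. u y) = sum u {0..<L - Y} + sum u {L - Y..<L}"
        by (simp add: lessThan_atLeast0 sum.atLeastLessThan_concat)
      moreover have "sum u {L - Y..<L} = (\<Sum>y<Y. u (L - Y + y))"
        using sum.shift_bounds_nat_ivl[of u 0 "L - Y" Y] False by (simp add: lessThan_atLeast0 add.commute)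
      ultimately show ?thesis by (simp add: lessThan_atLeast0)
    qed
    have "norm (\<Sum>y<L - Y. u y) \<le> \<delta> * real (L - Y) + real Y"
      using less.IH[of "L - Y"] less.prems assms(3) False by simp
    moreover have "norm (\<Sum>y<Y. u (L - Y + y)) \<le> \<delta> * real Y"
      using less.prems[of "L - Y"] False by simp
    moreover have "\<delta> * real L = \<delta> * real (L - Y) + \<delta> * real Y"
      using False by (simp add: of_nat_diff algebra_simps)
    ultimately show ?thesis unfolding split
      using norm_triangle_ineq[of "\<Sum>y<L - Y. u y" "\<Sum>y<Y. u (L - Y + y)"] by linarith
  qed
qed

text \<open>Write \<open>T\<close> for the size of the phase at \<open>X = Z ^ r\<close>. On a block of length \<open>Y = Z ^ (r - j)\<close> the
  degree \<open>i\<close> Taylor term has size about \<open>T / Z ^ (j * i)\<close>; the choice of \<open>j\<close> makes it large for \<open>i = K\<close>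
  and negligible for \<open>i > K\<close>, so only the leading coefficient of a polynomial phase matters.\<close>

lemma inverse_nonint_fixed_degree:
  fixes K B Tm r :: nat and C\<^sub>4 :: real
  assumes \<Theta>: "finite \<Theta>" "\<And>\<theta>. \<theta> \<in> \<Theta> \<Longrightarrow> 1 \<le> \<theta>" "\<And>\<theta>. \<theta> \<in> \<Theta> \<Longrightarrow> \<theta> \<le> real Tm"
    and K: "4 * (B + Tm + 1) \<le> K + 1" and r: "4 \<le> r" and C\<^sub>4: "0 < C\<^sub>4"
  shows "\<exists>C\<ge>1. \<exists>E. \<forall>Z\<ge>2. \<forall>\<gamma> \<epsilon>. 0 < \<epsilon> \<longrightarrow> \<epsilon> \<le> 1 \<longrightarrow>
     (\<forall>\<theta>\<in>\<Theta>. \<bar>\<gamma> \<theta>\<bar> \<le> real (Z ^ r) ^ B) \<longrightarrow>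
     real Z ^ ((K + 1) * (K + 2)) \<le> (\<Sum>\<theta>\<in>\<Theta>. \<bar>\<gamma> \<theta>\<bar> * real (Z ^ r) powr \<theta>) \<longrightarrow>
     (\<Sum>\<theta>\<in>\<Theta>. \<bar>\<gamma> \<theta>\<bar> * real (Z ^ r) powr \<theta>) \<le> C\<^sub>4 * \<bar>\<Sum>\<theta>\<in>\<Theta>. \<gamma> \<theta> * real (Z ^ r) powr \<theta> * (\<theta> gchoose K)\<bar> \<longrightarrow>
     \<epsilon> * real (Z ^ (r - 1)) \<le> norm (\<Sum>y<Z ^ (r - 1). expi (gen_poly \<Theta> \<gamma> (real (Z ^ r + y)))) \<longrightarrow>
     real Z \<le> C / \<epsilon> ^ E"
proof -
  have K1: "K \<ge> 1" using K by simp
  obtain CW EW where CW: "CW \<ge> 1" and Weyl0: "\<forall>Y\<ge>1. \<forall>L\<le>Y. \<forall>\<epsilon> a \<phi>. 0 < \<epsilon> \<longrightarrow> \<epsilon> \<le> 1 \<longrightarrow> poly_diff K a \<phi> \<longrightarrow>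
           \<bar>a\<bar> * real Y ^ (K - 1) \<le> 1 / 2 \<longrightarrow>
           \<epsilon> * real Y \<le> norm (\<Sum>y<L. expi (\<phi> y)) \<longrightarrow> \<bar>a\<bar> * real Y ^ K \<le> CW / \<epsilon> ^ EW"
    using Weyl_small_leading_coefficient[OF K1] by (elim exE conjE)
  note Weyl = Weyl0[rule_format]
  \<comment> \<open>Taylor constants are chosen as functions of the exponent: order \<open>K\<close>
    replaces the phase by a polynomial, order 0 controls a change of base point.\<close>
  define tay where "tay = (\<lambda>(K::nat) (\<theta>::real) (C::real). 0 \<le> C \<and> (\<forall>X y. 0 < X \<longrightarrow> 0 \<le> y \<longrightarrow> y \<le> X / 2 \<longrightarrow>
    \<bar>(X + y) powr \<theta> - (\<Sum>i\<le>K. (\<theta> gchoose i) * X powr \<theta> * (y / X) ^ i)\<bar> \<le> C * X powr \<theta> * (y / X) ^ Suc K))"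
  define CT where "CT = (\<lambda>\<theta>. SOME C. tay K \<theta> C)"
  define C0 where "C0 = (\<lambda>\<theta>. SOME C. tay 0 \<theta> C)"
  have CT: "tay K \<theta> (CT \<theta>)" for \<theta>
    unfolding CT_def by (rule someI_ex, unfold tay_def, rule powr_Taylor)
  have C0: "tay 0 \<theta> (C0 \<theta>)" for \<theta>
    unfolding C0_def by (rule someI_ex, unfold tay_def, rule powr_Taylor)
  have CT': "\<bar>(X + y) powr \<theta> - (\<Sum>i\<le>K. (\<theta> gchoose i) * X powr \<theta> * (y / X) ^ i)\<bar> \<le> CT \<theta> * X powr \<theta> * (y / X) ^ Suc K"
    if "0 < X" "0 \<le> y" "y \<le> X / 2" for X y \<theta>
    using CT[of \<theta>] that unfolding tay_def by blast
  have C0': "\<bar>(X + y) powr \<theta> - X powr \<theta>\<bar> \<le> C0 \<theta> * X powr \<theta> * (y / X)"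
    if "0 < X" "0 \<le> y" "y \<le> X / 2" for X y \<theta>
    using C0[of \<theta>] that unfolding tay_def by fastforce
  define ST S0 G where "ST = (\<Sum>\<theta>\<in>\<Theta>. CT \<theta>)" and "S0 = (\<Sum>\<theta>\<in>\<Theta>. C0 \<theta>)" and "G = (\<Sum>\<theta>\<in>\<Theta>. \<bar>\<theta> gchoose K\<bar>)"
  have CTnn: "0 \<le> CT \<theta>" and C0nn: "0 \<le> C0 \<theta>" for \<theta> using CT C0 by (auto simp: tay_def)
  have CT_le: "CT \<theta> \<le> ST" and C0_le: "C0 \<theta> \<le> S0" and G_le: "\<bar>\<theta> gchoose K\<bar> \<le> G" if "\<theta> \<in> \<Theta>" for \<theta>
    unfolding ST_def S0_def G_def using that \<Theta>(1) CTnn C0nn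
    by (auto intro!: member_le_sum[where f = CT] member_le_sum[where f = C0] member_le_sum[where f = "\<lambda>\<theta>. \<bar>\<theta> gchoose K\<bar>"])
  have nn: "0 \<le> ST" "0 \<le> S0" "0 \<le> G" using CTnn C0nn by (auto simp: ST_def S0_def G_def intro!: sum_nonneg)
  define c2 c3 c5 where "c2 = 2 ^ Tm * ST" and "c3 = S0 * G" and "c5 = 2 ^ Tm * G"
  have cnn: "0 \<le> c2" "0 \<le> c3" "0 \<le> c5" using nn by (auto simp: c2_def c3_def c5_def)
  \<comment> \<open>One summand for each estimate in which \<open>Z\<close> or
    \<open>\<epsilon> * Z\<close> must beat a constant: the upper bound for \<open>T\<close>, the
    length of the sub-block, the Taylor error, the change of base point, and the hypothesis
    \<open>up\<close>. If \<open>Z <= Z\<^sub>0 / \<epsilon>\<close>, nothing is left to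
    prove.\<close>
  define Z\<^sub>0 where "Z\<^sub>0 = real (card \<Theta>) + 4 + 8 * pi * c2 + 2 * c3 * C\<^sub>4 + 2 * fact K * c5"
  have pnn: "0 \<le> 8 * pi * c2" "0 \<le> 2 * c3 * C\<^sub>4" "0 \<le> 2 * fact K * c5" using cnn C\<^sub>4 by auto
  have Z\<^sub>0: "4 \<le> Z\<^sub>0" "real (card \<Theta>) \<le> Z\<^sub>0" "8 * pi * c2 \<le> Z\<^sub>0" "2 * c3 * C\<^sub>4 \<le> Z\<^sub>0" "2 * fact K * c5 \<le> Z\<^sub>0"
    unfolding Z\<^sub>0_def using pnn by linarith+
  define CF where "CF = 2 * C\<^sub>4 * 2 ^ K * CW * 4 ^ EW"
  have CF: "0 \<le> CF" using C\<^sub>4 CW by (simp add: CF_def)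
  define C where "C = Z\<^sub>0 + CF"
  define E where "E = EW + 1"
  have C1: "1 \<le> C" using Z\<^sub>0 CF by (simp add: C_def)
  show ?thesis
  proof (rule exI[of _ C], rule conjI[OF C1], rule exI[of _ E], intro allI impI)
    fix Z :: nat and \<gamma> :: "real \<Rightarrow> real" and \<epsilon> :: real
    assume Z: "2 \<le> Z" and \<epsilon>: "0 < \<epsilon>" "\<epsilon> \<le> 1" and \<gamma>: "\<forall>\<theta>\<in>\<Theta>. \<bar>\<gamma> \<theta>\<bar> \<le> real (Z ^ r) ^ B"
      and TZ: "real Z ^ ((K + 1) * (K + 2)) \<le> (\<Sum>\<theta>\<in>\<Theta>. \<bar>\<gamma> \<theta>\<bar> * real (Z ^ r) powr \<theta>)"
      and TD: "(\<Sum>\<theta>\<in>\<Theta>. \<bar>\<gamma> \<theta>\<bar> * real (Z ^ r) powr \<theta>) \<le> C\<^sub>4 * \<bar>\<Sum>\<theta>\<in>\<Theta>. \<gamma> \<theta> * real (Z ^ r) powr \<theta> * (\<theta> gchoose K)\<bar>"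
      and bias: "\<epsilon> * real (Z ^ (r - 1)) \<le> norm (\<Sum>y<Z ^ (r - 1). expi (gen_poly \<Theta> \<gamma> (real (Z ^ r + y))))"
    have \<epsilon>E: "\<epsilon> ^ E \<le> \<epsilon>" "\<epsilon> ^ E \<le> \<epsilon> ^ EW" "0 < \<epsilon> ^ E"
      using power_decreasing[of 1 E \<epsilon>] power_decreasing[of EW E \<epsilon>] \<epsilon> by (auto simp: E_def)
    show "real Z \<le> C / \<epsilon> ^ E"
    proof (cases "real Z \<le> Z\<^sub>0 / \<epsilon>")
      case True
      also have "Z\<^sub>0 / \<epsilon> \<le> C / \<epsilon> ^ E" using \<epsilon>E Z\<^sub>0 CF C1 by (intro frac_le) (auto simp: C_def)
      finally show ?thesis .
    next
      case False
      then have \<epsilon>Z: "Z\<^sub>0 < \<epsilon> * real Z" using \<epsilon> by (simp add: field_simps)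
      also have "\<epsilon> * real Z \<le> real Z" using \<epsilon> by (simp add: mult_left_le_one_le)
      finally have ZZ: "Z\<^sub>0 < real Z" .
      define X where "X = real (Z ^ r)"
      define L where "L = Z ^ (r - 1)"
      define T where "T = (\<Sum>\<theta>\<in>\<Theta>. \<bar>\<gamma> \<theta>\<bar> * X powr \<theta>)"
      define D where "D = (\<Sum>\<theta>\<in>\<Theta>. \<gamma> \<theta> * X powr \<theta> * (\<theta> gchoose K))"
      have Z1: "1 < real Z" using Z by simp
      have X1: "1 \<le> X" using Z by (simp add: X_def)
      have XZ: "X = real Z ^ r" by (simp add: X_def)
      have Tlow0: "real Z ^ ((K + 1) * (K + 2)) \<le> T" using TZ by (simp add: T_def X_def)
      have T0: "0 < T" using Tlow0 Z1 by (smt (verit) zero_less_power)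
      have TD': "T / C\<^sub>4 \<le> \<bar>D\<bar>" using TD C\<^sub>4 by (simp add: T_def D_def X_def field_simps)
      have Tup0: "T * real Z \<le> real Z ^ (r * (B + Tm) + 2)"
      proof -
        have "T \<le> (\<Sum>\<theta>\<in>\<Theta>. X ^ B * X ^ Tm)"
          unfolding T_def
        proof (intro sum_mono mult_mono)
          fix \<theta> assume \<theta>: "\<theta> \<in> \<Theta>"
          show "\<bar>\<gamma> \<theta>\<bar> \<le> X ^ B" using \<gamma> \<theta> by (simp add: X_def)
          have "X powr \<theta> \<le> X powr real Tm" using X1 \<Theta>(3)[OF \<theta>] by (intro powr_mono)
          then show "X powr \<theta> \<le> X ^ Tm" using X1 by (simp add: powr_realpow)
        qed (use X1 in auto)
        also have "\<dots> = real (card \<Theta>) * real Z ^ (r * (B + Tm))"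
          by (simp add: XZ power_mult power_add)
        also have "\<dots> \<le> real Z * real Z ^ (r * (B + Tm))" using Z\<^sub>0 ZZ by (intro mult_right_mono) auto
        finally have "T * real Z \<le> real Z * real Z ^ (r * (B + Tm)) * real Z" by (intro mult_right_mono) auto
        then show ?thesis by (simp add: mult_ac)
      qed
      \<comment> \<open>The least \<open>j\<close> for which the Taylor remainder on a block of
        length \<open>X / Z ^ j\<close> is of order \<open>1 / Z\<close>. Its minimality will bound
        the term of degree \<open>K\<close> from below.\<close>
      define j where "j = (LEAST j. T * real Z \<le> real Z ^ (j * (K + 1)))"
      have ex: "T * real Z \<le> real Z ^ ((r * (B + Tm) + 2) * (K + 1))"
        using Z1 by (intro order_trans[OF Tup0] power_increasing) auto
      have j1: "T * real Z \<le> real Z ^ (j * (K + 1))" unfolding j_def by (rule LeastI, rule ex)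
      have j2: "real Z ^ (i * (K + 1)) < T * real Z" if "i < j" for i
        using not_less_Least[OF that[unfolded j_def]] by simp
      \<comment> \<open>This is exactly what the inequality
        \<open>j * K + 2 <= (j - 1) * (K + 1)\<close> behind \<open>Tlow\<close> requires.\<close>
      have jK: "K + 3 \<le> j"
      proof (rule ccontr)
        assume "\<not> ?thesis"
        then have "j * (K + 1) \<le> (K + 2) * (K + 1)" by (intro mult_right_mono) auto
        then have "real Z ^ (j * (K + 1)) \<le> real Z ^ ((K + 2) * (K + 1))" using Z1 by (intro power_increasing) auto
        also have "\<dots> \<le> T" using Tlow0 by (simp only: mult.commute)
        also have "T < T * real Z" using T0 Z1 by simp
        finally show False using j1 by simp
      qed
      \<comment> \<open>The lower bound on \<open>K\<close> keeps \<open>j\<close> small against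
        \<open>r\<close>; the consequence \<open>Z ^ j <= Y\<close> is used for
        \<open>up\<close>.\<close>
      have jr: "2 * j \<le> r"
      proof -
        have "real Z ^ ((j - 1) * (K + 1)) < T * real Z" using jK by (intro j2) auto
        also note Tup0
        finally have "(j - 1) * (K + 1) < r * (B + Tm) + 2" using Z1 by (rule power_less_imp_less_exp[rotated])
        moreover have "(j - 1) * (4 * (B + Tm + 1)) \<le> (j - 1) * (K + 1)" using K by (intro mult_left_mono) auto
        moreover have "r * (B + Tm) + 1 \<le> r * (B + Tm + 1)" using r by simp
        ultimately have "(4 * (j - 1)) * (B + Tm + 1) \<le> r * (B + Tm + 1)" by (simp add: mult_ac)
        then have "4 * (j - 1) \<le> r" by (simp only: mult_le_cancel2)
        then show ?thesis using r jK by linarith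
      qed
      have Tlow: "real Z ^ (j * K + 1) \<le> T"
      proof -
        have "j * K + 2 \<le> (j - 1) * (K + 1)"
        proof -
          obtain i where "j = i + (K + 3)" using jK by (metis le_Suc_ex add.commute)
          then show ?thesis by (simp add: algebra_simps)
        qed
        then have "real Z ^ (j * K + 2) \<le> real Z ^ ((j - 1) * (K + 1))" using Z1 by (intro power_increasing) auto
        also have "\<dots> < T * real Z" using jK by (intro j2) auto
        finally have "real Z ^ (j * K + 1) * real Z < T * real Z" by (simp add: mult_ac)
        then show ?thesis using Z1 by (simp add: mult.commute)
      qed
      define Y where "Y = Z ^ (r - j)"
      have Y1: "1 \<le> Y" using Z by (simp add: Y_def)
      have YX: "real Y * real Z ^ j = X"
      proof -
        have "Y * Z ^ j = Z ^ r" unfolding Y_def power_add[symmetric] using jr by simp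
        then show ?thesis unfolding X_def by (metis of_nat_mult of_nat_power)
      qed
      have YXd: "real Y / X = 1 / real Z ^ j" using YX Z1 X1 by (simp add: field_simps)
      have LX: "real L * real Z = X"
      proof -
        have "L * Z ^ 1 = Z ^ r" unfolding L_def power_add[symmetric] using r by simp
        then show ?thesis unfolding X_def by (metis of_nat_mult power_one_right)
      qed
      have YL: "real Y \<le> \<epsilon> / 4 * real L"
      proof -
        have "r - j + 1 \<le> r - 1" using jr jK by linarith
        then have "Z ^ (r - j + 1) \<le> L" unfolding L_def using Z by (intro power_increasing) auto
        then have "real (Y * Z) \<le> real L" unfolding Y_def by (intro of_nat_mono) (simp add: mult.commute)
        then have "real Y * (\<epsilon> * real Z) \<le> \<epsilon> * real L" using \<epsilon> by (simp add: mult.left_commute)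
        moreover have "real Y * 4 \<le> real Y * (\<epsilon> * real Z)" using \<epsilon>Z Z\<^sub>0 by (intro mult_left_mono) auto
        ultimately show ?thesis by simp
      qed
      have "\<exists>p. p + Y \<le> L \<and> \<epsilon> / 2 * real Y < norm (\<Sum>y<Y. expi (gen_poly \<Theta> \<gamma> (real (Z ^ r + (p + y)))))"
      proof (rule ccontr)
        assume "\<not> ?thesis"
        then have "norm (\<Sum>y<L. expi (gen_poly \<Theta> \<gamma> (real (Z ^ r + y)))) \<le> \<epsilon> / 2 * real L + real Y"
          using \<epsilon> Y1 by (intro norm_sum_le_subintervals) (auto simp: not_less)
        then have "\<epsilon> * real L \<le> \<epsilon> / 2 * real L + \<epsilon> / 4 * real L" using bias YL unfolding L_def[symmetric] by linarith
        moreover have "0 < \<epsilon> * real L" using \<epsilon> Z by (simp add: L_def)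
        ultimately show False by simp
      qed
      then obtain p where p: "p + Y \<le> L" and
        biasY: "\<epsilon> / 2 * real Y < norm (\<Sum>y<Y. expi (gen_poly \<Theta> \<gamma> (real (Z ^ r + (p + y)))))" by blast
      \<comment> \<open>The base point of the biased sub-block. It differs from \<open>X\<close> by
        at most \<open>X / Z\<close>, so the moment of order \<open>K\<close> changes only by a
        small fraction of \<open>T\<close>.\<close>
      define X' where "X' = X + real p"
      have X': "X \<le> X'" "0 < X'" using X1 by (auto simp: X'_def)
      have pX: "real p * real Z \<le> X" using p LX mult_right_mono[of "real p" "real L" "real Z"] by simp
      have pX2: "real p \<le> X / 2"
      proof -
        have "real p * 2 \<le> real p * real Z" using Z by (intro mult_left_mono) auto
        then show ?thesis using pX by simp
      qed
      have X'2: "X' \<le> 2 * X" using pX2 X1 by (simp add: X'_def)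
      have X'\<theta>: "X' powr \<theta> \<le> 2 ^ Tm * X powr \<theta>" if "\<theta> \<in> \<Theta>" for \<theta>
      proof -
        have "X' powr \<theta> \<le> (2 * X) powr \<theta>" using X' X'2 \<Theta>(2)[OF that] by (intro powr_mono2) auto
        also have "\<dots> = 2 powr \<theta> * X powr \<theta>" using X1 by (simp add: powr_mult)
        also have "2 powr \<theta> \<le> 2 powr real Tm" using \<Theta>(3)[OF that] by (intro powr_mono) auto
        also have "2 powr real Tm = 2 ^ Tm" by (simp add: powr_realpow)
        finally show ?thesis by (simp add: mult_right_mono)
      qed
      define c where "c = (\<lambda>i. \<Sum>\<theta>\<in>\<Theta>. \<gamma> \<theta> * (\<theta> gchoose i) * X' powr \<theta> / X' ^ i)"
      define \<phi> where "\<phi> = (\<lambda>y. \<Sum>i\<le>K. c i * real y ^ i)"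
      have Yhalf: "real Y \<le> X / 2"
      proof -
        have "real Z ^ 1 \<le> real Z ^ j" using Z1 jK by (intro power_increasing) auto
        then have "2 \<le> real Z ^ j" using Z unfolding power_one_right by linarith
        then have "real Y * 2 \<le> real Y * real Z ^ j" by (intro mult_left_mono) auto
        then show ?thesis using YX by simp
      qed
      have err: "\<bar>gen_poly \<Theta> \<gamma> (real (Z ^ r + (p + y))) - \<phi> y\<bar> \<le> c2 / real Z" if "y < Y" for y
      proof -
        have y: "real y \<le> X' / 2" using that Yhalf X' by linarith
        have "\<phi> y = (\<Sum>\<theta>\<in>\<Theta>. \<Sum>i\<le>K. \<gamma> \<theta> * (\<theta> gchoose i) * X' powr \<theta> / X' ^ i * real y ^ i)"
          unfolding \<phi>_def c_def sum_distrib_right by (rule sum.swap)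
        also have "\<dots> = (\<Sum>\<theta>\<in>\<Theta>. \<gamma> \<theta> * (\<Sum>i\<le>K. (\<theta> gchoose i) * X' powr \<theta> * (real y / X') ^ i))"
          by (simp add: sum_distrib_left power_divide mult.assoc)
        finally have \<phi>y: "\<phi> y = (\<Sum>\<theta>\<in>\<Theta>. \<gamma> \<theta> * (\<Sum>i\<le>K. (\<theta> gchoose i) * X' powr \<theta> * (real y / X') ^ i))" .
        have "real (Z ^ r + (p + y)) = X' + real y" by (simp add: X'_def X_def)
        then have "\<bar>gen_poly \<Theta> \<gamma> (real (Z ^ r + (p + y))) - \<phi> y\<bar>
          = \<bar>\<Sum>\<theta>\<in>\<Theta>. \<gamma> \<theta> * ((X' + real y) powr \<theta> - (\<Sum>i\<le>K. (\<theta> gchoose i) * X' powr \<theta> * (real y / X') ^ i))\<bar>"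
          unfolding \<phi>y gen_poly_def by (simp only: right_diff_distrib sum_subtractf)
        also have "\<dots> \<le> (\<Sum>\<theta>\<in>\<Theta>. \<bar>\<gamma> \<theta>\<bar> * \<bar>(X' + real y) powr \<theta> - (\<Sum>i\<le>K. (\<theta> gchoose i) * X' powr \<theta> * (real y / X') ^ i)\<bar>)"
          unfolding abs_mult[symmetric] by (rule sum_abs)
        also have "\<dots> \<le> (\<Sum>\<theta>\<in>\<Theta>. \<bar>\<gamma> \<theta>\<bar> * (ST * (2 ^ Tm * X powr \<theta>) * (1 / real Z ^ j) ^ Suc K))"
        proof (intro sum_mono mult_left_mono)
          fix \<theta> assume \<theta>: "\<theta> \<in> \<Theta>"
          have "\<bar>(X' + real y) powr \<theta> - (\<Sum>i\<le>K. (\<theta> gchoose i) * X' powr \<theta> * (real y / X') ^ i)\<bar> \<le> CT \<theta> * X' powr \<theta> * (real y / X') ^ Suc K"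
            by (rule CT'[OF X'(2) of_nat_0_le_iff y])
          also have "\<dots> \<le> ST * (2 ^ Tm * X powr \<theta>) * (1 / real Z ^ j) ^ Suc K"
          proof (rule mult_mono[OF mult_mono[OF CT_le[OF \<theta>] X'\<theta>[OF \<theta>]] power_mono])
            have "real y \<le> real Y" "0 \<le> real Y" using that by auto
            then have "real y / X' \<le> real Y / X" using X' X1 by (intro frac_le) linarith+
            then show "real y / X' \<le> 1 / real Z ^ j" using YXd by simp
            show "0 \<le> real y / X'" using X' by simp
          qed (use nn CTnn X' in \<open>simp_all\<close>)
          finally show "\<bar>(X' + real y) powr \<theta> - (\<Sum>i\<le>K. (\<theta> gchoose i) * X' powr \<theta> * (real y / X') ^ i)\<bar>
            \<le> ST * (2 ^ Tm * X powr \<theta>) * (1 / real Z ^ j) ^ Suc K" .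
        qed auto
        also have "\<dots> = c2 * (1 / real Z ^ j) ^ Suc K * T"
          unfolding T_def sum_distrib_left c2_def by (intro sum.cong) auto
        also have "\<dots> = c2 * (T / real Z ^ (j * (K + 1)))"
          by (simp add: power_divide power_mult power_add)
        also have "T / real Z ^ (j * (K + 1)) \<le> 1 / real Z"
          using j1 Z1 by (simp add: field_simps)
        finally show ?thesis using cnn by (simp add: mult_left_mono)
      qed
      have bias\<phi>: "\<epsilon> / 4 * real Y \<le> norm (\<Sum>y<Y. expi (\<phi> y))"
      proof -
        have "norm ((\<Sum>y<Y. expi (gen_poly \<Theta> \<gamma> (real (Z ^ r + (p + y))))) - (\<Sum>y<Y. expi (\<phi> y))) \<le> (\<Sum>y<Y. \<epsilon> / 4)"
          unfolding sum_subtractf[symmetric]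
        proof (rule sum_norm_le)
          fix y assume "y \<in> {..<Y}"
          then have y: "y < Y" by simp
          have "norm (expi (gen_poly \<Theta> \<gamma> (real (Z ^ r + (p + y)))) - expi (\<phi> y)) \<le> 2 * pi * (c2 / real Z)"
            by (rule order_trans[OF norm_expi_diff_le]) (use err[OF y] in \<open>intro mult_left_mono, auto\<close>)
          also have "\<dots> \<le> \<epsilon> / 4"
          proof -
            have "8 * pi * c2 \<le> \<epsilon> * real Z" using \<epsilon>Z Z\<^sub>0 by linarith
            then show ?thesis using Z1 by (simp add: field_simps)
          qed
          finally show "norm (expi (gen_poly \<Theta> \<gamma> (real (Z ^ r + (p + y)))) - expi (\<phi> y)) \<le> \<epsilon> / 4" .
        qed
        then show ?thesis
          using biasY norm_triangle_ineq2[of "\<Sum>y<Y. expi (gen_poly \<Theta> \<gamma> (real (Z ^ r + (p + y))))" "\<Sum>y<Y. expi (\<phi> y)"]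
          by (simp add: field_simps)
      qed
      define D' where "D' = (\<Sum>\<theta>\<in>\<Theta>. \<gamma> \<theta> * X' powr \<theta> * (\<theta> gchoose K))"
      have D'up: "\<bar>D'\<bar> \<le> c5 * T"
      proof -
        have "\<bar>D'\<bar> \<le> (\<Sum>\<theta>\<in>\<Theta>. \<bar>\<gamma> \<theta> * X' powr \<theta> * (\<theta> gchoose K)\<bar>)" unfolding D'_def by (rule sum_abs)
        also have "\<dots> \<le> (\<Sum>\<theta>\<in>\<Theta>. \<bar>\<gamma> \<theta>\<bar> * (2 ^ Tm * X powr \<theta>) * G)"
          unfolding abs_mult using X'\<theta> G_le nn by (intro sum_mono mult_mono) auto
        also have "\<dots> = c5 * T" unfolding T_def c5_def sum_distrib_left by (intro sum.cong) auto
        finally show ?thesis .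
      qed
      have D'low: "T / (2 * C\<^sub>4) \<le> \<bar>D'\<bar>"
      proof -
        have "\<bar>D' - D\<bar> \<le> (\<Sum>\<theta>\<in>\<Theta>. \<bar>\<gamma> \<theta> * X' powr \<theta> * (\<theta> gchoose K) - \<gamma> \<theta> * X powr \<theta> * (\<theta> gchoose K)\<bar>)"
          unfolding D'_def D_def sum_subtractf[symmetric] by (rule sum_abs)
        also have "\<dots> = (\<Sum>\<theta>\<in>\<Theta>. \<bar>\<gamma> \<theta>\<bar> * \<bar>X' powr \<theta> - X powr \<theta>\<bar> * \<bar>\<theta> gchoose K\<bar>)"
          unfolding abs_mult[symmetric] by (simp add: algebra_simps)
        also have "\<dots> \<le> (\<Sum>\<theta>\<in>\<Theta>. \<bar>\<gamma> \<theta>\<bar> * (S0 * X powr \<theta> * (1 / real Z)) * G)"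
        proof (intro sum_mono mult_mono)
          fix \<theta> assume \<theta>: "\<theta> \<in> \<Theta>"
          have "\<bar>X' powr \<theta> - X powr \<theta>\<bar> \<le> C0 \<theta> * X powr \<theta> * (real p / X)"
            unfolding X'_def using X1 by (intro C0' pX2) auto
          also have "\<dots> \<le> S0 * X powr \<theta> * (1 / real Z)"
            using C0_le[OF \<theta>] nn pX X1 Z1 by (intro mult_mono) (auto simp: field_simps)
          finally show "\<bar>X' powr \<theta> - X powr \<theta>\<bar> \<le> S0 * X powr \<theta> * (1 / real Z)" .
          show "\<bar>\<theta> gchoose K\<bar> \<le> G" by (rule G_le[OF \<theta>])
        qed (use nn in auto)
        also have "\<dots> = c3 / real Z * T" unfolding T_def c3_def sum_distrib_left by (intro sum.cong) auto
        also have "\<dots> \<le> 1 / (2 * C\<^sub>4) * T"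
        proof (intro mult_right_mono)
          have "2 * c3 * C\<^sub>4 \<le> real Z" using ZZ Z\<^sub>0 by linarith
          then show "c3 / real Z \<le> 1 / (2 * C\<^sub>4)" using Z1 C\<^sub>4 by (simp add: field_simps)
        qed (use T0 in simp)
        finally have "\<bar>D' - D\<bar> \<le> T / (2 * C\<^sub>4)" by simp
        moreover have "T / C\<^sub>4 = T / (2 * C\<^sub>4) + T / (2 * C\<^sub>4)" by simp
        ultimately show ?thesis using TD' by linarith
      qed
      define a where "a = fact K * c K"
      have pd: "poly_diff K a \<phi>" unfolding a_def \<phi>_def by (rule poly_diff_power_sum)
      have cK: "c K = D' / X' ^ K"
        unfolding c_def D'_def sum_divide_distrib by (intro sum.cong) auto
      have aY: "\<bar>a\<bar> * real Y ^ K = fact K * \<bar>D'\<bar> * (real Y / X') ^ K"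
        using X' by (simp add: a_def cK abs_mult power_divide)
      \<comment> \<open>The choice of \<open>j\<close> gives
        \<open>T * Z <= Z ^ (j * K) * Z ^ j\<close>, and \<open>Z ^ j <= Y\<close>; hence the
        leading term is at most \<open>Y / 2\<close> on the block.\<close>
      have up: "\<bar>a\<bar> * real Y ^ (K - 1) \<le> 1 / 2"
      proof -
        have "\<bar>a\<bar> * real Y ^ K \<le> fact K * (c5 * T) * (1 / real Z ^ j) ^ K"
          unfolding aY
        proof (intro mult_mono power_mono)
          have "real Y / X' \<le> real Y / X" using X' X1 by (intro frac_le) auto
          then show "real Y / X' \<le> 1 / real Z ^ j" using YXd by simp
        qed (use D'up X' cnn T0 in auto)
        also have "\<dots> = fact K * c5 * (T / real Z ^ (j * K))"
          by (simp add: power_divide power_mult)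
        also have "\<dots> \<le> fact K * c5 * (real Y / real Z)"
        proof (intro mult_left_mono)
          have "real Z ^ j \<le> real Y"
            unfolding Y_def of_nat_power using jr Z1 by (intro power_increasing) auto
          then have "real Z ^ (j * K) * real Z ^ j \<le> real Z ^ (j * K) * real Y"
            by (intro mult_left_mono) auto
          moreover have "real Z ^ (j * (K + 1)) = real Z ^ (j * K) * real Z ^ j" by (simp add: power_add)
          ultimately have "T * real Z \<le> real Z ^ (j * K) * real Y" using j1 by linarith
          then show "T / real Z ^ (j * K) \<le> real Y / real Z" using Z1 by (simp add: field_simps)
        qed (use cnn in auto)
        also have "\<dots> \<le> real Y / 2"
        proof -
          have "2 * fact K * c5 \<le> real Z" using ZZ Z\<^sub>0 by linarith
          then have "(2 * fact K * c5) * real Y \<le> real Z * real Y" by (intro mult_right_mono) auto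
          then show ?thesis using Z1 by (simp add: field_simps)
        qed
        finally have "\<bar>a\<bar> * real Y ^ K \<le> 1 / 2 * real Y" by simp
        moreover have "real Y ^ K = real Y ^ (K - 1) * real Y" using K1 by (simp add: power_eq_if)
        ultimately have "(\<bar>a\<bar> * real Y ^ (K - 1)) * real Y \<le> 1 / 2 * real Y" by (simp add: mult.assoc)
        then show ?thesis using Y1 by (simp only: mult_le_cancel_right)
      qed
      have "\<bar>a\<bar> * real Y ^ K \<le> CW / (\<epsilon> / 4) ^ EW"
        using Weyl[OF Y1 order_refl _ _ pd up bias\<phi>] \<epsilon> by simp
      \<comment> \<open>By \<open>Tlow\<close> the leading term is at least of order
        \<open>Z\<close>, while Weyl's bound is a power of \<open>1 / \<epsilon>\<close>. The factor
        \<open>2 ^ K\<close> comes from \<open>X' <= 2 * X\<close>.\<close>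
      moreover have "real Z / (2 * C\<^sub>4 * 2 ^ K) \<le> \<bar>a\<bar> * real Y ^ K"
      proof -
        have "real Z * real Z ^ (j * K) \<le> T" using Tlow by (simp add: mult.commute)
        then have "real Z \<le> T / real Z ^ (j * K)" using Z1 by (simp add: field_simps)
        then have "real Z / (2 * C\<^sub>4 * 2 ^ K) \<le> T / real Z ^ (j * K) / (2 * C\<^sub>4 * 2 ^ K)"
          using C\<^sub>4 by (intro divide_right_mono) auto
        also have "\<dots> = 1 * (T / (2 * C\<^sub>4)) * (1 / real Z ^ j / 2) ^ K"
          by (simp add: power_divide power_mult)
        also have "\<dots> \<le> fact K * \<bar>D'\<bar> * (real Y / X') ^ K"
        proof (intro mult_mono power_mono D'low)
          have "real Y / (2 * X) \<le> real Y / X'" using X'2 X' X1 by (intro divide_left_mono) auto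
          then show "1 / real Z ^ j / 2 \<le> real Y / X'" using YXd by simp
        qed (use T0 C\<^sub>4 Z1 in auto)
        finally show ?thesis by (simp add: aY)
      qed
      ultimately have "real Z / (2 * C\<^sub>4 * 2 ^ K) \<le> CW / (\<epsilon> / 4) ^ EW" by linarith
      also have "\<dots> = CW * 4 ^ EW / \<epsilon> ^ EW" by (simp add: power_divide)
      finally have "real Z \<le> CW * 4 ^ EW / \<epsilon> ^ EW * (2 * C\<^sub>4 * 2 ^ K)"
        using C\<^sub>4 by (subst (asm) pos_divide_le_eq) auto
      also have "\<dots> = CF / \<epsilon> ^ EW" by (simp add: CF_def)
      also have "\<dots> \<le> C / \<epsilon> ^ E" using \<epsilon>E Z\<^sub>0 CF by (intro frac_le) (auto simp: C_def)
      finally show ?thesis .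
    qed
  qed
qed

text \<open>Here \<open>q = 1\<close> and \<open>m = 0\<close> suffice. A coefficient above
  \<open>1 / Z ^ \<kappa>\<close> makes the phase size \<open>T\<close> large, the moment inequality
  selects a degree \<open>K\<close> whose Taylor coefficient is comparable to \<open>T\<close>, and
  the estimate for that degree bounds \<open>Z\<close> by \<open>Cc * M ^ (a * Ec)\<close>, which a
  large \<open>w\<close> excludes.\<close>

lemma inverse_property_nonint:
  assumes \<Theta>: "finite \<Theta>" "\<And>\<theta>. \<theta> \<in> \<Theta> \<Longrightarrow> 1 \<le> \<theta>" "\<Theta> \<inter> \<nat> = {}"
  shows "inverse_property \<Theta>"
  unfolding inverse_property_def
proof (intro allI)
  fix B \<kappa> :: nat
  obtain Tm :: nat where Tm: "\<And>\<theta>. \<theta> \<in> \<Theta> \<Longrightarrow> \<theta> \<le> real Tm"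
    using finite_real_set_bound[OF \<Theta>(1)] by blast
  \<comment> \<open>\<open>2 * B\<close> replaces \<open>B\<close> because the range ends below
    \<open>Z ^ (r + 1)\<close>: coefficients up to \<open>Z ^ ((r + 1) * B)\<close> are at most
    \<open>(Z ^ r) ^ (2 * B)\<close>.\<close>
  define K\<^sub>0 where "K\<^sub>0 = 4 * (2 * B + Tm + 1)"
  define K\<^sub>1 where "K\<^sub>1 = K\<^sub>0 + card \<Theta>"
  \<comment> \<open>Ensures \<open>(K + 1) * (K + 2) <= r - \<kappa>\<close> for all
    \<open>K <= K\<^sub>1\<close>, so one coefficient above \<open>1 / Z ^ \<kappa>\<close> already
    forces the required lower bound on \<open>T\<close>.\<close>
  define r where "r = (K\<^sub>1 + 1) * (K\<^sub>1 + 2) + \<kappa> + 4"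
  obtain Cm where Cm: "Cm \<ge> 0" and moments: "\<And>v. (\<Sum>\<theta>\<in>\<Theta>. \<bar>v \<theta>\<bar>)
           \<le> Cm * (\<Sum>i\<in>{K\<^sub>0..<K\<^sub>1}. \<bar>\<Sum>\<theta>\<in>\<Theta>. v \<theta> * (\<theta> gchoose i)\<bar>)"
    using gbinomial_moments[OF \<Theta>(1,3), of K\<^sub>0] unfolding K\<^sub>1_def by blast
  \<comment> \<open>The summand 1 makes \<open>Cm * card \<Theta> / C\<^sub>4 < 1\<close>, so the
    moments cannot all be below \<open>T / C\<^sub>4\<close>.\<close>
  define C\<^sub>4 where "C\<^sub>4 = Cm * real (card \<Theta>) + 1"
  have C\<^sub>4: "0 < C\<^sub>4" using Cm by (simp add: C\<^sub>4_def add_nonneg_pos)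
  define P where "P = (\<lambda>K C E. 1 \<le> C \<and> (\<forall>Z\<ge>2. \<forall>\<gamma> \<epsilon>. 0 < \<epsilon> \<longrightarrow> \<epsilon> \<le> 1 \<longrightarrow>
     (\<forall>\<theta>\<in>\<Theta>. \<bar>\<gamma> \<theta>\<bar> \<le> real (Z ^ r) ^ (2 * B)) \<longrightarrow>
     real Z ^ ((K + 1) * (K + 2)) \<le> (\<Sum>\<theta>\<in>\<Theta>. \<bar>\<gamma> \<theta>\<bar> * real (Z ^ r) powr \<theta>) \<longrightarrow>
     (\<Sum>\<theta>\<in>\<Theta>. \<bar>\<gamma> \<theta>\<bar> * real (Z ^ r) powr \<theta>) \<le> C\<^sub>4 * \<bar>\<Sum>\<theta>\<in>\<Theta>. \<gamma> \<theta> * real (Z ^ r) powr \<theta> * (\<theta> gchoose K)\<bar> \<longrightarrow>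
     \<epsilon> * real (Z ^ (r - 1)) \<le> norm (\<Sum>y<Z ^ (r - 1). expi (gen_poly \<Theta> \<gamma> (real (Z ^ r + y)))) \<longrightarrow>
     real Z \<le> C / \<epsilon> ^ E))"
  have "\<forall>K\<in>{K\<^sub>0..<K\<^sub>1}. \<exists>c. P K (fst c) (snd c)"
  proof
    fix K assume "K \<in> {K\<^sub>0..<K\<^sub>1}"
    then have "4 * (2 * B + Tm + 1) \<le> K + 1" by (simp add: K\<^sub>0_def)
    from inverse_nonint_fixed_degree[OF \<Theta>(1,2) Tm this _ C\<^sub>4, of r]
    have "\<exists>C E. P K C E" unfolding P_def by (auto simp: r_def)
    then show "\<exists>c. P K (fst c) (snd c)" by force
  qed
  then obtain c where c: "\<forall>K\<in>{K\<^sub>0..<K\<^sub>1}. P K (fst (c K)) (snd (c K))" by (rule bchoice[THEN exE])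
  define Cc where "Cc = (\<Sum>K\<in>{K\<^sub>0..<K\<^sub>1}. fst (c K))"
  define Ec where "Ec = (\<Sum>K\<in>{K\<^sub>0..<K\<^sub>1}. snd (c K))"
  have fst_c: "1 \<le> fst (c K)" if "K \<in> {K\<^sub>0..<K\<^sub>1}" for K using c that by (auto simp: P_def)
  have fst_le: "fst (c K) \<le> Cc" if "K \<in> {K\<^sub>0..<K\<^sub>1}" for K
    unfolding Cc_def using that fst_c by (intro member_le_sum[where f = "\<lambda>K. fst (c K)"]) (auto intro: order_trans[of 0 1])
  have snd_le: "snd (c K) \<le> Ec" if "K \<in> {K\<^sub>0..<K\<^sub>1}" for K
    unfolding Ec_def using that by (intro member_le_sum[where f = "\<lambda>K. snd (c K)"]) auto
  have r4: "4 \<le> r" by (simp add: r_def)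
  have main: "\<exists>\<sigma> w\<^sub>0. \<forall>w\<ge>w\<^sub>0. \<forall>M\<ge>2. \<exists>X\<ge>1. \<exists>L\<ge>1.
     X + L \<le> (M ^ w) ^ (r + 1) \<and>
     (\<forall>\<gamma>. (\<forall>\<theta>\<in>\<Theta>. \<theta> \<notin> \<nat> \<longrightarrow> \<bar>\<gamma> \<theta>\<bar> \<le> (real M ^ w) ^ ((r + 1) * B)) \<longrightarrow>
        real L / real M ^ a \<le> norm (\<Sum>y<L. expi (gen_poly \<Theta> \<gamma> (real (X + y)))) \<longrightarrow>
        (\<exists>q\<ge>1. \<exists>m :: real \<Rightarrow> int. q \<le> M ^ \<sigma> \<and>
           (\<forall>\<theta>\<in>\<Theta>. (\<theta> \<notin> \<nat> \<longrightarrow> m \<theta> = 0) \<and> \<bar>real q * \<gamma> \<theta> - of_int (m \<theta>)\<bar> \<le> 1 / (real M ^ w) ^ \<kappa>)))" for a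
  proof (rule exI[of _ 0], rule exI[of _ "nat \<lceil>Cc\<rceil> + 1 + a * Ec"], intro allI impI)
    fix w M :: nat assume w: "nat \<lceil>Cc\<rceil> + 1 + a * Ec \<le> w" and M: "2 \<le> M"
    define Z where "Z = M ^ w"
    have ZM: "real Z = real M ^ w" by (simp add: Z_def)
    have "M ^ 1 \<le> Z" unfolding Z_def using M w by (intro power_increasing) auto
    then have Z: "2 \<le> Z" using M by simp
    have "(nat \<lceil>Cc\<rceil> + 1) * M ^ (a * Ec) \<le> Z"
      unfolding Z_def using M w by (intro mult_power_le_power) auto
    then have "real ((nat \<lceil>Cc\<rceil> + 1) * M ^ (a * Ec)) \<le> real Z" by (rule of_nat_mono)
    moreover have "Cc * real M ^ (a * Ec) < real ((nat \<lceil>Cc\<rceil> + 1) * M ^ (a * Ec))"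
    proof -
      have "Cc < real (nat \<lceil>Cc\<rceil> + 1)" by linarith
      then show ?thesis unfolding of_nat_mult of_nat_power using M by (intro mult_strict_right_mono) auto
    qed
    ultimately have bigZ: "Cc * real M ^ (a * Ec) < real Z" by linarith
    show "\<exists>X\<ge>1. \<exists>L\<ge>1. X + L \<le> (M ^ w) ^ (r + 1) \<and>
     (\<forall>\<gamma>. (\<forall>\<theta>\<in>\<Theta>. \<theta> \<notin> \<nat> \<longrightarrow> \<bar>\<gamma> \<theta>\<bar> \<le> (real M ^ w) ^ ((r + 1) * B)) \<longrightarrow>
        real L / real M ^ a \<le> norm (\<Sum>y<L. expi (gen_poly \<Theta> \<gamma> (real (X + y)))) \<longrightarrow>
        (\<exists>q\<ge>1. \<exists>m :: real \<Rightarrow> int. q \<le> M ^ 0 \<and>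
           (\<forall>\<theta>\<in>\<Theta>. (\<theta> \<notin> \<nat> \<longrightarrow> m \<theta> = 0) \<and> \<bar>real q * \<gamma> \<theta> - of_int (m \<theta>)\<bar> \<le> 1 / (real M ^ w) ^ \<kappa>)))"
      unfolding ZM[symmetric] Z_def[symmetric]
    proof (rule exI[of _ "Z ^ r"], rule conjI, (use Z in simp), rule exI[of _ "Z ^ (r - 1)"], intro conjI allI impI)
      show "1 \<le> Z ^ (r - 1)" using Z by simp
      have "Z ^ (r - 1) \<le> Z ^ r" using Z by (intro power_increasing) auto
      moreover have "2 * Z ^ r \<le> Z * Z ^ r" using Z by (intro mult_right_mono) auto
      moreover have "Z ^ (r + 1) = Z * Z ^ r" by simp
      ultimately show "Z ^ r + Z ^ (r - 1) \<le> Z ^ (r + 1)" by linarith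
      fix \<gamma> :: "real \<Rightarrow> real"
      assume \<gamma>: "\<forall>\<theta>\<in>\<Theta>. \<theta> \<notin> \<nat> \<longrightarrow> \<bar>\<gamma> \<theta>\<bar> \<le> real Z ^ ((r + 1) * B)"
        and bias: "real (Z ^ (r - 1)) / real M ^ a \<le> norm (\<Sum>y<Z ^ (r - 1). expi (gen_poly \<Theta> \<gamma> (real (Z ^ r + y))))"
      define T where "T = (\<Sum>\<theta>\<in>\<Theta>. \<bar>\<gamma> \<theta>\<bar> * real (Z ^ r) powr \<theta>)"
      have small: "\<bar>\<gamma> \<xi>\<bar> \<le> 1 / real Z ^ \<kappa>" if \<xi>: "\<xi> \<in> \<Theta>" for \<xi>
      proof (rule ccontr)
        assume "\<not> ?thesis"
        then have "1 / real Z ^ \<kappa> < \<bar>\<gamma> \<xi>\<bar>" by simp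
        then have "1 / real Z ^ \<kappa> * real (Z ^ r) powr 1 \<le> \<bar>\<gamma> \<xi>\<bar> * real (Z ^ r) powr \<xi>"
          using \<Theta>(2)[OF \<xi>] Z by (intro mult_mono powr_mono) auto
        also have "\<dots> \<le> T"
          unfolding T_def using \<xi> \<Theta>(1) by (intro member_le_sum[where f = "\<lambda>\<theta>. \<bar>\<gamma> \<theta>\<bar> * real (Z ^ r) powr \<theta>"]) auto
        finally have "real Z ^ r / real Z ^ \<kappa> \<le> T" using Z by simp
        moreover have "real Z ^ r / real Z ^ \<kappa> = real Z ^ (r - \<kappa>)"
          using Z by (subst power_diff) (auto simp: r_def)
        moreover have pow: "real Z ^ ((K + 1) * (K + 2)) \<le> real Z ^ (r - \<kappa>)" if "K \<le> K\<^sub>1" for K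
        proof -
          have "(K + 1) * (K + 2) \<le> (K\<^sub>1 + 1) * (K\<^sub>1 + 2)" using that by (intro mult_mono) auto
          then show ?thesis using Z by (intro power_increasing) (auto simp: r_def)
        qed
        ultimately have Tlow: "real Z ^ ((K + 1) * (K + 2)) \<le> T" if "K \<le> K\<^sub>1" for K
          using that by (metis order_trans)
        have T0: "0 < T" using Tlow[of 0] Z by (smt (verit) le0 of_nat_0_less_iff pos2 less_le_trans zero_less_power)
        define D where "D = (\<lambda>K. \<bar>\<Sum>\<theta>\<in>\<Theta>. \<gamma> \<theta> * real (Z ^ r) powr \<theta> * (\<theta> gchoose K)\<bar>)"
        have "\<exists>K\<in>{K\<^sub>0..<K\<^sub>1}. T \<le> C\<^sub>4 * D K"
        proof (rule ccontr)
          assume "\<not> ?thesis"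
          then have D: "D K \<le> T / C\<^sub>4" if "K \<in> {K\<^sub>0..<K\<^sub>1}" for K
            using that C\<^sub>4 by (auto simp: field_simps not_le intro: less_imp_le)
          have "T = (\<Sum>\<theta>\<in>\<Theta>. \<bar>\<gamma> \<theta> * real (Z ^ r) powr \<theta>\<bar>)" by (simp add: T_def abs_mult)
          also have "\<dots> \<le> Cm * (\<Sum>K\<in>{K\<^sub>0..<K\<^sub>1}. D K)" unfolding D_def by (rule moments)
          also have "\<dots> \<le> Cm * (\<Sum>K\<in>{K\<^sub>0..<K\<^sub>1}. T / C\<^sub>4)" using Cm D by (intro mult_left_mono sum_mono) auto
          also have "\<dots> = (C\<^sub>4 - 1) / C\<^sub>4 * T" by (simp add: K\<^sub>1_def C\<^sub>4_def)
          also have "\<dots> < 1 * T" using T0 C\<^sub>4 by (intro mult_strict_right_mono) auto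
          finally show False by simp
        qed
        then obtain K where K: "K \<in> {K\<^sub>0..<K\<^sub>1}" "T \<le> C\<^sub>4 * D K" by blast
        define \<epsilon> where "\<epsilon> = 1 / real M ^ a"
        have \<epsilon>: "0 < \<epsilon>" "\<epsilon> \<le> 1" using M by (auto simp: \<epsilon>_def)
        have \<gamma>': "\<forall>\<theta>\<in>\<Theta>. \<bar>\<gamma> \<theta>\<bar> \<le> real (Z ^ r) ^ (2 * B)"
        proof
          fix \<theta> assume "\<theta> \<in> \<Theta>"
          then have "\<bar>\<gamma> \<theta>\<bar> \<le> real Z ^ ((r + 1) * B)" using \<gamma> \<Theta>(3) by auto
          also have "\<dots> \<le> real Z ^ (r * (2 * B))"
          proof (rule power_increasing)
            have "(r + 1) * B \<le> (r * 2) * B" using r4 by (intro mult_right_mono) auto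
            then show "(r + 1) * B \<le> r * (2 * B)" by (simp add: mult.assoc)
          qed (use Z in simp)
          also have "\<dots> = real (Z ^ r) ^ (2 * B)" by (simp add: power_mult)
          finally show "\<bar>\<gamma> \<theta>\<bar> \<le> real (Z ^ r) ^ (2 * B)" .
        qed
        have "P K (fst (c K)) (snd (c K))" using c K by blast
        moreover have "real Z ^ ((K + 1) * (K + 2)) \<le> T" using K by (intro Tlow) auto
        moreover have "\<epsilon> * real (Z ^ (r - 1)) \<le> norm (\<Sum>y<Z ^ (r - 1). expi (gen_poly \<Theta> \<gamma> (real (Z ^ r + y))))"
          using bias unfolding \<epsilon>_def by simp
        ultimately have "real Z \<le> fst (c K) / \<epsilon> ^ snd (c K)"
          using Z \<epsilon> \<gamma>' K(2) unfolding P_def T_def D_def by blast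
        also have "\<dots> \<le> Cc / \<epsilon> ^ Ec"
          using \<epsilon> fst_le[OF K(1)] snd_le[OF K(1)] fst_c[OF K(1)] by (intro frac_le power_decreasing) auto
        also have "\<dots> = Cc * real M ^ (a * Ec)" by (simp add: \<epsilon>_def power_divide power_mult)
        finally show False using bigZ by simp
      qed
      show "\<exists>q\<ge>1. \<exists>m :: real \<Rightarrow> int. q \<le> M ^ 0 \<and>
           (\<forall>\<theta>\<in>\<Theta>. (\<theta> \<notin> \<nat> \<longrightarrow> m \<theta> = 0) \<and> \<bar>real q * \<gamma> \<theta> - of_int (m \<theta>)\<bar> \<le> 1 / real Z ^ \<kappa>)"
        using small by (intro exI[of _ "1 :: nat"] conjI exI[of _ "\<lambda>_. 0 :: int"]) auto
    qed
  qed
  show "\<exists>r\<ge>2. \<forall>a. \<exists>\<sigma> w\<^sub>0. \<forall>w\<ge>w\<^sub>0. \<forall>M\<ge>2. \<exists>X\<ge>1. \<exists>L\<ge>1.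
     X + L \<le> (M ^ w) ^ r \<and>
     (\<forall>\<gamma>. (\<forall>\<theta>\<in>\<Theta>. \<theta> \<notin> \<nat> \<longrightarrow> \<bar>\<gamma> \<theta>\<bar> \<le> (real M ^ w) ^ (r * B)) \<longrightarrow>
        real L / real M ^ a \<le> norm (\<Sum>y<L. expi (gen_poly \<Theta> \<gamma> (real (X + y)))) \<longrightarrow>
        (\<exists>q\<ge>1. \<exists>m :: real \<Rightarrow> int. q \<le> M ^ \<sigma> \<and>
           (\<forall>\<theta>\<in>\<Theta>. (\<theta> \<notin> \<nat> \<longrightarrow> m \<theta> = 0) \<and> \<bar>real q * \<gamma> \<theta> - of_int (m \<theta>)\<bar> \<le> 1 / (real M ^ w) ^ \<kappa>)))"
    by (rule exI[of _ "r + 1"], rule conjI[OF _ allI[OF main]]) (use r4 in simp)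
qed

text \<open>If \<open>q\<close> serves the degrees in \<open>S\<close>, then for the new degree the
  factor \<open>q ^ d\<close> is put into the coefficients and a further multiplier \<open>n\<close>
  is found. Targets are 0, so smallness in the old degrees survives multiplication by
  \<open>n ^ e\<close> at a controlled cost.\<close>

lemma simultaneous_monomials:
  assumes "finite S" "\<forall>d\<in>S. 1 \<le> d"
  shows "\<exists>E. \<forall>M\<ge>2. \<forall>I (\<Gamma> :: nat \<Rightarrow> nat \<Rightarrow> real). finite I \<longrightarrow> card I = D \<longrightarrow>
    (\<exists>q\<ge>1. q \<le> M ^ E \<and> (\<forall>i\<in>I. \<forall>d\<in>S. dist_int (\<Gamma> i d * real q ^ d) \<le> 1 / real M))"
  using assms
proof (induction S rule: finite_induct)
  case empty
  show ?case by (rule exI[of _ 0]) auto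
next
  case (insert d S)
  then obtain E where E: "\<And>M I (\<Gamma> :: nat \<Rightarrow> nat \<Rightarrow> real). 2 \<le> M \<Longrightarrow> finite I \<Longrightarrow> card I = D \<Longrightarrow>
    (\<exists>q\<ge>1. q \<le> M ^ E \<and> (\<forall>i\<in>I. \<forall>d\<in>S. dist_int (\<Gamma> i d * real q ^ d) \<le> 1 / real M))"
    by (metis insertCI)
  have d: "d \<ge> 1" using insert.prems by auto
  then have "recurrence_property {real d} D"
    by (intro recurrence_from_inverse inverse_property_monomial) auto
  then obtain g where g0: "\<forall>M\<ge>2. \<forall>I (\<Gamma> :: nat \<Rightarrow> real \<Rightarrow> real) t. finite I \<longrightarrow> card I = D \<longrightarrow>
     (\<forall>i\<in>I. \<forall>\<theta>\<in>{real d}. \<theta> \<notin> \<nat> \<longrightarrow> \<bar>\<Gamma> i \<theta>\<bar> \<le> (real M ^ g) ^ 0) \<longrightarrow>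
     (\<forall>\<theta>\<in>{real d}. \<bar>t \<theta>\<bar> \<le> 1 \<and> (\<theta> \<in> \<nat> \<longrightarrow> t \<theta> = 0)) \<longrightarrow>
     (\<exists>n\<ge>1. n \<le> M ^ g \<and>
        (\<forall>i\<in>I. dist_int (gen_poly {real d} (\<Gamma> i) (real n) - (\<Sum>\<theta>\<in>{real d}. t \<theta> * \<Gamma> i \<theta>)) \<le> 1 / real M))"
    unfolding recurrence_property_def by blast
  have g: "\<exists>n\<ge>1. n \<le> M ^ g \<and> (\<forall>i\<in>I. dist_int (\<beta> i * real n ^ d) \<le> 1 / real M)"
    if "2 \<le> M" "finite I" "card I = D" for M I and \<beta> :: "nat \<Rightarrow> real"
  proof -
    from g0[rule_format, of M I "\<lambda>i _. \<beta> i" "\<lambda>_. 0"] that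
    obtain n where n: "1 \<le> n" "n \<le> M ^ g" "\<forall>i\<in>I. dist_int (\<beta> i * real n powr real d) \<le> 1 / real M"
      by (auto simp: gen_poly_def)
    then show ?thesis by (intro exI[of _ n]) (auto simp: powr_realpow)
  qed
  \<comment> \<open>The multiplier enlarges the errors of the old degrees by
    \<open>n ^ e <= M ^ (g * \<Sum>S)\<close>, so accuracy \<open>1 / M ^ c\<close> beforehand
    leaves \<open>1 / M\<close>.\<close>
  define c where "c = g * (\<Sum>S) + 1"
  show ?case
  proof (rule exI[of _ "c * E + g"], intro allI impI)
    fix M :: nat and I :: "nat set" and \<Gamma> :: "nat \<Rightarrow> nat \<Rightarrow> real"
    assume M: "2 \<le> M" and I: "finite I" "card I = D"
    have "M ^ 1 \<le> M ^ c" using M by (intro power_increasing) (auto simp: c_def)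
    then have "2 \<le> M ^ c" using M by simp
    from E[OF this I] obtain q where q: "1 \<le> q" "q \<le> (M ^ c) ^ E"
      "\<forall>i\<in>I. \<forall>d\<in>S. dist_int (\<Gamma> i d * real q ^ d) \<le> 1 / real (M ^ c)" by blast
    from g[OF M I, of "\<lambda>i. \<Gamma> i d * real q ^ d"] obtain n where n: "1 \<le> n" "n \<le> M ^ g"
      "\<forall>i\<in>I. dist_int (\<Gamma> i d * real q ^ d * real n ^ d) \<le> 1 / real M" by blast
    have "q * n \<le> M ^ (c * E + g)"
      unfolding power_add power_mult using q n by (intro mult_mono) auto
    moreover have "1 \<le> q * n" using q n by (simp add: Suc_le_eq)
    moreover have "dist_int (\<Gamma> i e * real (q * n) ^ e) \<le> 1 / real M" if i: "i \<in> I" and e: "e \<in> insert d S" for i e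
    proof (cases "e = d")
      case True
      then show ?thesis using n(3) i by (simp add: power_mult_distrib mult.assoc)
    next
      case False
      then have eS: "e \<in> S" using e by simp
      have "dist_int (\<Gamma> i e * real (q * n) ^ e) = dist_int (real (n ^ e) * (\<Gamma> i e * real q ^ e))"
        by (simp add: power_mult_distrib mult_ac)
      also have "\<dots> \<le> real (n ^ e) * dist_int (\<Gamma> i e * real q ^ e)" by (rule dist_int_mult_nat)
      also have "\<dots> \<le> real (M ^ (g * \<Sum>S)) * (1 / real (M ^ c))"
      proof (intro mult_mono of_nat_mono)
        have "n ^ e \<le> (M ^ g) ^ e" using n by (intro power_mono) auto
        also have "\<dots> = M ^ (g * e)" by (simp add: power_mult)
        also have "\<dots> \<le> M ^ (g * \<Sum>S)"
          using M insert.hyps eS by (intro power_increasing mult_left_mono member_le_sum[where f = "\<lambda>x. x"]) auto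
        finally show "n ^ e \<le> M ^ (g * \<Sum>S)" .
        show "dist_int (\<Gamma> i e * real q ^ e) \<le> 1 / real (M ^ c)" using q(3) i eS by blast
      qed (auto simp: dist_int_nonneg)
      also have "\<dots> = 1 / real M" using M by (simp add: c_def)
      finally show ?thesis .
    qed
    ultimately show "\<exists>q\<ge>1. q \<le> M ^ (c * E + g) \<and> (\<forall>i\<in>I. \<forall>d\<in>insert d S. dist_int (\<Gamma> i d * real q ^ d) \<le> 1 / real M)"
      by blast
  qed
qed

section \<open>Small fractional parts of pseudo-polynomials\<close>

text \<open>The accuracy demanded of \<open>q\<close> depends on the range of the multiplier
  \<open>n\<close>, and \<open>q\<close> in turn rescales the coefficients for which
  \<open>n\<close> is sought. The circle is broken because \<open>recurrence_property\<close>
  measures coefficients against its own range.\<close>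

lemma simultaneous_gen_poly:
  fixes C\<^sub>0 :: real
  assumes \<Theta>: "finite \<Theta>" "\<forall>\<theta>\<in>\<Theta>. 1 \<le> \<theta>"
  shows "\<exists>E. \<exists>M\<^sub>0\<ge>2. \<forall>M\<ge>M\<^sub>0. \<forall>I (\<Gamma> :: nat \<Rightarrow> real \<Rightarrow> real). finite I \<longrightarrow> card I = D \<longrightarrow>
    (\<forall>i\<in>I. \<forall>\<theta>\<in>\<Theta>. \<bar>\<Gamma> i \<theta>\<bar> \<le> C\<^sub>0) \<longrightarrow>
    (\<exists>n\<ge>1. n \<le> M ^ E \<and> (\<forall>i\<in>I. dist_int (gen_poly \<Theta> (\<Gamma> i) (real n) - (\<Sum>\<theta>\<in>\<Theta> - \<nat>. \<Gamma> i \<theta>) / real M) \<le> 1 / (real M)\<^sup>2))"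
proof -
  obtain Tm :: nat where Tm: "\<And>\<theta>. \<theta> \<in> \<Theta> \<Longrightarrow> \<theta> \<le> real Tm"
    using finite_real_set_bound[OF \<Theta>(1)] by blast
  define S where "S = {d :: nat. real d \<in> \<Theta>}"
  have S: "finite S" unfolding S_def using finite_vimageI[OF \<Theta>(1), of real] by (simp add: vimage_def)
  have S1: "\<forall>d\<in>S. 1 \<le> d" using \<Theta>(2) by (auto simp: S_def)
  have ST: "d \<le> Tm" if "d \<in> S" for d using Tm[of "real d"] that by (simp add: S_def)
  obtain E\<^sub>1 where E0: "\<forall>M\<ge>2. \<forall>I (\<Gamma> :: nat \<Rightarrow> nat \<Rightarrow> real). finite I \<longrightarrow> card I = D \<longrightarrow>
    (\<exists>q\<ge>1. q \<le> M ^ E\<^sub>1 \<and> (\<forall>i\<in>I. \<forall>d\<in>S. dist_int (\<Gamma> i d * real q ^ d) \<le> 1 / real M))"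
    using simultaneous_monomials[OF S S1, of D] by (elim exE)
  \<comment> \<open>For an integral exponent \<open>d\<close> one has
    \<open>n ^ d <= Z ^ Tm\<close>; accuracy \<open>1 / Z ^ (Tm + 1)\<close> at \<open>q\<close>
    therefore leaves \<open>1 / Z\<close>.\<close>
  define u where "u = Tm + 1"
  \<comment> \<open>Free of \<open>g\<close>: relative to \<open>Z = N ^ g\<close> the factor
    \<open>q powr \<theta>\<close> is at most \<open>Z ^ (u * E\<^sub>1 * Tm)\<close>, and the extra
    1 accounts for \<open>C\<^sub>0 <= Z\<close>.\<close>
  define B where "B = u * E\<^sub>1 * Tm + 1"
  define \<Theta>' where "\<Theta>' = \<Theta> - \<nat>"
  have \<Theta>': "finite \<Theta>'" "\<And>\<theta>. \<theta> \<in> \<Theta>' \<Longrightarrow> 1 \<le> \<theta>" "\<Theta>' \<inter> \<nat> = {}" using \<Theta> by (auto simp: \<Theta>'_def)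
  have "recurrence_property \<Theta>' D"
    using \<Theta>' by (intro recurrence_from_inverse inverse_property_nonint)
  then obtain g where g1: "g \<ge> 1" and g0: "\<forall>M\<ge>2. \<forall>I (\<Gamma> :: nat \<Rightarrow> real \<Rightarrow> real) t. finite I \<longrightarrow> card I = D \<longrightarrow>
     (\<forall>i\<in>I. \<forall>\<theta>\<in>\<Theta>'. \<theta> \<notin> \<nat> \<longrightarrow> \<bar>\<Gamma> i \<theta>\<bar> \<le> (real M ^ g) ^ B) \<longrightarrow>
     (\<forall>\<theta>\<in>\<Theta>'. \<bar>t \<theta>\<bar> \<le> 1 \<and> (\<theta> \<in> \<nat> \<longrightarrow> t \<theta> = 0)) \<longrightarrow>
     (\<exists>n\<ge>1. n \<le> M ^ g \<and>
        (\<forall>i\<in>I. dist_int (gen_poly \<Theta>' (\<Gamma> i) (real n) - (\<Sum>\<theta>\<in>\<Theta>'. t \<theta> * \<Gamma> i \<theta>)) \<le> 1 / real M))"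
    unfolding recurrence_property_def by blast
  define M\<^sub>0 where "M\<^sub>0 = nat \<lceil>C\<^sub>0\<rceil> + card S + 2"
  define E where "E = 3 * g * (u * E\<^sub>1 + 1)"
  show ?thesis
  proof (rule exI[of _ E], rule exI[of _ M\<^sub>0], rule conjI, simp add: M\<^sub>0_def, intro allI impI)
    fix M :: nat and I :: "nat set" and \<Gamma> :: "nat \<Rightarrow> real \<Rightarrow> real"
    assume M: "M\<^sub>0 \<le> M" and I: "finite I" "card I = D" and \<Gamma>: "\<forall>i\<in>I. \<forall>\<theta>\<in>\<Theta>. \<bar>\<Gamma> i \<theta>\<bar> \<le> C\<^sub>0"
    have M2: "2 \<le> M" using M by (simp add: M\<^sub>0_def)
    \<comment> \<open>There are \<open>card S + 1 <= M\<close> errors of size \<open>1 / N\<close>,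
      and their total must not exceed \<open>1 / M ^ 2\<close>.\<close>
    define N where "N = M ^ 3"
    define Z where "Z = N ^ g"
    have MN: "M \<le> N" unfolding N_def using M2 by (intro self_le_power) auto
    have NZ: "N \<le> Z" unfolding Z_def using g1 M2 MN by (intro self_le_power) auto
    have N2: "2 \<le> N" and Z2: "2 \<le> Z" using M2 MN NZ by auto
    have "C\<^sub>0 \<le> real M" using M unfolding M\<^sub>0_def by linarith
    then have C\<^sub>0Z: "C\<^sub>0 \<le> real Z" using MN NZ by linarith
    have "Z \<le> Z ^ u" unfolding u_def using Z2 by (intro self_le_power) auto
    then have Zu: "2 \<le> Z ^ u" using Z2 by linarith
    obtain q where q: "1 \<le> q" "q \<le> (Z ^ u) ^ E\<^sub>1"
      "\<forall>i\<in>I. \<forall>d\<in>S. dist_int (\<Gamma> i (real d) * real q ^ d) \<le> 1 / real (Z ^ u)"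
      using E0[THEN spec, THEN mp, OF Zu, THEN spec[of _ I], THEN spec[of _ "\<lambda>i d. \<Gamma> i (real d)"], THEN mp, OF I(1), THEN mp, OF I(2)]
      by (elim exE conjE)
    define \<Gamma>' where "\<Gamma>' = (\<lambda>i \<theta>. \<Gamma> i \<theta> * real q powr \<theta>)"
    \<comment> \<open>The factor \<open>q powr (- \<theta>)\<close> undoes the rescaling in
      \<open>\<Gamma>'\<close>, so the target stays the sum of the
      \<open>\<Gamma> i \<theta>\<close> divided by \<open>M\<close>.\<close>
    define t where "t = (\<lambda>\<theta>. 1 / real M * real q powr (- \<theta>))"
    have \<Gamma>': "\<forall>i\<in>I. \<forall>\<theta>\<in>\<Theta>'. \<theta> \<notin> \<nat> \<longrightarrow> \<bar>\<Gamma>' i \<theta>\<bar> \<le> (real N ^ g) ^ B"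
    proof (intro ballI impI)
      fix i \<theta> assume i: "i \<in> I" and \<theta>: "\<theta> \<in> \<Theta>'"
      then have \<theta>T: "\<theta> \<in> \<Theta>" by (simp add: \<Theta>'_def)
      have "real q powr \<theta> \<le> real q powr real Tm" using q(1) Tm[OF \<theta>T] by (intro powr_mono) auto
      also have "\<dots> = real q ^ Tm" using q(1) by (simp add: powr_realpow)
      also have "\<dots> \<le> real ((Z ^ u) ^ E\<^sub>1) ^ Tm" using q(2) by (intro power_mono of_nat_mono) auto
      also have "\<dots> = real Z ^ (u * E\<^sub>1 * Tm)" by (simp add: power_mult)
      finally have "real q powr \<theta> \<le> real Z ^ (u * E\<^sub>1 * Tm)" .
      moreover have "\<bar>\<Gamma> i \<theta>\<bar> \<le> real Z" using \<Gamma> i \<theta>T C\<^sub>0Z by (meson order_trans)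
      ultimately have "\<bar>\<Gamma> i \<theta>\<bar> * real q powr \<theta> \<le> real Z * real Z ^ (u * E\<^sub>1 * Tm)" by (intro mult_mono) auto
      then show "\<bar>\<Gamma>' i \<theta>\<bar> \<le> (real N ^ g) ^ B" by (simp add: \<Gamma>'_def abs_mult B_def Z_def)
    qed
    have t: "\<forall>\<theta>\<in>\<Theta>'. \<bar>t \<theta>\<bar> \<le> 1 \<and> (\<theta> \<in> \<nat> \<longrightarrow> t \<theta> = 0)"
    proof (intro ballI conjI impI)
      fix \<theta> assume \<theta>: "\<theta> \<in> \<Theta>'"
      have "real q powr (- \<theta>) \<le> real q powr 0" using q(1) \<Theta>'(2)[OF \<theta>] by (intro powr_mono) auto
      also have "\<dots> = 1" using q by simp
      finally have "1 / real M * real q powr (- \<theta>) \<le> 1 * 1" using M2 by (intro mult_mono) auto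
      then show "\<bar>t \<theta>\<bar> \<le> 1" by (simp add: t_def abs_mult)
      assume "\<theta> \<in> \<nat>"
      then show "t \<theta> = 0" using \<theta> \<Theta>'(3) by auto
    qed
    obtain n where n: "1 \<le> n" "n \<le> N ^ g"
      "\<forall>i\<in>I. dist_int (gen_poly \<Theta>' (\<Gamma>' i) (real n) - (\<Sum>\<theta>\<in>\<Theta>'. t \<theta> * \<Gamma>' i \<theta>)) \<le> 1 / real N"
      using g0[THEN spec, THEN mp, OF N2, THEN spec[of _ I], THEN spec[of _ \<Gamma>'], THEN spec[of _ t], THEN mp, OF I(1),
          THEN mp, OF I(2), THEN mp, OF \<Gamma>', THEN mp, OF t]
      by (elim exE conjE)
    have "q * n \<le> M ^ E"
    proof -
      have "q * n \<le> (Z ^ u) ^ E\<^sub>1 * Z" using q(2) n(2) unfolding Z_def by (intro mult_mono) auto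
      also have "\<dots> = Z ^ (u * E\<^sub>1 + 1)" by (simp only: power_add power_mult power_one_right)
      also have "\<dots> = M ^ E" by (simp only: Z_def N_def E_def power_mult)
      finally show ?thesis .
    qed
    moreover have "1 \<le> q * n" using q n by (simp add: Suc_le_eq)
    moreover have "dist_int (gen_poly \<Theta> (\<Gamma> i) (real (q * n)) - (\<Sum>\<theta>\<in>\<Theta> - \<nat>. \<Gamma> i \<theta>) / real M) \<le> 1 / (real M)\<^sup>2"
      if i: "i \<in> I" for i
    proof -
      have int_part: "(\<Sum>\<theta>\<in>\<Theta> \<inter> \<nat>. \<Gamma> i \<theta> * real (q * n) powr \<theta>) = (\<Sum>d\<in>S. real (n ^ d) * (\<Gamma> i (real d) * real q ^ d))"
      proof (rule sum.reindex_bij_witness[where i = real and j = "\<lambda>\<theta>. nat \<lfloor>\<theta>\<rfloor>"])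
        fix d assume "d \<in> S"
        then show "real d \<in> \<Theta> \<inter> \<nat>" by (simp add: S_def)
      next
        fix \<theta> assume "\<theta> \<in> \<Theta> \<inter> \<nat>"
        then obtain d where d: "\<theta> = real d" "real d \<in> \<Theta>" by (auto elim: Nats_cases)
        then show "nat \<lfloor>\<theta>\<rfloor> \<in> S" "real (nat \<lfloor>\<theta>\<rfloor>) = \<theta>" by (auto simp: S_def)
        have "0 < real (q * n)" using q n by simp
        then show "real (n ^ nat \<lfloor>\<theta>\<rfloor>) * (\<Gamma> i (real (nat \<lfloor>\<theta>\<rfloor>)) * real q ^ nat \<lfloor>\<theta>\<rfloor>) = \<Gamma> i \<theta> * real (q * n) powr \<theta>"
          unfolding d by (subst powr_realpow) (auto simp: power_mult_distrib mult_ac)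
      qed simp
      have frac_part: "(\<Sum>\<theta>\<in>\<Theta>'. \<Gamma> i \<theta> * real (q * n) powr \<theta>) = gen_poly \<Theta>' (\<Gamma>' i) (real n)"
        unfolding gen_poly_def \<Gamma>'_def by (intro sum.cong) (auto simp: powr_mult)
      have target: "(\<Sum>\<theta>\<in>\<Theta> - \<nat>. \<Gamma> i \<theta>) / real M = (\<Sum>\<theta>\<in>\<Theta>'. t \<theta> * \<Gamma>' i \<theta>)"
        unfolding sum_divide_distrib \<Theta>'_def t_def \<Gamma>'_def
        using q(1) by (intro sum.cong) (auto simp: powr_minus field_simps)
      have "gen_poly \<Theta> (\<Gamma> i) (real (q * n)) = (\<Sum>\<theta>\<in>\<Theta> \<inter> \<nat>. \<Gamma> i \<theta> * real (q * n) powr \<theta>) + (\<Sum>\<theta>\<in>\<Theta>'. \<Gamma> i \<theta> * real (q * n) powr \<theta>)"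
        unfolding gen_poly_def \<Theta>'_def using \<Theta>(1) by (rule sum.Int_Diff)
      then have eq: "gen_poly \<Theta> (\<Gamma> i) (real (q * n)) - (\<Sum>\<theta>\<in>\<Theta> - \<nat>. \<Gamma> i \<theta>) / real M
        = (\<Sum>d\<in>S. real (n ^ d) * (\<Gamma> i (real d) * real q ^ d)) + (gen_poly \<Theta>' (\<Gamma>' i) (real n) - (\<Sum>\<theta>\<in>\<Theta>'. t \<theta> * \<Gamma>' i \<theta>))"
        unfolding int_part frac_part target by simp
      have "dist_int (\<Sum>d\<in>S. real (n ^ d) * (\<Gamma> i (real d) * real q ^ d)) \<le> (\<Sum>d\<in>S. dist_int (real (n ^ d) * (\<Gamma> i (real d) * real q ^ d)))"
        by (rule dist_int_sum)
      also have "\<dots> \<le> (\<Sum>d\<in>S. 1 / real N)"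
      proof (rule sum_mono)
        fix d assume d: "d \<in> S"
        have "dist_int (real (n ^ d) * (\<Gamma> i (real d) * real q ^ d)) \<le> real (n ^ d) * dist_int (\<Gamma> i (real d) * real q ^ d)"
          by (rule dist_int_mult_nat)
        also have "\<dots> \<le> real (Z ^ Tm) * (1 / real (Z ^ u))"
        proof (intro mult_mono of_nat_mono)
          have "n ^ d \<le> Z ^ d" using n(2) unfolding Z_def by (intro power_mono) auto
          also have "\<dots> \<le> Z ^ Tm" using Z2 ST[OF d] by (intro power_increasing) auto
          finally show "n ^ d \<le> Z ^ Tm" .
          show "dist_int (\<Gamma> i (real d) * real q ^ d) \<le> 1 / real (Z ^ u)" using q(3) i d by blast
        qed (auto simp: dist_int_nonneg)
        also have "\<dots> = 1 / real Z" using Z2 by (simp add: u_def)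
        also have "\<dots> \<le> 1 / real N" using N2 NZ by (intro divide_left_mono) auto
        finally show "dist_int (real (n ^ d) * (\<Gamma> i (real d) * real q ^ d)) \<le> 1 / real N" .
      qed
      also have "\<dots> = real (card S) / real N" by simp
      finally have "dist_int (\<Sum>d\<in>S. real (n ^ d) * (\<Gamma> i (real d) * real q ^ d)) \<le> real (card S) / real N" .
      then have "dist_int (gen_poly \<Theta> (\<Gamma> i) (real (q * n)) - (\<Sum>\<theta>\<in>\<Theta> - \<nat>. \<Gamma> i \<theta>) / real M) \<le> real (card S) / real N + 1 / real N"
        unfolding eq by (intro order_trans[OF dist_int_add] add_mono bspec[OF n(3) i])
      also have "\<dots> = real (card S + 1) / real N" by (simp add: add_divide_distrib)
      also have "\<dots> \<le> real M / real N" using M by (intro divide_right_mono of_nat_mono) (auto simp: M\<^sub>0_def)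
      also have "\<dots> = 1 / (real M)\<^sup>2" using M2 by (simp add: N_def power2_eq_square power3_eq_cube)
      finally show ?thesis .
    qed
    ultimately show "\<exists>n\<ge>1. n \<le> M ^ E \<and> (\<forall>i\<in>I. dist_int (gen_poly \<Theta> (\<Gamma> i) (real n) - (\<Sum>\<theta>\<in>\<Theta> - \<nat>. \<Gamma> i \<theta>) / real M) \<le> 1 / (real M)\<^sup>2)"
      by blast
  qed
qed

section \<open>Pseudo-polynomials over a common set of exponents, and their floors\<close>

lemma pseudo_poly_as_gen_poly:
  assumes "pseudo_poly f"
  shows "\<exists>\<Theta> \<beta>. finite \<Theta> \<and> (\<forall>\<theta>\<in>\<Theta>. 1 \<le> \<theta>) \<and> (\<forall>\<theta>. 0 \<le> \<beta> \<theta>) \<and> (\<forall>\<theta>. \<theta> \<notin> \<Theta> \<longrightarrow> \<beta> \<theta> = 0) \<and>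
    (\<exists>\<theta>\<in>\<Theta> - \<nat>. 0 < \<beta> \<theta>) \<and> (\<forall>x>0. f x = gen_poly \<Theta> \<beta> x)"
proof -
  obtain d \<alpha> \<theta> where *: "d \<ge> (1::nat)" "\<forall>j\<in>{1..d}. \<alpha> j > 0" "1 \<le> \<theta> 1" "strict_mono_on {1..d} \<theta>"
    "\<exists>j\<in>{1..d}. \<theta> j \<notin> \<int>" "\<forall>x>0. f x = (\<Sum>j=1..d. \<alpha> j * x powr \<theta> j)"
    using assms unfolding pseudo_poly_def by blast
  \<comment> \<open>Coefficients are indexed by the exponent itself and vanish off the image of
    \<open>\<theta>\<close>, so that several functions can be written over the union of their
    exponent sets.\<close>
  define \<beta> where "\<beta> = (\<lambda>\<tau>. \<Sum>j\<in>{j\<in>{1..d}. \<theta> j = \<tau>}. \<alpha> j)"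
  have \<beta>_nonneg: "0 \<le> \<beta> \<tau>" for \<tau> unfolding \<beta>_def using *(2) by (intro sum_nonneg) (auto intro: less_imp_le)
  have \<theta>1: "1 \<le> \<theta> j" if "j \<in> {1..d}" for j
  proof -
    have "\<theta> 1 \<le> \<theta> j"
      using strict_mono_onD[OF *(4), of 1 j] that by (cases "j = 1") auto
    then show ?thesis using *(3) by simp
  qed
  obtain j where j: "j \<in> {1..d}" "\<theta> j \<notin> \<int>" using *(5) by blast
  have "\<theta> j \<in> \<theta> ` {1..d} - \<nat>" using j Nats_subset_Ints by blast
  moreover have "0 < \<beta> (\<theta> j)"
    unfolding \<beta>_def using *(2) j by (intro sum_pos2[where i = j]) (auto intro: less_imp_le)
  moreover have "f x = gen_poly (\<theta> ` {1..d}) \<beta> x" if "x > 0" for x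
  proof -
    have "f x = (\<Sum>j=1..d. \<alpha> j * x powr \<theta> j)" using *(6) that by blast
    also have "\<dots> = (\<Sum>\<tau>\<in>\<theta> ` {1..d}. \<Sum>j\<in>{j\<in>{1..d}. \<theta> j = \<tau>}. \<alpha> j * x powr \<theta> j)"
      by (rule sum.image_gen) simp
    also have "\<dots> = gen_poly (\<theta> ` {1..d}) \<beta> x"
      unfolding gen_poly_def \<beta>_def sum_distrib_right by (intro sum.cong) auto
    finally show ?thesis .
  qed
  moreover have "\<beta> \<tau> = 0" if "\<tau> \<notin> \<theta> ` {1..d}" for \<tau>
  proof -
    have "{j\<in>{1..d}. \<theta> j = \<tau>} = {}" using that by auto
    then show ?thesis unfolding \<beta>_def by (simp only: sum.empty)
  qed
  ultimately show ?thesis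
    using \<theta>1 \<beta>_nonneg by (intro exI[of _ "\<theta> ` {1..d}"] exI[of _ \<beta>]) blast
qed

text \<open>There are \<open>k + l\<close> coordinates: the functions themselves, which determine
  the floors, and the combinations given by the rows of the matrix. All targets come from the same
  linear form, so the shifts \<open>p j / M\<close> cancel when the floors are combined.\<close>

lemma floors_near_integers:
  fixes f :: "nat \<Rightarrow> real \<Rightarrow> real"
  assumes "\<forall>j\<in>{1..k}. pseudo_poly (f j)"
  shows "\<exists>E M\<^sub>0. \<forall>M\<ge>M\<^sub>0. M \<ge> 1 \<longrightarrow> (\<forall>A :: nat \<Rightarrow> nat \<Rightarrow> real. \<exists>n\<ge>1. n \<le> M ^ E \<and>
    (\<forall>i\<in>{1..l}. dist_int (\<Sum>j=1..k. A i j * of_int \<lfloor>f j (real n)\<rfloor>) \<le> 1 / real M))"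
proof -
  define P where "P = (\<lambda>j \<Theta> \<beta>. finite \<Theta> \<and> (\<forall>\<theta>\<in>\<Theta>. 1 \<le> \<theta>) \<and> (\<forall>\<theta>. 0 \<le> \<beta> \<theta>) \<and> (\<forall>\<theta>. \<theta> \<notin> \<Theta> \<longrightarrow> \<beta> \<theta> = 0) \<and>
    (\<exists>\<theta>\<in>\<Theta> - \<nat>. 0 < \<beta> \<theta>) \<and> (\<forall>x>0. f j x = gen_poly \<Theta> \<beta> x))"
  have "\<forall>j\<in>{1..k}. \<exists>c. P j (fst c) (snd c)"
  proof
    fix j assume "j \<in> {1..k}"
    then have "\<exists>\<Theta> \<beta>. P j \<Theta> \<beta>" unfolding P_def using assms by (intro pseudo_poly_as_gen_poly) blast
    then show "\<exists>c. P j (fst c) (snd c)" by force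
  qed
  then obtain c where c: "\<forall>j\<in>{1..k}. P j (fst (c j)) (snd (c j))" by (rule bchoice[THEN exE])
  define \<beta> where "\<beta> = (\<lambda>j. snd (c j))"
  define \<Theta> where "\<Theta> = (\<Union>j\<in>{1..k}. fst (c j))"
  have \<Theta>: "finite \<Theta>" "\<forall>\<theta>\<in>\<Theta>. 1 \<le> \<theta>" using c by (auto simp: \<Theta>_def P_def)
  have \<beta>_nonneg: "0 \<le> \<beta> j \<theta>" if "j \<in> {1..k}" for j \<theta> using c that by (auto simp: \<beta>_def P_def)
  have f_eq: "f j x = gen_poly \<Theta> (\<beta> j) x" if "j \<in> {1..k}" "x > 0" for j x
  proof -
    have "f j x = gen_poly (fst (c j)) (\<beta> j) x" using c that by (auto simp: \<beta>_def P_def)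
    also have "\<dots> = gen_poly \<Theta> (\<beta> j) x"
      unfolding gen_poly_def
    proof (rule sum.mono_neutral_left)
      show "\<forall>\<theta>\<in>\<Theta> - fst (c j). \<beta> j \<theta> * x powr \<theta> = 0" using c that by (auto simp: \<beta>_def P_def)
    qed (use \<Theta> that in \<open>auto simp: \<Theta>_def\<close>)
    finally show ?thesis .
  qed
  define p where "p = (\<lambda>j. \<Sum>\<theta>\<in>\<Theta> - \<nat>. \<beta> j \<theta>)"
  have p_pos: "0 < p j" if j: "j \<in> {1..k}" for j
  proof -
    obtain \<theta> where "\<theta> \<in> fst (c j) - \<nat>" "0 < \<beta> j \<theta>" using c j unfolding P_def \<beta>_def by blast
    then show ?thesis unfolding p_def using \<Theta>(1) \<beta>_nonneg[OF j] j
      by (intro sum_pos2[where i = \<theta>]) (auto simp: \<Theta>_def)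
  qed
  define C\<^sub>0 where "C\<^sub>0 = (\<Sum>j=1..k. \<Sum>\<theta>\<in>\<Theta>. \<beta> j \<theta>)"
  obtain E M\<^sub>1 where M\<^sub>1: "M\<^sub>1 \<ge> (2::nat)" and main0: "\<forall>M\<ge>M\<^sub>1. \<forall>I (\<Gamma> :: nat \<Rightarrow> real \<Rightarrow> real). finite I \<longrightarrow> card I = k + l \<longrightarrow>
    (\<forall>i\<in>I. \<forall>\<theta>\<in>\<Theta>. \<bar>\<Gamma> i \<theta>\<bar> \<le> C\<^sub>0) \<longrightarrow>
    (\<exists>n\<ge>1. n \<le> M ^ E \<and> (\<forall>i\<in>I. dist_int (gen_poly \<Theta> (\<Gamma> i) (real n) - (\<Sum>\<theta>\<in>\<Theta> - \<nat>. \<Gamma> i \<theta>) / real M) \<le> 1 / (real M)\<^sup>2))"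
    using simultaneous_gen_poly[OF \<Theta>, of "k + l" C\<^sub>0] by (elim exE conjE)
  \<comment> \<open>Guarantees \<open>1 / M <= p j\<close> and \<open>p j + 2 <= M\<close>, so a
    point within \<open>1 / M ^ 2\<close> of \<open>p j / M\<close> stays in \<open>[0, 1)\<close>,
    and \<open>k + 1 <= M\<close>, so \<open>k + 1\<close> errors of this size add up to at most
    \<open>1 / M\<close>.\<close>
  define M\<^sub>0 where "M\<^sub>0 = M\<^sub>1 + nat \<lceil>\<Sum>j=1..k. 1 / p j\<rceil> + nat \<lceil>\<Sum>j=1..k. p j\<rceil> + k + 2"
  show ?thesis
  proof (rule exI[of _ E], rule exI[of _ M\<^sub>0], intro allI impI)
    fix M :: nat and A :: "nat \<Rightarrow> nat \<Rightarrow> real"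
    assume M: "M\<^sub>0 \<le> M" and M1: "1 \<le> M"
    \<comment> \<open>The integer part of an entry contributes an integer. The fractional part is
      bounded by 1, which makes \<open>C\<^sub>0\<close> and all later constants independent of
      \<open>A\<close>.\<close>
    define b where "b = (\<lambda>i j. frac (A i j))"
    have b: "0 \<le> b i j" "b i j \<le> 1" for i j unfolding b_def by (auto simp: frac_ge_0 less_imp_le[OF frac_lt_1])
    define \<Gamma> where "\<Gamma> = (\<lambda>i. if i \<le> k then \<beta> i else (\<lambda>\<theta>. \<Sum>j=1..k. b (i - k) j * \<beta> j \<theta>))"
    have "\<forall>i\<in>{1..k + l}. \<forall>\<theta>\<in>\<Theta>. \<bar>\<Gamma> i \<theta>\<bar> \<le> C\<^sub>0"
    proof (intro ballI)
      fix i \<theta> assume i: "i \<in> {1..k + l}" and \<theta>: "\<theta> \<in> \<Theta>"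
      have inner: "\<beta> j \<theta> \<le> (\<Sum>\<theta>\<in>\<Theta>. \<beta> j \<theta>)" if "j \<in> {1..k}" for j
        using \<Theta>(1) \<theta> \<beta>_nonneg[OF that] by (intro member_le_sum) auto
      show "\<bar>\<Gamma> i \<theta>\<bar> \<le> C\<^sub>0"
      proof (cases "i \<le> k")
        case True
        then have ik: "i \<in> {1..k}" using i by simp
        have "\<bar>\<Gamma> i \<theta>\<bar> = \<beta> i \<theta>" using True \<beta>_nonneg[OF ik] by (simp add: \<Gamma>_def)
        also have "\<dots> \<le> (\<Sum>\<theta>\<in>\<Theta>. \<beta> i \<theta>)" using inner ik by blast
        also have "\<dots> \<le> C\<^sub>0"
          unfolding C\<^sub>0_def using ik \<beta>_nonneg
          by (intro member_le_sum[where f = "\<lambda>j. \<Sum>\<theta>\<in>\<Theta>. \<beta> j \<theta>"] sum_nonneg) auto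
        finally show ?thesis .
      next
        case False
        have "\<bar>\<Gamma> i \<theta>\<bar> \<le> (\<Sum>j=1..k. \<bar>b (i - k) j * \<beta> j \<theta>\<bar>)" using False by (simp add: \<Gamma>_def sum_abs)
        also have "\<dots> \<le> (\<Sum>j=1..k. 1 * (\<Sum>\<theta>\<in>\<Theta>. \<beta> j \<theta>))"
          unfolding abs_mult using b inner \<beta>_nonneg by (intro sum_mono mult_mono) auto
        also have "\<dots> = C\<^sub>0" by (simp add: C\<^sub>0_def)
        finally show ?thesis .
      qed
    qed
    moreover have "M\<^sub>1 \<le> M" using M by (simp add: M\<^sub>0_def)
    ultimately obtain n where n: "1 \<le> n" "n \<le> M ^ E" and
      near: "\<forall>i\<in>{1..k + l}. dist_int (gen_poly \<Theta> (\<Gamma> i) (real n) - (\<Sum>\<theta>\<in>\<Theta> - \<nat>. \<Gamma> i \<theta>) / real M) \<le> 1 / (real M)\<^sup>2"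
      using main0[rule_format, of M "{1..k + l}" \<Gamma>] by auto
    have n0: "0 < real n" using n by simp
    have Mk: "real k + 1 \<le> real M" using M unfolding M\<^sub>0_def by linarith
    have M0: "0 < real M" using M1 by simp
    define e where "e = (\<lambda>j. f j (real n) - of_int \<lfloor>f j (real n)\<rfloor> - p j / real M)"
    have e: "\<bar>e j\<bar> \<le> 1 / (real M)\<^sup>2" if j: "j \<in> {1..k}" for j
    proof -
      have "dist_int (f j (real n) - p j / real M) \<le> 1 / (real M)\<^sup>2"
        using near j f_eq[OF j n0] by (auto simp: \<Gamma>_def p_def dest: bspec[of _ _ j])
      then obtain m where m: "\<bar>f j (real n) - p j / real M - of_int m\<bar> \<le> 1 / (real M)\<^sup>2"
        using dist_int_obtain by metis
      have "1 / p j \<le> (\<Sum>j=1..k. 1 / p j)"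
        using j p_pos by (intro member_le_sum) (auto intro: less_imp_le)
      then have "1 / p j \<le> real M" using M unfolding M\<^sub>0_def by linarith
      then have "1 / real M \<le> p j" using p_pos[OF j] M0 by (simp add: field_simps)
      then have lower: "1 / (real M)\<^sup>2 \<le> p j / real M"
        using M0 by (simp add: power2_eq_square field_simps)
      have "p j \<le> (\<Sum>j=1..k. p j)"
        using j p_pos by (intro member_le_sum) (auto intro: less_imp_le)
      then have "p j + 2 \<le> real M" using M unfolding M\<^sub>0_def by linarith
      moreover have "1 / real M \<le> 1" using M1 by simp
      ultimately have "p j + 1 / real M < real M" by linarith
      then have "(p j + 1 / real M) / real M < 1" using M0 by simp
      then have upper: "p j / real M + 1 / (real M)\<^sup>2 < 1"
        by (simp add: add_divide_distrib power2_eq_square)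
      have "\<lfloor>f j (real n)\<rfloor> = m"
        using m lower upper by (intro floor_unique) linarith+
      then show ?thesis using m by (simp add: e_def algebra_simps)
    qed
    have "dist_int (\<Sum>j=1..k. A i j * of_int \<lfloor>f j (real n)\<rfloor>) \<le> 1 / real M" if i: "i \<in> {1..l}" for i
    proof -
      have ki: "k + i \<in> {1..k + l}" "\<not> k + i \<le> k" using i by auto
      have comb: "gen_poly \<Theta> (\<Gamma> (k + i)) (real n) = (\<Sum>j=1..k. b i j * f j (real n))"
      proof -
        have "gen_poly \<Theta> (\<Gamma> (k + i)) (real n) = (\<Sum>\<theta>\<in>\<Theta>. \<Sum>j=1..k. b i j * (\<beta> j \<theta> * real n powr \<theta>))"
          unfolding gen_poly_def using ki(2) by (simp add: \<Gamma>_def sum_distrib_right mult.assoc)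
        also have "\<dots> = (\<Sum>j=1..k. \<Sum>\<theta>\<in>\<Theta>. b i j * (\<beta> j \<theta> * real n powr \<theta>))" by (rule sum.swap)
        also have "\<dots> = (\<Sum>j=1..k. b i j * f j (real n))"
          using n0 by (intro sum.cong) (auto simp: f_eq gen_poly_def sum_distrib_left)
        finally show ?thesis .
      qed
      have target: "(\<Sum>\<theta>\<in>\<Theta> - \<nat>. \<Gamma> (k + i) \<theta>) = (\<Sum>j=1..k. b i j * p j)"
      proof -
        have "(\<Sum>\<theta>\<in>\<Theta> - \<nat>. \<Gamma> (k + i) \<theta>) = (\<Sum>\<theta>\<in>\<Theta> - \<nat>. \<Sum>j=1..k. b i j * \<beta> j \<theta>)"
          using ki(2) by (simp add: \<Gamma>_def)
        also have "\<dots> = (\<Sum>j=1..k. \<Sum>\<theta>\<in>\<Theta> - \<nat>. b i j * \<beta> j \<theta>)" by (rule sum.swap)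
        finally show ?thesis by (simp add: p_def sum_distrib_left)
      qed
      have "(\<Sum>j=1..k. A i j * of_int \<lfloor>f j (real n)\<rfloor>)
        = (gen_poly \<Theta> (\<Gamma> (k + i)) (real n) - (\<Sum>\<theta>\<in>\<Theta> - \<nat>. \<Gamma> (k + i) \<theta>) / real M)
          + - (\<Sum>j=1..k. b i j * e j) + (\<Sum>j=1..k. of_int (\<lfloor>A i j\<rfloor> * \<lfloor>f j (real n)\<rfloor>))"
      proof -
        \<comment> \<open>Split \<open>A i j\<close> into floor and fractional part, and replace the
          floor of \<open>f j n\<close> by \<open>f j n - p j / M - e j\<close> in the product with
          the latter.\<close>
        have "A i j * of_int \<lfloor>f j (real n)\<rfloor> = b i j * f j (real n) - b i j * p j / real M - b i j * e j + of_int (\<lfloor>A i j\<rfloor> * \<lfloor>f j (real n)\<rfloor>)" for j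
          by (simp add: b_def e_def frac_def algebra_simps diff_divide_distrib)
        then show ?thesis
          unfolding comb target by (simp add: sum.distrib sum_subtractf sum_divide_distrib)
      qed
      moreover have "(\<Sum>j=1..k. real_of_int (\<lfloor>A i j\<rfloor> * \<lfloor>f j (real n)\<rfloor>)) \<in> \<int>"
        by (intro Ints_sum Ints_of_int)
      ultimately have "dist_int (\<Sum>j=1..k. A i j * of_int \<lfloor>f j (real n)\<rfloor>)
        = dist_int ((gen_poly \<Theta> (\<Gamma> (k + i)) (real n) - (\<Sum>\<theta>\<in>\<Theta> - \<nat>. \<Gamma> (k + i) \<theta>) / real M) + - (\<Sum>j=1..k. b i j * e j))"
        by (simp only: dist_int_add_Ints)
      also have "\<dots> \<le> 1 / (real M)\<^sup>2 + real k * (1 / (real M)\<^sup>2)"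
      proof (rule order_trans[OF dist_int_add], rule add_mono)
        show "dist_int (gen_poly \<Theta> (\<Gamma> (k + i)) (real n) - (\<Sum>\<theta>\<in>\<Theta> - \<nat>. \<Gamma> (k + i) \<theta>) / real M) \<le> 1 / (real M)\<^sup>2"
          using near ki by blast
        have "dist_int (- (\<Sum>j=1..k. b i j * e j)) \<le> \<bar>\<Sum>j=1..k. b i j * e j\<bar>"
          using dist_int_le_abs[of "- (\<Sum>j=1..k. b i j * e j)"] by simp
        also have "\<dots> \<le> (\<Sum>j=1..k. \<bar>b i j * e j\<bar>)" by (rule sum_abs)
        also have "\<dots> \<le> (\<Sum>j=1..k. 1 * (1 / (real M)\<^sup>2))"
          unfolding abs_mult using b e by (intro sum_mono mult_mono) auto
        also have "\<dots> = real k * (1 / (real M)\<^sup>2)" by simp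
        finally show "dist_int (- (\<Sum>j=1..k. b i j * e j)) \<le> real k * (1 / (real M)\<^sup>2)" .
      qed
      also have "\<dots> = (real k + 1) / (real M)\<^sup>2" by (simp add: add_divide_distrib)
      also have "\<dots> \<le> real M / (real M)\<^sup>2" using Mk by (intro divide_right_mono) auto
      also have "\<dots> = 1 / real M" using M0 by (simp add: power2_eq_square)
      finally show ?thesis .
    qed
    then show "\<exists>n\<ge>1. n \<le> M ^ E \<and> (\<forall>i\<in>{1..l}. dist_int (\<Sum>j=1..k. A i j * of_int \<lfloor>f j (real n)\<rfloor>) \<le> 1 / real M)"
      using n by blast
  qed
qed

theorem theorem2p11:
  fixes l k :: nat and f :: "nat \<Rightarrow> real \<Rightarrow> real"
  assumes "l \<ge> 1"
    and "\<forall>j\<in>{1..k}. pseudo_poly (f j)"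
    and "Q_lin_indep k f"
  shows "\<exists>\<eta>>0. \<exists>C>0. \<forall>(A::nat \<Rightarrow> nat \<Rightarrow> real) (N::nat). N \<ge> 1 \<longrightarrow>
           Min ((\<lambda>n. Max ((\<lambda>i. dist_int (\<Sum>j=1..k. A i j * of_int \<lfloor>f j (real n)\<rfloor>)) ` {1..l}))
                 ` {1..N})
           \<le> C * real N powr (- \<eta>)"
proof -
  obtain E M\<^sub>0 where main: "\<forall>M\<ge>M\<^sub>0. M \<ge> 1 \<longrightarrow> (\<forall>A :: nat \<Rightarrow> nat \<Rightarrow> real. \<exists>n\<ge>1. n \<le> M ^ E \<and>
    (\<forall>i\<in>{1..l}. dist_int (\<Sum>j=1..k. A i j * of_int \<lfloor>f j (real n)\<rfloor>) \<le> 1 / real M))"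
    using floors_near_integers[OF assms(2), of l] by (elim exE)
  \<comment> \<open>With this exponent the floor \<open>M\<close> of \<open>N powr \<eta>\<close>
    satisfies \<open>M ^ (E + 1) <= N\<close>; using \<open>E + 1\<close> also covers
    \<open>E = 0\<close>.\<close>
  define \<eta> where "\<eta> = 1 / real (E + 1)"
  \<comment> \<open>For \<open>R < M\<^sub>0 + 2\<close> the trivial bound on
    \<open>dist_int\<close> suffices; beyond that the constant only has to absorb the 2 in
    \<open>1 / M <= 2 / R\<close>.\<close>
  define C where "C = real M\<^sub>0 + 2"
  have \<eta>: "0 < \<eta>" by (simp add: \<eta>_def)
  show ?thesis
  proof (rule exI[of _ \<eta>], rule conjI[OF \<eta>], rule exI[of _ C], rule conjI, simp add: C_def, intro allI impI)
    fix A :: "nat \<Rightarrow> nat \<Rightarrow> real" and N :: nat assume N: "1 \<le> N"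
    define x where "x = (\<lambda>n i. dist_int (\<Sum>j=1..k. A i j * of_int \<lfloor>f j (real n)\<rfloor>))"
    define R where "R = real N powr \<eta>"
    have R: "1 \<le> R" using N \<eta> by (simp add: R_def ge_one_powr_ge_zero)
    have R_inv: "real N powr (- \<eta>) = 1 / R" by (simp add: R_def powr_minus_divide)
    have "\<exists>n\<in>{1..N}. \<forall>i\<in>{1..l}. x n i \<le> C / R"
    proof (cases "R < real M\<^sub>0 + 2")
      case True
      then have "1 \<le> C / R" using R by (simp add: C_def)
      then have "x 1 i \<le> C / R" for i
        using dist_int_le_half[of "\<Sum>j=1..k. A i j * of_int \<lfloor>f j (real 1)\<rfloor>"] by (simp add: x_def)
      then show ?thesis using N by (intro bexI[of _ 1]) auto
    next
      case False
      define M where "M = nat \<lfloor>R\<rfloor>"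
      have M: "real M \<le> R" "R < real M + 1" using R by (auto simp: M_def)
      then have M2: "M\<^sub>0 \<le> M" "1 \<le> M" "R \<le> 2 * real M" using False by linarith+
      from main[rule_format, OF M2(1,2)] obtain n where n: "1 \<le> n" "n \<le> M ^ E" "\<forall>i\<in>{1..l}. x n i \<le> 1 / real M"
        unfolding x_def by blast
      have "real n \<le> real M ^ E" using n(2) by (metis of_nat_le_iff of_nat_power)
      also have "\<dots> \<le> real M ^ (E + 1)" using M2 by (intro power_increasing) auto
      also have "\<dots> \<le> R ^ (E + 1)" using M by (intro power_mono) auto
      also have "R ^ (E + 1) = R powr real (E + 1)" using R by (subst powr_realpow) auto
      also have "\<dots> = real N" using N by (simp add: R_def \<eta>_def powr_powr)
      finally have "n \<in> {1..N}" using n(1) by simp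
      moreover have "x n i \<le> C / R" if "i \<in> {1..l}" for i
      proof -
        have "x n i \<le> 1 / real M" using n(3) that by blast
        also have "\<dots> \<le> 2 / R" using M2 R by (simp add: field_simps)
        also have "\<dots> \<le> C / R" using R by (intro divide_right_mono) (auto simp: C_def)
        finally show ?thesis .
      qed
      ultimately show ?thesis by blast
    qed
    then obtain n where n: "n \<in> {1..N}" "\<forall>i\<in>{1..l}. x n i \<le> C / R" by blast
    have "Min ((\<lambda>n. Max (x n ` {1..l})) ` {1..N}) \<le> Max (x n ` {1..l})"
      using n(1) by (intro Min_le) auto
    also have "\<dots> \<le> C / R" using n(2) assms(1) by (subst Max_le_iff) auto
    finally show "Min ((\<lambda>n. Max ((\<lambda>i. dist_int (\<Sum>j=1..k. A i j * of_int \<lfloor>f j (real n)\<rfloor>)) ` {1..l})) ` {1..N})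
        \<le> C * real N powr (- \<eta>)"
      by (simp add: x_def R_inv)
  qed
qed

end
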